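(* Every quasi-injective topos is totally distributive.
   Context: A quasi-injective topos is a Grothendieck topos $\mathcal{E}$ which is a retract, by geometric morphisms (up to isomorphism), of a presheaf topos $[\mathcal{C}^{\mathrm{op}},\mathbf{Set}]$ with $\mathcal{C}$ some small category. For a locally small category $\mathcal{E}$, $\widehat{\mathcal{E}} := [\mathcal{E}^{\mathrm{op}},\mathbf{Set}]$ and $\mathsf{y}:\mathcal{E}\to\widehat{\mathcal{E}}$, $v\mapsto \mathcal{E}(-,v)$, is the Yoneda embedding ($\mathcal{E}$ may be large). $\mathcal{E}$ is totally distributive if it is locally small and there are adjunctions $t\dashv c\dashv \mathsf{y}$ with $c:\widehat{\mathcal{E}}\to\mathcal{E}$ and $t:\mathcal{E}\to\widehat{\mathcal{E}}$. *)

theory Defs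
  imports "HOL-Library.FuncSet"
begin

text \<open>
  The category \<open>Set\<close> of small sets is relative to a Grothendieck universe. Here a universe
  is a type \<open>'u\<close> of (codes of) small sets, with \<open>elts u\<close> the set of elements of \<open>u\<close>. The
  assumptions say that \<open>('u, \<in>)\<close> is a copy of an uncountable Grothendieck universe
  \<open>V\<^sub>\<kappa>\<close>; replacement is second order, since \<open>f\<close> below is an arbitrary function.
\<close>

locale grothendieck_universe =
  fixes elts :: "'u \<Rightarrow> 'u set"
  assumes extensionality: "inj elts"
    and foundation: "wf {(x, y). x \<in> elts y}"
    and pairing: "\<exists>z. elts z = {x, y}"
    and power_set: "\<exists>p. elts ` elts p = Pow (elts x)"
    and union: "\<exists>z. elts z = (\<Union>i\<in>elts I. elts (f i))"
    and infinity: "\<exists>z. infinite (elts z)"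

definition small :: "('u \<Rightarrow> 'u set) \<Rightarrow> 'x set \<Rightarrow> bool" where
  "small elts A \<longleftrightarrow> (\<exists>u f. bij_betw f A (elts u))"

text \<open>Values of the operations outside the carriers \<open>Obj\<close> and \<open>Arr\<close> are irrelevant.\<close>

record ('o, 'a) cat =
  Obj :: "'o set"
  Arr :: "'a set"
  Dom :: "'a \<Rightarrow> 'o"
  Cod :: "'a \<Rightarrow> 'o"
  Ident :: "'o \<Rightarrow> 'a"
  Comp :: "'a \<Rightarrow> 'a \<Rightarrow> 'a" (infixl "\<cdot>\<index>" 70)

definition Hom :: "('o, 'a) cat \<Rightarrow> 'o \<Rightarrow> 'o \<Rightarrow> 'a set" where
  "Hom C x y = {f \<in> Arr C. Dom C f = x \<and> Cod C f = y}"

locale category =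
  fixes C :: "('o, 'a) cat" (structure)
  assumes dom_closed: "f \<in> Arr C \<Longrightarrow> Dom C f \<in> Obj C"
    and cod_closed: "f \<in> Arr C \<Longrightarrow> Cod C f \<in> Obj C"
    and ident_closed: "x \<in> Obj C \<Longrightarrow> Ident C x \<in> Hom C x x"
    and comp_closed: "\<lbrakk>f \<in> Hom C x y; g \<in> Hom C y z\<rbrakk> \<Longrightarrow> g \<cdot> f \<in> Hom C x z"
    and comp_assoc:
      "\<lbrakk>f \<in> Hom C w x; g \<in> Hom C x y; h \<in> Hom C y z\<rbrakk> \<Longrightarrow> (h \<cdot> g) \<cdot> f = h \<cdot> (g \<cdot> f)"
    and ident_left: "f \<in> Hom C x y \<Longrightarrow> Ident C y \<cdot> f = f"
    and ident_right: "f \<in> Hom C x y \<Longrightarrow> f \<cdot> Ident C x = f"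

definition op_cat :: "('o, 'a) cat \<Rightarrow> ('o, 'a) cat" where
  "op_cat C = \<lparr>Obj = Obj C, Arr = Arr C, Dom = Cod C, Cod = Dom C, Ident = Ident C,
               Comp = (\<lambda>g f. f \<cdot>\<^bsub>C\<^esub> g)\<rparr>"

definition full_subcat :: "('o, 'a) cat \<Rightarrow> 'o set \<Rightarrow> ('o, 'a) cat" where
  "full_subcat C S = \<lparr>Obj = Obj C \<inter> S, Arr = {f \<in> Arr C. Dom C f \<in> S \<and> Cod C f \<in> S},
                      Dom = Dom C, Cod = Cod C, Ident = Ident C, Comp = Comp C\<rparr>"

definition iso_arr :: "('o, 'a) cat \<Rightarrow> 'a \<Rightarrow> bool" where
  "iso_arr C f \<longleftrightarrow> f \<in> Arr C \<and>
     (\<exists>g \<in> Hom C (Cod C f) (Dom C f).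
        g \<cdot>\<^bsub>C\<^esub> f = Ident C (Dom C f) \<and> f \<cdot>\<^bsub>C\<^esub> g = Ident C (Cod C f))"

definition small_category :: "('u \<Rightarrow> 'u set) \<Rightarrow> ('o, 'a) cat \<Rightarrow> bool" where
  "small_category elts C \<longleftrightarrow> category C \<and> small elts (Obj C) \<and> small elts (Arr C)"

definition locally_small :: "('u \<Rightarrow> 'u set) \<Rightarrow> ('o, 'a) cat \<Rightarrow> bool" where
  "locally_small elts C \<longleftrightarrow> category C \<and> (\<forall>x\<in>Obj C. \<forall>y\<in>Obj C. small elts (Hom C x y))"

record ('o1, 'a1, 'o2, 'a2) func =
  fobj :: "'o1 \<Rightarrow> 'o2"
  farr :: "'a1 \<Rightarrow> 'a2"

locale cat_functor = dom: category C + cod: category D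
  for C :: "('o1, 'a1) cat" and D :: "('o2, 'a2) cat" +
  fixes F :: "('o1, 'a1, 'o2, 'a2) func"
  assumes fobj_closed: "x \<in> Obj C \<Longrightarrow> fobj F x \<in> Obj D"
    and farr_closed: "f \<in> Hom C x y \<Longrightarrow> farr F f \<in> Hom D (fobj F x) (fobj F y)"
    and farr_ident: "x \<in> Obj C \<Longrightarrow> farr F (Ident C x) = Ident D (fobj F x)"
    and farr_comp:
      "\<lbrakk>f \<in> Hom C x y; g \<in> Hom C y z\<rbrakk> \<Longrightarrow> farr F (g \<cdot>\<^bsub>C\<^esub> f) = farr F g \<cdot>\<^bsub>D\<^esub> farr F f"

definition id_func :: "('o, 'a, 'o, 'a) func" where
  "id_func = \<lparr>fobj = (\<lambda>x. x), farr = (\<lambda>f. f)\<rparr>"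

definition comp_func ::
  "('o2, 'a2, 'o3, 'a3) func \<Rightarrow> ('o1, 'a1, 'o2, 'a2) func \<Rightarrow> ('o1, 'a1, 'o3, 'a3) func" where
  "comp_func G F = \<lparr>fobj = fobj G \<circ> fobj F, farr = farr G \<circ> farr F\<rparr>"

definition natural ::
  "('o1, 'a1) cat \<Rightarrow> ('o2, 'a2) cat \<Rightarrow> ('o1, 'a1, 'o2, 'a2) func \<Rightarrow> ('o1, 'a1, 'o2, 'a2) func
     \<Rightarrow> ('o1 \<Rightarrow> 'a2) \<Rightarrow> bool" where
  "natural C D F G \<tau> \<longleftrightarrow>
     cat_functor C D F \<and> cat_functor C D G \<and>
     (\<forall>x\<in>Obj C. \<tau> x \<in> Hom D (fobj F x) (fobj G x)) \<and>
     (\<forall>f\<in>Arr C. \<tau> (Cod C f) \<cdot>\<^bsub>D\<^esub> farr F f = farr G f \<cdot>\<^bsub>D\<^esub> \<tau> (Dom C f))"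

definition naturally_isomorphic ::
  "('o1, 'a1) cat \<Rightarrow> ('o2, 'a2) cat \<Rightarrow> ('o1, 'a1, 'o2, 'a2) func \<Rightarrow> ('o1, 'a1, 'o2, 'a2) func
     \<Rightarrow> bool" where
  "naturally_isomorphic C D F G \<longleftrightarrow>
     (\<exists>\<tau>. natural C D F G \<tau> \<and> (\<forall>x\<in>Obj C. iso_arr D (\<tau> x)))"

definition equivalent_cats :: "('o1, 'a1) cat \<Rightarrow> ('o2, 'a2) cat \<Rightarrow> bool" where
  "equivalent_cats C D \<longleftrightarrow>
     (\<exists>F G. cat_functor C D F \<and> cat_functor D C G \<and>
        naturally_isomorphic C C (comp_func G F) id_func \<and>
        naturally_isomorphic D D (comp_func F G) id_func)"

text \<open>\<open>adjoint C D L R\<close>: the functor \<open>L : C \<rightarrow> D\<close> is left adjoint to \<open>R : D \<rightarrow> C\<close>.\<close>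

definition adjoint ::
  "('o1, 'a1) cat \<Rightarrow> ('o2, 'a2) cat \<Rightarrow> ('o1, 'a1, 'o2, 'a2) func \<Rightarrow> ('o2, 'a2, 'o1, 'a1) func
     \<Rightarrow> bool" where
  "adjoint C D L R \<longleftrightarrow>
     cat_functor C D L \<and> cat_functor D C R \<and>
     (\<exists>\<phi>.
        (\<forall>x\<in>Obj C. \<forall>y\<in>Obj D. bij_betw (\<phi> x y) (Hom D (fobj L x) y) (Hom C x (fobj R y))) \<and>
        (\<forall>x\<in>Obj C. \<forall>x'\<in>Obj C. \<forall>y\<in>Obj D. \<forall>y'\<in>Obj D.
           \<forall>f\<in>Hom C x' x. \<forall>g\<in>Hom D y y'. \<forall>h\<in>Hom D (fobj L x) y.
             \<phi> x' y' (g \<cdot>\<^bsub>D\<^esub> h \<cdot>\<^bsub>D\<^esub> farr L f) = farr R g \<cdot>\<^bsub>C\<^esub> \<phi> x y h \<cdot>\<^bsub>C\<^esub> f))"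

definition is_cone ::
  "('j, 'k) cat \<Rightarrow> ('o, 'a) cat \<Rightarrow> ('j, 'k, 'o, 'a) func \<Rightarrow> 'o \<Rightarrow> ('j \<Rightarrow> 'a) \<Rightarrow> bool" where
  "is_cone J C K x \<pi> \<longleftrightarrow> x \<in> Obj C \<and>
     (\<forall>j\<in>Obj J. \<pi> j \<in> Hom C x (fobj K j)) \<and>
     (\<forall>k\<in>Arr J. farr K k \<cdot>\<^bsub>C\<^esub> \<pi> (Dom J k) = \<pi> (Cod J k))"

definition is_limit ::
  "('j, 'k) cat \<Rightarrow> ('o, 'a) cat \<Rightarrow> ('j, 'k, 'o, 'a) func \<Rightarrow> 'o \<Rightarrow> ('j \<Rightarrow> 'a) \<Rightarrow> bool" where
  "is_limit J C K x \<pi> \<longleftrightarrow> is_cone J C K x \<pi> \<and>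
     (\<forall>y \<rho>. is_cone J C K y \<rho> \<longrightarrow> (\<exists>!h. h \<in> Hom C y x \<and> (\<forall>j\<in>Obj J. \<pi> j \<cdot>\<^bsub>C\<^esub> h = \<rho> j)))"

text \<open>Every finite category is isomorphic to one whose objects and arrows are natural numbers.\<close>

definition preserves_finite_limits ::
  "('o1, 'a1) cat \<Rightarrow> ('o2, 'a2) cat \<Rightarrow> ('o1, 'a1, 'o2, 'a2) func \<Rightarrow> bool" where
  "preserves_finite_limits C D F \<longleftrightarrow>
     (\<forall>(J :: (nat, nat) cat) K x \<pi>.
        category J \<and> finite (Obj J) \<and> finite (Arr J) \<and> cat_functor J C K \<and> is_limit J C K x \<pi> \<longrightarrow>
        is_limit J D (comp_func F K) (fobj F x) (\<lambda>j. farr F (\<pi> j)))"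

text \<open>Functors and natural transformations are made \<open>undefined\<close> outside their domains, so that
  equality of objects and of arrows of the functor category is the mathematical one. An arrow
  \<open>(F, G, \<tau>)\<close> carries its source and target.\<close>

definition functor_cat ::
  "('o1, 'a1) cat \<Rightarrow> ('o2, 'a2) cat \<Rightarrow>
     (('o1, 'a1, 'o2, 'a2) func,
      ('o1, 'a1, 'o2, 'a2) func \<times> ('o1, 'a1, 'o2, 'a2) func \<times> ('o1 \<Rightarrow> 'a2)) cat" where
  "functor_cat C D =
     (let Fun = {F. cat_functor C D F \<and>
                    fobj F \<in> extensional (Obj C) \<and> farr F \<in> extensional (Arr C)}
      in \<lparr>Obj = Fun,
          Arr = {(F, G, \<tau>). F \<in> Fun \<and> G \<in> Fun \<and>
                            natural C D F G \<tau> \<and> \<tau> \<in> extensional (Obj C)},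
          Dom = (\<lambda>(F, G, \<tau>). F),
          Cod = (\<lambda>(F, G, \<tau>). G),
          Ident = (\<lambda>F. (F, F, \<lambda>x\<in>Obj C. Ident D (fobj F x))),
          Comp = (\<lambda>(G', H, \<sigma>) (F, G, \<tau>). (F, H, \<lambda>x\<in>Obj C. \<sigma> x \<cdot>\<^bsub>D\<^esub> \<tau> x))\<rparr>)"

type_synonym 'u set_arr = "'u \<times> 'u \<times> ('u \<Rightarrow> 'u)"

definition set_cat :: "('u \<Rightarrow> 'u set) \<Rightarrow> ('u, 'u set_arr) cat" where
  "set_cat elts =
     \<lparr>Obj = UNIV,
      Arr = {(A, B, f). f \<in> elts A \<rightarrow>\<^sub>E elts B},
      Dom = (\<lambda>(A, B, f). A),
      Cod = (\<lambda>(A, B, f). B),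
      Ident = (\<lambda>A. (A, A, \<lambda>x\<in>elts A. x)),
      Comp = (\<lambda>(B', D, g) (A, B, f). (A, D, compose (elts A) g f))\<rparr>"

definition app :: "'u set_arr \<Rightarrow> 'u \<Rightarrow> 'u" where
  "app m = snd (snd m)"

type_synonym ('o, 'a, 'u) psh = "('o, 'a, 'u, 'u set_arr) func"
type_synonym ('o, 'a, 'u) psh_arr =
  "('o, 'a, 'u) psh \<times> ('o, 'a, 'u) psh \<times> ('o \<Rightarrow> 'u set_arr)"
type_synonym ('o, 'a, 'u) psh_cat = "(('o, 'a, 'u) psh, ('o, 'a, 'u) psh_arr) cat"

definition presheaf_cat :: "('u \<Rightarrow> 'u set) \<Rightarrow> ('o, 'a) cat \<Rightarrow> ('o, 'a, 'u) psh_cat" where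
  "presheaf_cat elts C = functor_cat (op_cat C) (set_cat elts)"

text \<open>The hom-sets of a locally small category live in the arrow type \<open>'a\<close>, not in the universe.
  We choose an object of \<open>set_cat elts\<close> in bijection with each of them; a different choice
  gives a naturally isomorphic Yoneda embedding.\<close>

definition hom_obj :: "('u \<Rightarrow> 'u set) \<Rightarrow> ('o, 'a) cat \<Rightarrow> 'o \<Rightarrow> 'o \<Rightarrow> 'u" where
  "hom_obj elts C x y = (SOME u. \<exists>f. bij_betw f (Hom C x y) (elts u))"

definition hom_enc :: "('u \<Rightarrow> 'u set) \<Rightarrow> ('o, 'a) cat \<Rightarrow> 'o \<Rightarrow> 'o \<Rightarrow> 'a \<Rightarrow> 'u" where
  "hom_enc elts C x y = (SOME f. bij_betw f (Hom C x y) (elts (hom_obj elts C x y)))"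

definition hom_dec :: "('u \<Rightarrow> 'u set) \<Rightarrow> ('o, 'a) cat \<Rightarrow> 'o \<Rightarrow> 'o \<Rightarrow> 'u \<Rightarrow> 'a" where
  "hom_dec elts C x y = inv_into (Hom C x y) (hom_enc elts C x y)"

definition representable ::
  "('u \<Rightarrow> 'u set) \<Rightarrow> ('o, 'a) cat \<Rightarrow> 'o \<Rightarrow> ('o, 'a, 'u) psh" where
  "representable elts C v =
     \<lparr>fobj = (\<lambda>x\<in>Obj C. hom_obj elts C x v),
      farr = (\<lambda>f\<in>Arr C. let x = Dom C f; y = Cod C f in
        (hom_obj elts C y v, hom_obj elts C x v,
         \<lambda>p\<in>elts (hom_obj elts C y v). hom_enc elts C x v (hom_dec elts C y v p \<cdot>\<^bsub>C\<^esub> f)))\<rparr>"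

definition yoneda ::
  "('u \<Rightarrow> 'u set) \<Rightarrow> ('o, 'a) cat \<Rightarrow> ('o, 'a, ('o, 'a, 'u) psh, ('o, 'a, 'u) psh_arr) func" where
  "yoneda elts C =
     \<lparr>fobj = representable elts C,
      farr = (\<lambda>g. let v = Dom C g; w = Cod C g in
        (representable elts C v, representable elts C w,
         \<lambda>x\<in>Obj C. (hom_obj elts C x v, hom_obj elts C x w,
           \<lambda>p\<in>elts (hom_obj elts C x v). hom_enc elts C x w (g \<cdot>\<^bsub>C\<^esub> hom_dec elts C x v p))))\<rparr>"

definition sieve :: "('o, 'a) cat \<Rightarrow> 'o \<Rightarrow> 'a set \<Rightarrow> bool" where
  "sieve C x S \<longleftrightarrow> S \<subseteq> {f \<in> Arr C. Cod C f = x} \<and>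
     (\<forall>f\<in>S. \<forall>g\<in>Arr C. Cod C g = Dom C f \<longrightarrow> f \<cdot>\<^bsub>C\<^esub> g \<in> S)"

definition pullback_sieve :: "('o, 'a) cat \<Rightarrow> 'a \<Rightarrow> 'a set \<Rightarrow> 'a set" where
  "pullback_sieve C h S = {g \<in> Arr C. Cod C g = Dom C h \<and> h \<cdot>\<^bsub>C\<^esub> g \<in> S}"

definition grothendieck_topology :: "('o, 'a) cat \<Rightarrow> ('o \<Rightarrow> 'a set set) \<Rightarrow> bool" where
  "grothendieck_topology C J \<longleftrightarrow>
     (\<forall>x\<in>Obj C. \<forall>S\<in>J x. sieve C x S) \<and>
     (\<forall>x\<in>Obj C. {f \<in> Arr C. Cod C f = x} \<in> J x) \<and>
     (\<forall>h\<in>Arr C. \<forall>S\<in>J (Cod C h). pullback_sieve C h S \<in> J (Dom C h)) \<and>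
     (\<forall>x\<in>Obj C. \<forall>S\<in>J x. \<forall>R. sieve C x R \<longrightarrow>
        (\<forall>h\<in>S. pullback_sieve C h R \<in> J (Dom C h)) \<longrightarrow> R \<in> J x)"

definition matching_family ::
  "('u \<Rightarrow> 'u set) \<Rightarrow> ('o, 'a) cat \<Rightarrow> ('o, 'a, 'u) psh \<Rightarrow> 'a set \<Rightarrow> ('a \<Rightarrow> 'u) \<Rightarrow> bool" where
  "matching_family elts C F S s \<longleftrightarrow>
     (\<forall>f\<in>S. s f \<in> elts (fobj F (Dom C f))) \<and>
     (\<forall>f\<in>S. \<forall>g\<in>Arr C. Cod C g = Dom C f \<longrightarrow> s (f \<cdot>\<^bsub>C\<^esub> g) = app (farr F g) (s f))"

definition is_sheaf ::
  "('u \<Rightarrow> 'u set) \<Rightarrow> ('o, 'a) cat \<Rightarrow> ('o \<Rightarrow> 'a set set) \<Rightarrow> ('o, 'a, 'u) psh \<Rightarrow> bool" where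
  "is_sheaf elts C J F \<longleftrightarrow> F \<in> Obj (presheaf_cat elts C) \<and>
     (\<forall>x\<in>Obj C. \<forall>S\<in>J x. \<forall>s. matching_family elts C F S s \<longrightarrow>
        (\<exists>!a. a \<in> elts (fobj F x) \<and> (\<forall>f\<in>S. app (farr F f) a = s f)))"

definition sheaf_cat ::
  "('u \<Rightarrow> 'u set) \<Rightarrow> ('o, 'a) cat \<Rightarrow> ('o \<Rightarrow> 'a set set) \<Rightarrow> ('o, 'a, 'u) psh_cat" where
  "sheaf_cat elts C J = full_subcat (presheaf_cat elts C) {F. is_sheaf elts C J F}"

text \<open>Every small category is isomorphic to one whose objects and arrows belong to the
  universe, so it suffices to quantify over categories on the type \<open>'u\<close>.\<close>

definition grothendieck_topos :: "('u \<Rightarrow> 'u set) \<Rightarrow> ('o, 'a) cat \<Rightarrow> bool" where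
  "grothendieck_topos elts E \<longleftrightarrow> category E \<and>
     (\<exists>(C :: ('u, 'u) cat) J. small_category elts C \<and> grothendieck_topology C J \<and>
        equivalent_cats E (sheaf_cat elts C J))"

text \<open>A geometric morphism from \<open>E\<close> (types \<open>'o1, 'a1\<close>) to \<open>F\<close> (types \<open>'o2, 'a2\<close>).\<close>

record ('o1, 'a1, 'o2, 'a2) geom =
  direct_image :: "('o1, 'a1, 'o2, 'a2) func"
  inverse_image :: "('o2, 'a2, 'o1, 'a1) func"

definition geometric_morphism ::
  "('o1, 'a1) cat \<Rightarrow> ('o2, 'a2) cat \<Rightarrow> ('o1, 'a1, 'o2, 'a2) geom \<Rightarrow> bool" where
  "geometric_morphism E F f \<longleftrightarrow>
     adjoint F E (inverse_image f) (direct_image f) \<and>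
     preserves_finite_limits F E (inverse_image f)"

definition geom_id :: "('o, 'a, 'o, 'a) geom" where
  "geom_id = \<lparr>direct_image = id_func, inverse_image = id_func\<rparr>"

definition geom_comp ::
  "('o2, 'a2, 'o3, 'a3) geom \<Rightarrow> ('o1, 'a1, 'o2, 'a2) geom \<Rightarrow> ('o1, 'a1, 'o3, 'a3) geom" where
  "geom_comp g f = \<lparr>direct_image = comp_func (direct_image g) (direct_image f),
                    inverse_image = comp_func (inverse_image f) (inverse_image g)\<rparr>"

text \<open>The 2-cells between geometric morphisms are the natural transformations between the inverse
  image functors.\<close>

definition geom_isomorphic ::
  "('o1, 'a1) cat \<Rightarrow> ('o2, 'a2) cat \<Rightarrow> ('o1, 'a1, 'o2, 'a2) geom \<Rightarrow> ('o1, 'a1, 'o2, 'a2) geom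
     \<Rightarrow> bool" where
  "geom_isomorphic E F f g \<longleftrightarrow> naturally_isomorphic F E (inverse_image f) (inverse_image g)"

definition geom_retract :: "('o1, 'a1) cat \<Rightarrow> ('o2, 'a2) cat \<Rightarrow> bool" where
  "geom_retract E F \<longleftrightarrow>
     (\<exists>i r. geometric_morphism E F i \<and> geometric_morphism F E r \<and>
        geom_isomorphic E E (geom_comp r i) geom_id)"

definition quasi_injective_topos :: "('u \<Rightarrow> 'u set) \<Rightarrow> ('o, 'a) cat \<Rightarrow> bool" where
  "quasi_injective_topos elts E \<longleftrightarrow> grothendieck_topos elts E \<and>
     (\<exists>C :: ('u, 'u) cat. small_category elts C \<and> geom_retract E (presheaf_cat elts C))"

definition totally_distributive :: "('u \<Rightarrow> 'u set) \<Rightarrow> ('o, 'a) cat \<Rightarrow> bool" where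
  "totally_distributive elts E \<longleftrightarrow> locally_small elts E \<and>
     (\<exists>c t. adjoint (presheaf_cat elts E) E c (yoneda elts E) \<and>
            adjoint E (presheaf_cat elts E) t c)"

end

theory Submission
  imports Defs
begin

text \<open>
  Let \<open>P\<close> be the presheaf category of which \<open>E\<close> is a retract, and write \<open>s = r\<^sup>*: E \<rightarrow> P\<close> and
  \<open>j = i\<^sup>*: P \<rightarrow> E\<close>, left adjoints with \<open>j s \<cong> 1\<close>.
  Put \<open>k = j y : C \<rightarrow> E\<close>. An element \<open>p \<in> (s x) c\<close> is an arrow \<open>y c \<rightarrow> s x\<close>, and so gives an arrow
  \<open>k c \<rightarrow> j s x \<cong> x\<close>. Through these arrows an element \<open>a \<in> F x\<close> of a presheaf \<open>F\<close> on \<open>E\<close> gives an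
  arrow \<open>\<mu> a : s x \<rightarrow> F k\<close> in \<open>P\<close>. Precomposition with \<open>a \<mapsto> j (\<mu> a)\<close> makes \<open>Nat(F, y v)\<close> a retract of
  \<open>E(j (F k), v)\<close>, naturally in \<open>v\<close>. Idempotents split in \<open>E\<close>, so \<open>Nat(F, y -)\<close> is represented by an object
  \<open>c F\<close>. Since \<open>s\<close> preserves the weighted colimit \<open>c F\<close>, the arrows \<open>\<mu> a\<close> induce \<open>\<phi> : s (c F) \<rightarrow> F k\<close>,
  and \<open>h \<mapsto> \<phi> \<circ> s h\<close> makes \<open>E(v, c F)\<close> a retract of \<open>P(s v, F k)\<close>, naturally in \<open>F\<close>. As \<open>C\<close> is small, the
  latter is represented by the left Kan extension of \<open>s v\<close> along \<open>k\<close>, and splitting one more idempotent, now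
  in the category of presheaves on \<open>E\<close>, gives \<open>t v\<close>.
\<close>

section \<open>Small sets\<close>

text \<open>The obstacle is size. \<open>E\<close> may be large, so a presheaf \<open>F\<close> on
  \<open>E\<close> is a large weight and the arrows between two such presheaves need not form a
  small set; smallness alone gives neither the colimit \<open>c F\<close> nor the value
  \<open>t v\<close>. The remedy is to look at \<open>F\<close> only through its restriction
  \<open>F k\<close> to the small category \<open>C\<close>. This loses nothing that matters:
  \<open>x\<close> is isomorphic to \<open>j (s x)\<close>, a colimit of objects \<open>k c\<close>,
  so a cocone on \<open>F\<close> can be recovered at every \<open>x\<close> from its legs at the
  objects \<open>k c\<close>, by naturality along the arrows \<open>k c \<rightarrow> x\<close> that
  come from elements of \<open>s x\<close>. Both retractions rest on this recovery, which is
  \<open>extends_mu\<close>. In general they are only retractions, since the comparison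
  \<open>s x \<rightarrow> E(k -, x)\<close> need not be invertible; this is why idempotents have to
  be split twice.\<close>

context grothendieck_universe
begin

lemma ex_subset:
  assumes "S \<subseteq> elts x"
  shows "\<exists>z. elts z = S"
proof -
  obtain p where "elts ` elts p = Pow (elts x)" using power_set by blast
  then have "S \<in> elts ` elts p" using assms by simp
  then show ?thesis by auto
qed

text \<open>Replacement: the union axiom admits an arbitrary function on the index set, and here it
  is applied to the singletons \<open>{g i}\<close>.\<close>

lemma ex_image: "\<exists>z. elts z = g ` elts x"
proof -
  have "\<exists>z. elts z = {g i}" for i using pairing[of "g i" "g i"] by simp
  then obtain h where "elts (h i) = {g i}" for i by metis
  moreover obtain z where "elts z = (\<Union>i\<in>elts x. elts (h i))" using union by blast
  ultimately have "elts z = g ` elts x" by auto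
  then show ?thesis by blast
qed

text \<open>Kuratowski pairs, formed with a choice \<open>up\<close> of unordered pairs. They let
  \<open>small_Sigma\<close> code a dependent pair by one element of \<open>'u\<close>.\<close>

lemma ex_ordered_pairs: "\<exists>op :: 'u \<Rightarrow> 'u \<Rightarrow> 'u. \<forall>x y x' y'. op x y = op x' y' \<longrightarrow> x = x' \<and> y = y'"
proof -
  obtain up where up: "elts (up x y) = {x, y}" for x y using pairing by metis
  have "x = x' \<and> y = y'" if "up (up x x) (up x y) = up (up x' x') (up x' y')" for x y x' y'
  proof -
    have "elts (up (up x x) (up x y)) = elts (up (up x' x') (up x' y'))" using that by simp
    then have "{up x x, up x y} = {up x' x', up x' y'}" by (simp only: up)
    \<comment> \<open>\<open>up x y\<close> is only a code, so \<open>elts\<close> is applied a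
      second time to reach the sets of sets.\<close>
    then have "elts ` {up x x, up x y} = elts ` {up x' x', up x' y'}" by (rule arg_cong)
    then have "{{x}, {x, y}} = {{x'}, {x', y'}}" by (simp add: up)
    then show ?thesis by (auto simp: doubleton_eq_iff)
  qed
  then show ?thesis by (intro exI[of _ "\<lambda>x y. up (up x x) (up x y)"]) blast
qed

lemma small_elts: "small elts (elts x)"
  unfolding small_def by (intro exI[of _ x] exI[of _ id]) simp

lemma small_inj:
  assumes "small elts A" "inj_on g B" "g ` B \<subseteq> A"
  shows "small elts B"
proof -
  obtain u f where f: "bij_betw f A (elts u)" using assms(1) unfolding small_def by (elim exE)
  have "f ` g ` B \<subseteq> elts u" using f image_mono[OF assms(3), of f] by (simp add: bij_betw_def)
  then obtain z where z: "elts z = f ` g ` B" using ex_subset[of "f ` g ` B" u] by auto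
  have "inj_on (f \<circ> g) B"
    using comp_inj_on[OF assms(2), of f] inj_on_subset[OF _ assms(3), of f] f
    by (simp add: bij_betw_def)
  then have "bij_betw (f \<circ> g) B (elts z)" by (simp add: bij_betw_def z image_comp)
  then show ?thesis unfolding small_def by (intro exI)
qed

lemma small_subset: "small elts A \<Longrightarrow> B \<subseteq> A \<Longrightarrow> small elts B"
  by (rule small_inj[where g = id and A = A]) auto

lemma small_image:
  assumes "small elts A" shows "small elts (f ` A)"
  by (rule small_inj[OF assms, where g = "inv_into A f"]) (auto simp: inj_on_inv_into inv_into_into)

lemma small_Pow:
  assumes "small elts A" shows "small elts (Pow A)"
proof -
  obtain u f where f: "bij_betw f A (elts u)" using assms unfolding small_def by (elim exE)
  obtain p where p: "elts ` elts p = Pow (elts u)" using power_set by blast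
  have "small elts (elts ` elts p)" by (intro small_image small_elts)
  then have "small elts (Pow (elts u))" by (simp add: p)
  moreover have "bij_betw ((`) f) (Pow A) (Pow (elts u))"
    using f by (rule bij_betw_Pow)
  ultimately show ?thesis
    by (intro small_inj[where A = "Pow (elts u)" and g = "(`) f"]) (simp_all add: bij_betw_def)
qed

text \<open>The union axiom glues the coded fibres, and pairing with the code of the index keeps
  different fibres disjoint.\<close>

lemma small_Sigma:
  assumes "small elts A" "\<And>x. x \<in> A \<Longrightarrow> small elts (B x)"
  shows "small elts (Sigma A B)"
proof -
  obtain u f where f: "bij_betw f A (elts u)" using assms(1) unfolding small_def by (elim exE)
  obtain v g where g: "bij_betw (g x) (B x) (elts (v x))" if "x \<in> A" for x
    using assms(2) unfolding small_def by metis
  obtain op :: "'u \<Rightarrow> 'u \<Rightarrow> 'u" where op: "op x y = op x' y' \<longleftrightarrow> x = x' \<and> y = y'" for x y x' y'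
    using ex_ordered_pairs by metis
  have "\<exists>z. elts z = op i ` elts w" for i w by (rule ex_image)
  then obtain h where h: "elts (h i w) = op i ` elts w" for i w by metis
  \<comment> \<open>The union runs over the codes in \<open>elts u\<close>, so
    \<open>inv_into A f\<close> first decodes the index.\<close>
  obtain z where z: "elts z = (\<Union>i\<in>elts u. elts (h i (v (inv_into A f i))))"
    using union[where I = u and f = "\<lambda>i. h i (v (inv_into A f i))"] by blast
  show ?thesis
  proof (rule small_inj[OF small_elts[of z], where g = "\<lambda>(x, y). op (f x) (g x y)"])
    show "inj_on (\<lambda>(x, y). op (f x) (g x y)) (Sigma A B)"
    proof (rule inj_onI)
      fix p q
      assume p: "p \<in> Sigma A B" and q: "q \<in> Sigma A B"
        and eq: "(case p of (x, y) \<Rightarrow> op (f x) (g x y)) = (case q of (x, y) \<Rightarrow> op (f x) (g x y))"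
      have 1: "f (fst p) = f (fst q)" "g (fst p) (snd p) = g (fst q) (snd q)"
        using eq by (simp_all add: op split_beta)
      have "fst p = fst q" using 1(1) p q f by (auto simp: bij_betw_def dest: inj_onD)
      moreover from this have "snd p = snd q"
        using 1(2) p q g[of "fst p"] by (auto simp: bij_betw_def dest: inj_onD)
      ultimately show "p = q" by (simp add: prod_eq_iff)
    qed
    have "op (f x) (g x y) \<in> elts z" if "x \<in> A" "y \<in> B x" for x y
    proof -
      have "inv_into A f (f x) = x" "f x \<in> elts u" "g x y \<in> elts (v x)"
        using that f g by (auto simp: bij_betw_def)
      then show ?thesis unfolding z UN_iff by (intro bexI[of _ "f x"]) (simp_all add: h)
    qed
    then show "(\<lambda>(x, y). op (f x) (g x y)) ` Sigma A B \<subseteq> elts z" by auto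
  qed
qed

end

section \<open>Universal arrows and adjoints\<close>

lemma HomD:
  assumes "f \<in> Hom C x y"
  shows "f \<in> Arr C" "Dom C f = x" "Cod C f = y"
  using assms by (auto simp: Hom_def)

lemma (in category) Hom_objD:
  assumes "f \<in> Hom C x y"
  shows "x \<in> Obj C" "y \<in> Obj C"
  using assms dom_closed[of f] cod_closed[of f] by (auto simp: Hom_def)

lemma (in category) comp_cancel_middle:
  assumes "f \<in> Hom C w x" "g \<in> Hom C x y" "g' \<in> Hom C y x" "h \<in> Hom C x z" "g' \<cdot> g = Ident C x"
  shows "(h \<cdot> g') \<cdot> (g \<cdot> f) = h \<cdot> f"
proof -
  have "(h \<cdot> g') \<cdot> (g \<cdot> f) = ((h \<cdot> g') \<cdot> g) \<cdot> f"
    using comp_assoc[OF assms(1,2) comp_closed[OF assms(3,4)]] by simp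
  also have "(h \<cdot> g') \<cdot> g = h"
    using comp_assoc[OF assms(2,3,4)] assms(5) ident_right[OF assms(4)] by simp
  finally show ?thesis .
qed

definition idempotents_split :: "('o, 'a) cat \<Rightarrow> bool" where
  "idempotents_split C \<longleftrightarrow>
     (\<forall>x. \<forall>e\<in>Hom C x x. e \<cdot>\<^bsub>C\<^esub> e = e \<longrightarrow>
        (\<exists>y. \<exists>q\<in>Hom C x y. \<exists>m\<in>Hom C y x. q \<cdot>\<^bsub>C\<^esub> m = Ident C y \<and> m \<cdot>\<^bsub>C\<^esub> q = e))"

text \<open>An initial object of the comma category of \<open>x\<close> over \<open>R\<close>;
  equivalently \<open>l\<close> represents the functor \<open>y \<mapsto> C(x, R y)\<close>. In this
  form a left adjoint can be built one object at a time.\<close>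

definition universal_arrow ::
  "('o1, 'a1) cat \<Rightarrow> ('o2, 'a2) cat \<Rightarrow> ('o2, 'a2, 'o1, 'a1) func \<Rightarrow> 'o1 \<Rightarrow> 'o2 \<Rightarrow> 'a1 \<Rightarrow> bool" where
  "universal_arrow C D R x l \<eta> \<longleftrightarrow> l \<in> Obj D \<and> \<eta> \<in> Hom C x (fobj R l) \<and>
     (\<forall>y\<in>Obj D. \<forall>h\<in>Hom C x (fobj R y). \<exists>!g. g \<in> Hom D l y \<and> farr R g \<cdot>\<^bsub>C\<^esub> \<eta> = h)"

text \<open>The Yoneda argument: a bijection of hom-sets natural in \<open>y\<close> is determined
  by the image of the identity, which is the unit.\<close>

lemma adjoint_unit:
  assumes "adjoint C D L R"
  obtains \<eta> where "\<And>x. x \<in> Obj C \<Longrightarrow> universal_arrow C D R x (fobj L x) (\<eta> x)"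
    and "\<And>x y f. f \<in> Hom C x y \<Longrightarrow> farr R (farr L f) \<cdot>\<^bsub>C\<^esub> \<eta> x = \<eta> y \<cdot>\<^bsub>C\<^esub> f"
proof -
  interpret L: cat_functor C D L using assms by (simp add: adjoint_def)
  interpret R: cat_functor D C R using assms by (simp add: adjoint_def)
  obtain \<phi> where
    bij: "\<forall>x\<in>Obj C. \<forall>y\<in>Obj D. bij_betw (\<phi> x y) (Hom D (fobj L x) y) (Hom C x (fobj R y))"
    and nat': "\<forall>x\<in>Obj C. \<forall>x'\<in>Obj C. \<forall>y\<in>Obj D. \<forall>y'\<in>Obj D.
      \<forall>f\<in>Hom C x' x. \<forall>g\<in>Hom D y y'. \<forall>h\<in>Hom D (fobj L x) y.
        \<phi> x' y' (g \<cdot>\<^bsub>D\<^esub> h \<cdot>\<^bsub>D\<^esub> farr L f) = farr R g \<cdot>\<^bsub>C\<^esub> \<phi> x y h \<cdot>\<^bsub>C\<^esub> f"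
    using assms unfolding adjoint_def by (elim conjE exE)
  have nat: "\<phi> x' y' (g \<cdot>\<^bsub>D\<^esub> h \<cdot>\<^bsub>D\<^esub> farr L f) = farr R g \<cdot>\<^bsub>C\<^esub> \<phi> x y h \<cdot>\<^bsub>C\<^esub> f"
    if "f \<in> Hom C x' x" "g \<in> Hom D y y'" "h \<in> Hom D (fobj L x) y" for x x' y y' f g h
    using nat'[rule_format, OF L.dom.Hom_objD(2)[OF that(1)] L.dom.Hom_objD(1)[OF that(1)]
        L.cod.Hom_objD[OF that(2)] that] .
  define \<eta> where "\<eta> x = \<phi> x (fobj L x) (Ident D (fobj L x))" for x
  have id: "Ident D (fobj L x) \<in> Hom D (fobj L x) (fobj L x)" if "x \<in> Obj C" for x
    using that by (intro L.cod.ident_closed L.fobj_closed)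
  have \<eta>: "\<eta> x \<in> Hom C x (fobj R (fobj L x))" if "x \<in> Obj C" for x
    using bij[rule_format, OF that L.fobj_closed[OF that]] id[OF that] by (auto simp: \<eta>_def bij_betw_def)
  \<comment> \<open>Naturality with \<open>h\<close> the identity of \<open>L x\<close> and
    \<open>f\<close> the identity of \<open>x\<close>.\<close>
  have \<phi>: "\<phi> x y g = farr R g \<cdot>\<^bsub>C\<^esub> \<eta> x" if x: "x \<in> Obj C" and g: "g \<in> Hom D (fobj L x) y" for x y g
  proof -
    have "\<phi> x y (g \<cdot>\<^bsub>D\<^esub> Ident D (fobj L x) \<cdot>\<^bsub>D\<^esub> farr L (Ident C x))
        = farr R g \<cdot>\<^bsub>C\<^esub> \<eta> x \<cdot>\<^bsub>C\<^esub> Ident C x"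
      unfolding \<eta>_def by (rule nat[OF L.dom.ident_closed[OF x] g id[OF x]])
    then show ?thesis
      using L.cod.ident_right[OF g] L.farr_ident[OF x]
        L.dom.ident_right[OF L.dom.comp_closed[OF \<eta>[OF x] R.farr_closed[OF g]]]
      by simp
  qed
  show thesis
  proof
    fix x assume x: "x \<in> Obj C"
    have "\<exists>!g. g \<in> Hom D (fobj L x) y \<and> farr R g \<cdot>\<^bsub>C\<^esub> \<eta> x = h"
      if "y \<in> Obj D" "h \<in> Hom C x (fobj R y)" for y h
    proof -
      have "\<exists>!g. g \<in> Hom D (fobj L x) y \<and> \<phi> x y g = h"
        using bij_betw_inv_into_right[OF bij[rule_format, OF x that(1)] that(2)]
          bij_betw_inv_into_left[OF bij[rule_format, OF x that(1)]]
          bij_betw_apply[OF bij_betw_inv_into[OF bij[rule_format, OF x that(1)]] that(2)]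
        by metis
      then show ?thesis using \<phi>[OF x] by metis
    qed
    then show "universal_arrow C D R x (fobj L x) (\<eta> x)"
      using \<eta>[OF x] L.fobj_closed[OF x] by (simp add: universal_arrow_def)
  next
    fix x y f assume f: "f \<in> Hom C x y"
    note xy = L.dom.Hom_objD[OF f]
    \<comment> \<open>Both \<open>g\<close> and \<open>h\<close> are identities, so only naturality
      in \<open>x\<close> remains.\<close>
    have "\<phi> x (fobj L y) (Ident D (fobj L y) \<cdot>\<^bsub>D\<^esub> Ident D (fobj L y) \<cdot>\<^bsub>D\<^esub> farr L f)
        = farr R (Ident D (fobj L y)) \<cdot>\<^bsub>C\<^esub> \<eta> y \<cdot>\<^bsub>C\<^esub> f"
      unfolding \<eta>_def by (rule nat[OF f id[OF xy(2)] id[OF xy(2)]])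
    then have "\<phi> x (fobj L y) (farr L f) = \<eta> y \<cdot>\<^bsub>C\<^esub> f"
      using L.cod.ident_left[OF id[OF xy(2)]] L.cod.ident_left[OF L.farr_closed[OF f]]
        R.farr_ident[OF L.fobj_closed[OF xy(2)]] L.dom.ident_left[OF \<eta>[OF xy(2)]]
      by simp
    then show "farr R (farr L f) \<cdot>\<^bsub>C\<^esub> \<eta> x = \<eta> y \<cdot>\<^bsub>C\<^esub> f"
      using \<phi>[OF xy(1) L.farr_closed[OF f]] by simp
  qed
qed

text \<open>The action on arrows is forced: \<open>L f\<close> is the unique arrow whose image under
  \<open>R\<close>, after the unit at \<open>x\<close>, is the unit at \<open>y\<close> after
  \<open>f\<close>. Functoriality then follows from uniqueness.\<close>

lemma ex_left_adjoint:
  assumes "cat_functor D C R" and "category C"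
    and "\<And>x. x \<in> Obj C \<Longrightarrow> \<exists>l \<eta>. universal_arrow C D R x l \<eta>"
  shows "\<exists>L. adjoint C D L R"
proof -
  interpret R: cat_functor D C R by fact
  obtain l \<eta> where u: "\<And>x. x \<in> Obj C \<Longrightarrow> universal_arrow C D R x (l x) (\<eta> x)"
    using assms(3) by metis
  have l: "l x \<in> Obj D" if "x \<in> Obj C" for x using u[OF that] by (simp add: universal_arrow_def)
  have \<eta>: "\<eta> x \<in> Hom C x (fobj R (l x))" if "x \<in> Obj C" for x
    using u[OF that] by (simp add: universal_arrow_def)
  have ex1: "\<exists>!g. g \<in> Hom D (l x) y \<and> farr R g \<cdot>\<^bsub>C\<^esub> \<eta> x = h"
    if "x \<in> Obj C" "y \<in> Obj D" "h \<in> Hom C x (fobj R y)" for x y h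
    using u[OF that(1)] that by (simp add: universal_arrow_def)
  have uniq: "g = g'"
    if "x \<in> Obj C" "g \<in> Hom D (l x) y" "g' \<in> Hom D (l x) y"
      "farr R g \<cdot>\<^bsub>C\<^esub> \<eta> x = farr R g' \<cdot>\<^bsub>C\<^esub> \<eta> x" for x y g g'
    using ex1[OF that(1) R.dom.Hom_objD(2)[OF that(2)]
        R.cod.comp_closed[OF \<eta>[OF that(1)] R.farr_closed[OF that(3)]]] that(2-4)
    by blast
  define m where "m f = (THE g. g \<in> Hom D (l (Dom C f)) (l (Cod C f)) \<and>
      farr R g \<cdot>\<^bsub>C\<^esub> \<eta> (Dom C f) = \<eta> (Cod C f) \<cdot>\<^bsub>C\<^esub> f)" for f
  have m: "m f \<in> Hom D (l x) (l y) \<and> farr R (m f) \<cdot>\<^bsub>C\<^esub> \<eta> x = \<eta> y \<cdot>\<^bsub>C\<^esub> f"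
    if f: "f \<in> Hom C x y" for x y f
  proof -
    note xy = R.cod.Hom_objD[OF f]
    show ?thesis
      using theI'[OF ex1[OF xy(1) l[OF xy(2)] R.cod.comp_closed[OF f \<eta>[OF xy(2)]]]] HomD[OF f]
      by (simp add: m_def)
  qed
  define L where "L = \<lparr>fobj = l, farr = m\<rparr>"
  have simps: "fobj L = l" "farr L = m" by (simp_all add: L_def)
  have "cat_functor C D L"
  proof (unfold_locales, unfold simps)
    fix x assume x: "x \<in> Obj C"
    show "l x \<in> Obj D" by (rule l[OF x])
    note i = R.cod.ident_closed[OF x]
    show "m (Ident C x) = Ident D (l x)"
    proof (rule uniq[OF x])
      show "m (Ident C x) \<in> Hom D (l x) (l x)" using m[OF i] by simp
      show "Ident D (l x) \<in> Hom D (l x) (l x)" by (intro R.dom.ident_closed l x)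
      show "farr R (m (Ident C x)) \<cdot>\<^bsub>C\<^esub> \<eta> x = farr R (Ident D (l x)) \<cdot>\<^bsub>C\<^esub> \<eta> x"
        using m[OF i] R.cod.ident_right[OF \<eta>[OF x]] R.cod.ident_left[OF \<eta>[OF x]]
          R.farr_ident[OF l[OF x]] by simp
    qed
  next
    fix f x y assume "f \<in> Hom C x y"
    then show "m f \<in> Hom D (l x) (l y)" using m by blast
  next
    fix f x y g z assume f: "f \<in> Hom C x y" and g: "g \<in> Hom C y z"
    note x = R.cod.Hom_objD(1)[OF f] and y = R.cod.Hom_objD(1)[OF g] and z = R.cod.Hom_objD(2)[OF g]
    note mf = conjunct1[OF m[OF f]] and mg = conjunct1[OF m[OF g]]
    note gf = R.cod.comp_closed[OF f g]
    show "m (g \<cdot>\<^bsub>C\<^esub> f) = m g \<cdot>\<^bsub>D\<^esub> m f"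
    proof (rule uniq[OF x])
      show "m (g \<cdot>\<^bsub>C\<^esub> f) \<in> Hom D (l x) (l z)" using m[OF gf] by simp
      show "m g \<cdot>\<^bsub>D\<^esub> m f \<in> Hom D (l x) (l z)" by (rule R.dom.comp_closed[OF mf mg])
      have "farr R (m g \<cdot>\<^bsub>D\<^esub> m f) \<cdot>\<^bsub>C\<^esub> \<eta> x = farr R (m g) \<cdot>\<^bsub>C\<^esub> (farr R (m f) \<cdot>\<^bsub>C\<^esub> \<eta> x)"
        using R.farr_comp[OF mf mg]
          R.cod.comp_assoc[OF \<eta>[OF x] R.farr_closed[OF mf] R.farr_closed[OF mg]] by simp
      also have "\<dots> = farr R (m g) \<cdot>\<^bsub>C\<^esub> (\<eta> y \<cdot>\<^bsub>C\<^esub> f)" using m[OF f] by simp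
      also have "\<dots> = (farr R (m g) \<cdot>\<^bsub>C\<^esub> \<eta> y) \<cdot>\<^bsub>C\<^esub> f"
        using R.cod.comp_assoc[OF f \<eta>[OF y] R.farr_closed[OF mg]] by simp
      also have "\<dots> = \<eta> z \<cdot>\<^bsub>C\<^esub> (g \<cdot>\<^bsub>C\<^esub> f)"
        using m[OF g] R.cod.comp_assoc[OF f g \<eta>[OF z]] by simp
      finally show "farr R (m (g \<cdot>\<^bsub>C\<^esub> f)) \<cdot>\<^bsub>C\<^esub> \<eta> x = farr R (m g \<cdot>\<^bsub>D\<^esub> m f) \<cdot>\<^bsub>C\<^esub> \<eta> x"
        using m[OF gf] by simp
    qed
  qed
  moreover have "bij_betw (\<lambda>h. farr R h \<cdot>\<^bsub>C\<^esub> \<eta> x) (Hom D (l x) y) (Hom C x (fobj R y))"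
    if x: "x \<in> Obj C" and y: "y \<in> Obj D" for x y
    unfolding bij_betw_def
  proof (intro conjI inj_onI equalityI subsetI)
    fix h assume "h \<in> Hom C x (fobj R y)"
    then show "h \<in> (\<lambda>h. farr R h \<cdot>\<^bsub>C\<^esub> \<eta> x) ` Hom D (l x) y" using ex1[OF x y] by (metis imageI)
  qed (use uniq[OF x] R.cod.comp_closed[OF \<eta>[OF x]] R.farr_closed in blast)+
  moreover have "farr R (g \<cdot>\<^bsub>D\<^esub> h \<cdot>\<^bsub>D\<^esub> m f) \<cdot>\<^bsub>C\<^esub> \<eta> x' = farr R g \<cdot>\<^bsub>C\<^esub> (farr R h \<cdot>\<^bsub>C\<^esub> \<eta> x) \<cdot>\<^bsub>C\<^esub> f"
    if f: "f \<in> Hom C x' x" and g: "g \<in> Hom D y y'" and h: "h \<in> Hom D (l x) y" for x x' y y' f g h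
  proof -
    note x' = R.cod.Hom_objD(1)[OF f] and x = R.cod.Hom_objD(2)[OF f]
    note mf = conjunct1[OF m[OF f]]
    note gh = R.dom.comp_closed[OF h g]
    have "farr R (g \<cdot>\<^bsub>D\<^esub> h \<cdot>\<^bsub>D\<^esub> m f) \<cdot>\<^bsub>C\<^esub> \<eta> x' = farr R (g \<cdot>\<^bsub>D\<^esub> h) \<cdot>\<^bsub>C\<^esub> (farr R (m f) \<cdot>\<^bsub>C\<^esub> \<eta> x')"
      using R.farr_comp[OF mf gh] R.cod.comp_assoc[OF \<eta>[OF x'] R.farr_closed[OF mf] R.farr_closed[OF gh]]
      by simp
    also have "\<dots> = (farr R (g \<cdot>\<^bsub>D\<^esub> h) \<cdot>\<^bsub>C\<^esub> \<eta> x) \<cdot>\<^bsub>C\<^esub> f"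
      using m[OF f] R.cod.comp_assoc[OF f \<eta>[OF x] R.farr_closed[OF gh]] by simp
    also have "farr R (g \<cdot>\<^bsub>D\<^esub> h) \<cdot>\<^bsub>C\<^esub> \<eta> x = farr R g \<cdot>\<^bsub>C\<^esub> (farr R h \<cdot>\<^bsub>C\<^esub> \<eta> x)"
      using R.farr_comp[OF h g] R.cod.comp_assoc[OF \<eta>[OF x] R.farr_closed[OF h] R.farr_closed[OF g]]
      by simp
    finally show ?thesis .
  qed
  ultimately have "adjoint C D L R"
    unfolding adjoint_def simps
    by (intro conjI assms(1) exI[of _ "\<lambda>x y h. farr R h \<cdot>\<^bsub>C\<^esub> \<eta> x"]) blast+
  then show ?thesis by blast
qed

text \<open>The functor represented by \<open>x\<close> is a retract of the one represented by \<open>d\<close>, and the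
  representing object is found by splitting the resulting idempotent of \<open>d\<close>.\<close>

lemma ex_universal_arrow_of_retract:
  assumes "cat_functor D C R" and "idempotents_split D"
    and d: "d \<in> Obj D" and \<eta>: "\<eta> \<in> Hom C x (fobj R d)"
    and closed: "\<And>y h. y \<in> Obj D \<Longrightarrow> h \<in> Hom C x (fobj R y) \<Longrightarrow> \<alpha> y h \<in> Hom D d y"
    and retr: "\<And>y h. y \<in> Obj D \<Longrightarrow> h \<in> Hom C x (fobj R y) \<Longrightarrow> farr R (\<alpha> y h) \<cdot>\<^bsub>C\<^esub> \<eta> = h"
    and nat: "\<And>y y' h g. h \<in> Hom C x (fobj R y) \<Longrightarrow> g \<in> Hom D y y' \<Longrightarrow>
      \<alpha> y' (farr R g \<cdot>\<^bsub>C\<^esub> h) = g \<cdot>\<^bsub>D\<^esub> \<alpha> y h"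
  shows "\<exists>l \<eta>. universal_arrow C D R x l \<eta>"
proof -
  interpret R: cat_functor D C R by fact
  \<comment> \<open>\<open>g \<mapsto> \<alpha> (R g \<cdot> \<eta>)\<close> is a natural idempotent
    on \<open>D(d, -)\<close>. By Yoneda it is precomposition with its value at the identity of
    \<open>d\<close>, which is \<open>e\<close>.\<close>
  define e where "e = \<alpha> d \<eta>"
  have e: "e \<in> Hom D d d" unfolding e_def by (rule closed[OF d \<eta>])
  have e\<eta>: "farr R e \<cdot>\<^bsub>C\<^esub> \<eta> = \<eta>" unfolding e_def by (rule retr[OF d \<eta>])
  \<comment> \<open>\<open>\<alpha> d (R e \<cdot> \<eta>)\<close> is \<open>e \<cdot> e\<close> by
    \<open>nat\<close>, and it is \<open>e\<close> because \<open>R e\<close> fixes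
    \<open>\<eta>\<close>.\<close>
  have "e \<cdot>\<^bsub>D\<^esub> e = e" using nat[OF \<eta> e] e\<eta> by (simp add: e_def)
  then obtain l q m where q: "q \<in> Hom D d l" and m: "m \<in> Hom D l d"
    and qm: "q \<cdot>\<^bsub>D\<^esub> m = Ident D l" and mq: "m \<cdot>\<^bsub>D\<^esub> q = e"
    using assms(2) e unfolding idempotents_split_def by blast
  have l: "l \<in> Obj D" by (rule R.dom.Hom_objD(1)[OF m])
  define \<eta>' where "\<eta>' = farr R q \<cdot>\<^bsub>C\<^esub> \<eta>"
  have \<eta>': "\<eta>' \<in> Hom C x (fobj R l)"
    unfolding \<eta>'_def by (rule R.cod.comp_closed[OF \<eta> R.farr_closed[OF q]])
  have R\<eta>': "farr R g \<cdot>\<^bsub>C\<^esub> \<eta>' = farr R (g \<cdot>\<^bsub>D\<^esub> q) \<cdot>\<^bsub>C\<^esub> \<eta>" if "g \<in> Hom D l y" for g y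
    using R.farr_comp[OF q that] R.cod.comp_assoc[OF \<eta> R.farr_closed[OF q] R.farr_closed[OF that]]
    by (simp add: \<eta>'_def)
  have "\<exists>!g. g \<in> Hom D l y \<and> farr R g \<cdot>\<^bsub>C\<^esub> \<eta>' = h" if y: "y \<in> Obj D" and h: "h \<in> Hom C x (fobj R y)" for y h
  proof
    note a = closed[OF y h]
    note am = R.dom.comp_closed[OF m a]
    have "(\<alpha> y h \<cdot>\<^bsub>D\<^esub> m) \<cdot>\<^bsub>D\<^esub> q = \<alpha> y h \<cdot>\<^bsub>D\<^esub> e"
      using R.dom.comp_assoc[OF q m a] mq by simp
    moreover have "farr R (\<alpha> y h \<cdot>\<^bsub>D\<^esub> e) \<cdot>\<^bsub>C\<^esub> \<eta> = farr R (\<alpha> y h) \<cdot>\<^bsub>C\<^esub> (farr R e \<cdot>\<^bsub>C\<^esub> \<eta>)"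
      using R.farr_comp[OF e a] R.cod.comp_assoc[OF \<eta> R.farr_closed[OF e] R.farr_closed[OF a]] by simp
    ultimately show "\<alpha> y h \<cdot>\<^bsub>D\<^esub> m \<in> Hom D l y \<and> farr R (\<alpha> y h \<cdot>\<^bsub>D\<^esub> m) \<cdot>\<^bsub>C\<^esub> \<eta>' = h"
      using am R\<eta>'[OF am] e\<eta> retr[OF y h] by simp
  next
    fix g assume g: "g \<in> Hom D l y \<and> farr R g \<cdot>\<^bsub>C\<^esub> \<eta>' = h"
    note gq = R.dom.comp_closed[OF q conjunct1[OF g]]
    \<comment> \<open>Uniqueness: \<open>h\<close> is \<open>R (g \<cdot> q)\<close> after
      \<open>\<eta>\<close>, so \<open>nat\<close> expresses \<open>\<alpha> y h\<close> through
      \<open>e\<close>; composing with \<open>m\<close> then leaves \<open>g\<close>.\<close>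
    have "\<alpha> y h = g \<cdot>\<^bsub>D\<^esub> q \<cdot>\<^bsub>D\<^esub> e"
      using nat[OF \<eta> gq] R\<eta>'[OF conjunct1[OF g]] g by (simp add: e_def)
    then have "\<alpha> y h \<cdot>\<^bsub>D\<^esub> m = (g \<cdot>\<^bsub>D\<^esub> q) \<cdot>\<^bsub>D\<^esub> (e \<cdot>\<^bsub>D\<^esub> m)"
      using R.dom.comp_assoc[OF m e gq] by simp
    also have "e \<cdot>\<^bsub>D\<^esub> m = m"
      using R.dom.comp_assoc[OF m q m] mq qm R.dom.ident_right[OF m] by simp
    also have "(g \<cdot>\<^bsub>D\<^esub> q) \<cdot>\<^bsub>D\<^esub> m = g"
      using R.dom.comp_assoc[OF m q conjunct1[OF g]] qm R.dom.ident_right[OF conjunct1[OF g]] by simp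
    finally show "g = \<alpha> y h \<cdot>\<^bsub>D\<^esub> m" by simp
  qed
  then have "universal_arrow C D R x l \<eta>'" using l \<eta>' by (simp add: universal_arrow_def)
  then show ?thesis by blast
qed

section \<open>Presheaves\<close>

lemma op_cat_simps [simp]:
  "Obj (op_cat C) = Obj C" "Arr (op_cat C) = Arr C" "Dom (op_cat C) = Cod C" "Cod (op_cat C) = Dom C"
  "Ident (op_cat C) = Ident C" "g \<cdot>\<^bsub>op_cat C\<^esub> f = f \<cdot>\<^bsub>C\<^esub> g"
  by (simp_all add: op_cat_def)

lemma Hom_op_cat [simp]: "Hom (op_cat C) x y = Hom C y x"
  by (auto simp: Hom_def)

lemma category_op_cat:
  assumes "category C"
  shows "category (op_cat C)"
proof -
  interpret category C by fact
  show ?thesis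
    by unfold_locales
      (simp_all add: dom_closed cod_closed ident_closed comp_closed comp_assoc[symmetric]
        ident_left ident_right)
qed

lemma set_cat_simps [simp]:
  "Obj (set_cat elts) = UNIV"
  "Ident (set_cat elts) A = (A, A, \<lambda>x\<in>elts A. x)"
  "(B', D, g) \<cdot>\<^bsub>set_cat elts\<^esub> (A, B, f) = (A, D, compose (elts A) g f)"
  by (simp_all add: set_cat_def)

lemma Hom_set_cat: "Hom (set_cat elts) A B = {(A, B, f) |f. f \<in> elts A \<rightarrow>\<^sub>E elts B}"
  by (auto simp: Hom_def set_cat_def)

lemma category_set_cat: "category (set_cat elts)"
proof
  fix f assume "f \<in> Arr (set_cat elts)"
  show "Dom (set_cat elts) f \<in> Obj (set_cat elts)" "Cod (set_cat elts) f \<in> Obj (set_cat elts)"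
    by simp_all
next
  fix x show "Ident (set_cat elts) x \<in> Hom (set_cat elts) x x" by (simp add: Hom_set_cat)
next
  fix f g x y z
  assume "f \<in> Hom (set_cat elts) x y" "g \<in> Hom (set_cat elts) y z"
  then show "g \<cdot>\<^bsub>set_cat elts\<^esub> f \<in> Hom (set_cat elts) x z"
    by (auto simp: Hom_set_cat compose_def PiE_iff)
next
  fix f g h w x y z
  assume "f \<in> Hom (set_cat elts) w x" "g \<in> Hom (set_cat elts) x y" "h \<in> Hom (set_cat elts) y z"
  then show "h \<cdot>\<^bsub>set_cat elts\<^esub> g \<cdot>\<^bsub>set_cat elts\<^esub> f = h \<cdot>\<^bsub>set_cat elts\<^esub> (g \<cdot>\<^bsub>set_cat elts\<^esub> f)"
    by (auto simp: Hom_set_cat compose_def PiE_iff intro!: restrict_ext)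
next
  fix f x y assume "f \<in> Hom (set_cat elts) x y"
  then show "Ident (set_cat elts) y \<cdot>\<^bsub>set_cat elts\<^esub> f = f"
    "f \<cdot>\<^bsub>set_cat elts\<^esub> Ident (set_cat elts) x = f"
    by (auto simp: Hom_set_cat compose_def PiE_iff extensional_def fun_eq_iff) metis
qed

section \<open>Functor categories\<close>

lemma functor_cat_simps:
  "Obj (functor_cat C D) = {F. cat_functor C D F \<and> fobj F \<in> extensional (Obj C) \<and>
     farr F \<in> extensional (Arr C)}"
  "Ident (functor_cat C D) F = (F, F, \<lambda>x\<in>Obj C. Ident D (fobj F x))"
  "(G', H, \<sigma>) \<cdot>\<^bsub>functor_cat C D\<^esub> (F, G, \<tau>) = (F, H, \<lambda>x\<in>Obj C. \<sigma> x \<cdot>\<^bsub>D\<^esub> \<tau> x)"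
  by (simp_all add: functor_cat_def)

lemma Hom_functor_cat:
  "Hom (functor_cat C D) F G = {(F, G, \<tau>) |\<tau>. F \<in> Obj (functor_cat C D) \<and>
     G \<in> Obj (functor_cat C D) \<and> natural C D F G \<tau> \<and> \<tau> \<in> extensional (Obj C)}"
  by (auto simp: Hom_def functor_cat_def)

lemma natural_comp:
  assumes "natural C D F G \<tau>" "natural C D G H \<sigma>"
  shows "natural C D F H (\<lambda>x\<in>Obj C. \<sigma> x \<cdot>\<^bsub>D\<^esub> \<tau> x)"
proof -
  interpret F: cat_functor C D F using assms by (simp add: natural_def)
  interpret G: cat_functor C D G using assms by (simp add: natural_def)
  interpret H: cat_functor C D H using assms by (simp add: natural_def)
  have \<tau>: "\<tau> x \<in> Hom D (fobj F x) (fobj G x)" if "x \<in> Obj C" for x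
    using assms that by (simp add: natural_def)
  have \<sigma>: "\<sigma> x \<in> Hom D (fobj G x) (fobj H x)" if "x \<in> Obj C" for x
    using assms that by (simp add: natural_def)
  have "(\<sigma> (Cod C f) \<cdot>\<^bsub>D\<^esub> \<tau> (Cod C f)) \<cdot>\<^bsub>D\<^esub> farr F f = farr H f \<cdot>\<^bsub>D\<^esub> (\<sigma> (Dom C f) \<cdot>\<^bsub>D\<^esub> \<tau> (Dom C f))"
    if f: "f \<in> Arr C" for f
  proof -
    have h: "f \<in> Hom C (Dom C f) (Cod C f)" using f by (simp add: Hom_def)
    note x = F.dom.dom_closed[OF f] and y = F.dom.cod_closed[OF f]
    have "(\<sigma> (Cod C f) \<cdot>\<^bsub>D\<^esub> \<tau> (Cod C f)) \<cdot>\<^bsub>D\<^esub> farr F f = \<sigma> (Cod C f) \<cdot>\<^bsub>D\<^esub> (farr G f \<cdot>\<^bsub>D\<^esub> \<tau> (Dom C f))"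
      using F.cod.comp_assoc[OF F.farr_closed[OF h] \<tau>[OF y] \<sigma>[OF y]] assms(1) f
      by (simp add: natural_def)
    also have "\<dots> = (farr H f \<cdot>\<^bsub>D\<^esub> \<sigma> (Dom C f)) \<cdot>\<^bsub>D\<^esub> \<tau> (Dom C f)"
      using F.cod.comp_assoc[OF \<tau>[OF x] G.farr_closed[OF h] \<sigma>[OF y]] assms(2) f
      by (simp add: natural_def)
    finally show ?thesis
      using F.cod.comp_assoc[OF \<tau>[OF x] \<sigma>[OF x] H.farr_closed[OF h]] by simp
  qed
  then show ?thesis
    using F.cat_functor_axioms H.cat_functor_axioms F.cod.comp_closed[OF \<tau> \<sigma>]
      F.dom.dom_closed F.dom.cod_closed
    by (simp add: natural_def)
qed

lemma category_functor_cat: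
  assumes "category C" "category D"
  shows "category (functor_cat C D)"
proof -
  interpret C: category C by fact
  interpret D: category D by fact
  have ident: "natural C D F F (\<lambda>x\<in>Obj C. Ident D (fobj F x))" if "cat_functor C D F" for F
  proof -
    interpret F: cat_functor C D F by fact
    have "Ident D (fobj F (Cod C f)) \<cdot>\<^bsub>D\<^esub> farr F f = farr F f \<cdot>\<^bsub>D\<^esub> Ident D (fobj F (Dom C f))"
      if "f \<in> Arr C" for f
    proof -
      have "f \<in> Hom C (Dom C f) (Cod C f)" using that by (simp add: Hom_def)
      from F.farr_closed[OF this] show ?thesis using D.ident_left D.ident_right by simp
    qed
    then show ?thesis using that
      by (simp add: natural_def D.ident_closed F.fobj_closed C.dom_closed C.cod_closed)
  qed
  have \<tau>: "\<tau> x \<in> Hom D (fobj F x) (fobj G x)" if "natural C D F G \<tau>" "x \<in> Obj C" for F G \<tau> x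
    using that by (simp add: natural_def)
  show ?thesis
  proof
    fix f assume "f \<in> Arr (functor_cat C D)"
    then show "Dom (functor_cat C D) f \<in> Obj (functor_cat C D)"
      "Cod (functor_cat C D) f \<in> Obj (functor_cat C D)"
      by (auto simp: functor_cat_def)
  next
    fix F assume "F \<in> Obj (functor_cat C D)"
    then show "Ident (functor_cat C D) F \<in> Hom (functor_cat C D) F F"
      using ident by (simp add: Hom_functor_cat functor_cat_simps)
  next
    fix f g F G H
    assume "f \<in> Hom (functor_cat C D) F G" "g \<in> Hom (functor_cat C D) G H"
    then show "g \<cdot>\<^bsub>functor_cat C D\<^esub> f \<in> Hom (functor_cat C D) F H"
      by (auto simp: Hom_functor_cat functor_cat_simps(2,3) intro: natural_comp)
  next
    fix f g h F G H K
    assume "f \<in> Hom (functor_cat C D) F G" "g \<in> Hom (functor_cat C D) G H"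
      "h \<in> Hom (functor_cat C D) H K"
    then show "h \<cdot>\<^bsub>functor_cat C D\<^esub> g \<cdot>\<^bsub>functor_cat C D\<^esub> f = h \<cdot>\<^bsub>functor_cat C D\<^esub> (g \<cdot>\<^bsub>functor_cat C D\<^esub> f)"
      by (auto simp: Hom_functor_cat functor_cat_simps(2,3) intro!: restrict_ext D.comp_assoc[OF \<tau> \<tau> \<tau>])
  next
    fix f F G
    assume f: "f \<in> Hom (functor_cat C D) F G"
    then show "Ident (functor_cat C D) G \<cdot>\<^bsub>functor_cat C D\<^esub> f = f"
      "f \<cdot>\<^bsub>functor_cat C D\<^esub> Ident (functor_cat C D) F = f"
      by (auto simp: Hom_functor_cat functor_cat_simps(2,3) fun_eq_iff extensional_def
          D.ident_left[OF \<tau>] D.ident_right[OF \<tau>])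
  qed
qed

section \<open>Presheaf categories, described by elements\<close>

lemma category_presheaf_cat: "category A \<Longrightarrow> category (presheaf_cat elts A)"
  unfolding presheaf_cat_def by (intro category_functor_cat category_op_cat category_set_cat)

text \<open>\<open>snd (snd m)\<close> is the family of components of \<open>m\<close>. From here on
  arrows of presheaves are handled elementwise through \<open>ev\<close>, with
  \<open>psh_arr_eqI\<close> for equality.\<close>

definition ev :: "('o, 'a, 'u) psh_arr \<Rightarrow> 'o \<Rightarrow> 'u \<Rightarrow> 'u" where
  "ev m x = app (snd (snd m) x)"

lemma psh_app_closed:
  assumes "F \<in> Obj (presheaf_cat elts A)" "f \<in> Hom A x y" "a \<in> elts (fobj F y)"
  shows "app (farr F f) a \<in> elts (fobj F x)"
proof -
  interpret F: cat_functor "op_cat A" "set_cat elts" F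
    using assms(1) by (simp add: presheaf_cat_def functor_cat_simps)
  show ?thesis using F.farr_closed[of f y x] assms(2,3) by (auto simp: Hom_set_cat app_def)
qed

lemma psh_app_ident:
  assumes "F \<in> Obj (presheaf_cat elts A)" "x \<in> Obj A" "a \<in> elts (fobj F x)"
  shows "app (farr F (Ident A x)) a = a"
proof -
  interpret F: cat_functor "op_cat A" "set_cat elts" F
    using assms(1) by (simp add: presheaf_cat_def functor_cat_simps)
  show ?thesis using F.farr_ident[of x] assms(2,3) by (simp add: app_def)
qed

lemma psh_app_comp:
  assumes "F \<in> Obj (presheaf_cat elts A)" "f \<in> Hom A x y" "g \<in> Hom A y z" "a \<in> elts (fobj F z)"
  shows "app (farr F (g \<cdot>\<^bsub>A\<^esub> f)) a = app (farr F f) (app (farr F g) a)"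
proof -
  interpret F: cat_functor "op_cat A" "set_cat elts" F
    using assms(1) by (simp add: presheaf_cat_def functor_cat_simps)
  have "farr F (g \<cdot>\<^bsub>A\<^esub> f) = farr F f \<cdot>\<^bsub>set_cat elts\<^esub> farr F g"
    using F.farr_comp[of g z y f x] assms(2,3) by simp
  then show ?thesis
    using F.farr_closed[of f y x] F.farr_closed[of g z y] assms
    by (auto simp: Hom_set_cat app_def compose_def)
qed

text \<open>Membership in \<open>functor_cat\<close> demands values restricted to the carriers;
  building the restriction in here leaves \<open>ob\<close> and \<open>ac\<close> arbitrary
  elsewhere.\<close>

definition mk_psh ::
  "('u \<Rightarrow> 'u set) \<Rightarrow> ('o, 'a) cat \<Rightarrow> ('o \<Rightarrow> 'u) \<Rightarrow> ('a \<Rightarrow> 'u \<Rightarrow> 'u) \<Rightarrow> ('o, 'a, 'u) psh" where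
  "mk_psh elts A ob ac =
     \<lparr>fobj = (\<lambda>x\<in>Obj A. ob x),
      farr = (\<lambda>f\<in>Arr A. (ob (Cod A f), ob (Dom A f), \<lambda>a\<in>elts (ob (Cod A f)). ac f a))\<rparr>"

lemma fobj_mk_psh [simp]: "x \<in> Obj A \<Longrightarrow> fobj (mk_psh elts A ob ac) x = ob x"
  by (simp add: mk_psh_def)

lemma app_mk_psh [simp]:
  "f \<in> Hom A x y \<Longrightarrow> a \<in> elts (ob y) \<Longrightarrow> app (farr (mk_psh elts A ob ac) f) a = ac f a"
  by (auto simp: mk_psh_def app_def Hom_def)

lemma mk_psh_closed:
  assumes A: "category A"
    and closed: "\<And>f x y a. f \<in> Hom A x y \<Longrightarrow> a \<in> elts (ob y) \<Longrightarrow> ac f a \<in> elts (ob x)"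
    and ident: "\<And>x a. x \<in> Obj A \<Longrightarrow> a \<in> elts (ob x) \<Longrightarrow> ac (Ident A x) a = a"
    and comp: "\<And>f g x y z a. f \<in> Hom A x y \<Longrightarrow> g \<in> Hom A y z \<Longrightarrow> a \<in> elts (ob z) \<Longrightarrow>
      ac (g \<cdot>\<^bsub>A\<^esub> f) a = ac f (ac g a)"
  shows "mk_psh elts A ob ac \<in> Obj (presheaf_cat elts A)"
proof -
  interpret A: category A by fact
  have farr: "farr (mk_psh elts A ob ac) f = (ob y, ob x, \<lambda>a\<in>elts (ob y). ac f a)"
    if "f \<in> Hom A x y" for f x y
    using that by (auto simp: mk_psh_def Hom_def)
  have "cat_functor (op_cat A) (set_cat elts) (mk_psh elts A ob ac)"
  proof (intro cat_functor.intro category_op_cat category_set_cat A cat_functor_axioms.intro, goal_cases)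
    case (1 x) then show ?case by simp
  next
    case (2 f x y)
    then have f: "f \<in> Hom A y x" by simp
    show ?case using closed[OF f] A.Hom_objD[OF f] by (simp add: Hom_set_cat farr[OF f])
  next
    case (3 x)
    then have x: "x \<in> Obj A" by simp
    show ?case using ident x by (auto simp: farr[OF A.ident_closed[OF x]] intro!: restrict_ext)
  next
    case (4 f x y g z)
    then have f: "f \<in> Hom A y x" and g: "g \<in> Hom A z y" by simp_all
    show ?case
      using comp[OF g f] closed[OF f]
      by (simp add: farr[OF f] farr[OF g] farr[OF A.comp_closed[OF g f]] compose_def cong: restrict_cong)
  qed
  then show ?thesis by (simp add: presheaf_cat_def functor_cat_simps) (simp add: mk_psh_def)
qed

definition mk_arr ::
  "('u \<Rightarrow> 'u set) \<Rightarrow> ('o, 'a) cat \<Rightarrow> ('o, 'a, 'u) psh \<Rightarrow> ('o, 'a, 'u) psh \<Rightarrow> ('o \<Rightarrow> 'u \<Rightarrow> 'u) \<Rightarrow>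
     ('o, 'a, 'u) psh_arr" where
  "mk_arr elts A F G t = (F, G, \<lambda>x\<in>Obj A. (fobj F x, fobj G x, \<lambda>a\<in>elts (fobj F x). t x a))"

lemma ev_mk_arr [simp]:
  "x \<in> Obj A \<Longrightarrow> a \<in> elts (fobj F x) \<Longrightarrow> ev (mk_arr elts A F G t) x a = t x a"
  by (simp add: ev_def mk_arr_def app_def)

text \<open>Puts an unknown \<open>farr F f\<close> into the form of an explicit triple with a
  restricted function, on which the composition rule in \<open>set_cat_simps\<close> can
  fire.\<close>

lemma psh_farr:
  assumes "F \<in> Obj (presheaf_cat elts A)" "f \<in> Hom A x y"
  shows "farr F f = (fobj F y, fobj F x, \<lambda>a\<in>elts (fobj F y). app (farr F f) a)"
proof -
  interpret F: cat_functor "op_cat A" "set_cat elts" F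
    using assms(1) by (simp add: presheaf_cat_def functor_cat_simps)
  show ?thesis using F.farr_closed[of f y x] assms(2)
    by (auto simp: Hom_set_cat app_def PiE_iff extensional_restrict)
qed

lemma mk_arr_closed:
  assumes A: "category A" and F: "F \<in> Obj (presheaf_cat elts A)" and G: "G \<in> Obj (presheaf_cat elts A)"
    and closed: "\<And>x a. x \<in> Obj A \<Longrightarrow> a \<in> elts (fobj F x) \<Longrightarrow> t x a \<in> elts (fobj G x)"
    and nat: "\<And>f x y a. f \<in> Hom A x y \<Longrightarrow> a \<in> elts (fobj F y) \<Longrightarrow>
      t x (app (farr F f) a) = app (farr G f) (t y a)"
  shows "mk_arr elts A F G t \<in> Hom (presheaf_cat elts A) F G"
proof -
  interpret A: category A by fact
  have "natural (op_cat A) (set_cat elts) F G (\<lambda>x\<in>Obj A. (fobj F x, fobj G x, \<lambda>a\<in>elts (fobj F x). t x a))"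
    unfolding natural_def
  proof (intro conjI ballI, goal_cases)
    case (4 f)
    then have f: "f \<in> Hom A (Dom A f) (Cod A f)" by (simp add: Hom_def)
    show ?case
      using nat[OF f] psh_app_closed[OF F f] closed A.Hom_objD[OF f]
      by (subst (1) psh_farr[OF F f], subst (1) psh_farr[OF G f])
        (auto simp: compose_def intro!: restrict_ext)
  qed (use F G closed in \<open>simp_all add: presheaf_cat_def functor_cat_simps Hom_set_cat\<close>)
  then show ?thesis using F G by (simp add: Hom_functor_cat mk_arr_def presheaf_cat_def)
qed

lemma ev_closed:
  assumes "m \<in> Hom (presheaf_cat elts A) F G" "x \<in> Obj A" "a \<in> elts (fobj F x)"
  shows "ev m x a \<in> elts (fobj G x)"
proof -
  obtain \<tau> where "m = (F, G, \<tau>)" "natural (op_cat A) (set_cat elts) F G \<tau>"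
    using assms(1) unfolding presheaf_cat_def Hom_functor_cat by blast
  then have "snd (snd m) x \<in> Hom (set_cat elts) (fobj F x) (fobj G x)"
    using assms(2) by (simp add: natural_def)
  then show ?thesis using assms(3) by (auto simp: Hom_set_cat ev_def app_def)
qed

lemma ev_natural:
  assumes "m \<in> Hom (presheaf_cat elts A) F G" "f \<in> Hom A x y" "a \<in> elts (fobj F y)"
  shows "ev m x (app (farr F f) a) = app (farr G f) (ev m y a)"
proof -
  obtain \<tau> where m: "m = (F, G, \<tau>)" and n: "natural (op_cat A) (set_cat elts) F G \<tau>"
    and F: "F \<in> Obj (presheaf_cat elts A)" and G: "G \<in> Obj (presheaf_cat elts A)"
    using assms(1) unfolding presheaf_cat_def Hom_functor_cat by blast
  interpret F: cat_functor "op_cat A" "set_cat elts" F using n by (simp add: natural_def)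
  have xy: "x \<in> Obj A" "y \<in> Obj A" using F.dom.Hom_objD[of f y x] assms(2) by simp_all
  have "\<tau> x \<cdot>\<^bsub>set_cat elts\<^esub> farr F f = farr G f \<cdot>\<^bsub>set_cat elts\<^esub> \<tau> y"
    using n assms(2) by (auto simp: natural_def Hom_def)
  moreover have "\<tau> x \<in> Hom (set_cat elts) (fobj F x) (fobj G x)"
    "\<tau> y \<in> Hom (set_cat elts) (fobj F y) (fobj G y)"
    using n xy by (simp_all add: natural_def)
  ultimately have "compose (elts (fobj F y)) (snd (snd (\<tau> x))) (snd (snd (farr F f))) =
      compose (elts (fobj F y)) (snd (snd (farr G f))) (snd (snd (\<tau> y)))"
    by (subst (asm) psh_farr[OF F assms(2)], subst (asm) psh_farr[OF G assms(2)],
        subst psh_farr[OF F assms(2)], subst psh_farr[OF G assms(2)]) (auto simp: Hom_set_cat)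
  from fun_cong[OF this, of a] show ?thesis
    using assms(3) by (simp add: compose_def ev_def app_def m)
qed

lemma psh_arr_eqI:
  assumes m: "m \<in> Hom (presheaf_cat elts A) F G" "n \<in> Hom (presheaf_cat elts A) F G"
    and eq: "\<And>x a. x \<in> Obj A \<Longrightarrow> a \<in> elts (fobj F x) \<Longrightarrow> ev m x a = ev n x a"
  shows "m = n"
proof -
  obtain \<sigma> \<tau> where mn: "m = (F, G, \<sigma>)" "n = (F, G, \<tau>)" "natural (op_cat A) (set_cat elts) F G \<sigma>"
      "natural (op_cat A) (set_cat elts) F G \<tau>" "\<sigma> \<in> extensional (Obj A)" "\<tau> \<in> extensional (Obj A)"
    using m unfolding presheaf_cat_def Hom_functor_cat by auto
  have "\<sigma> x = \<tau> x" if x: "x \<in> Obj A" for x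
  proof -
    have "\<sigma> x \<in> Hom (set_cat elts) (fobj F x) (fobj G x)"
      "\<tau> x \<in> Hom (set_cat elts) (fobj F x) (fobj G x)"
      using mn x by (simp_all add: natural_def)
    then obtain f g where fg: "\<sigma> x = (fobj F x, fobj G x, f)" "\<tau> x = (fobj F x, fobj G x, g)"
      and ext: "f \<in> elts (fobj F x) \<rightarrow>\<^sub>E elts (fobj G x)" "g \<in> elts (fobj F x) \<rightarrow>\<^sub>E elts (fobj G x)"
      by (auto simp: Hom_set_cat)
    have "f = g" using eq[OF x] by (intro PiE_ext[OF ext]) (simp add: ev_def app_def mn fg)
    then show ?thesis by (simp add: fg)
  qed
  then show ?thesis using mn by (auto intro: extensionalityI)
qed

lemma ev_comp:
  assumes "m \<in> Hom (presheaf_cat elts A) F G" "n \<in> Hom (presheaf_cat elts A) G H"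
    "x \<in> Obj A" "a \<in> elts (fobj F x)"
  shows "ev (n \<cdot>\<^bsub>presheaf_cat elts A\<^esub> m) x a = ev n x (ev m x a)"
proof -
  obtain \<sigma> \<tau> where mn: "m = (F, G, \<sigma>)" "n = (G, H, \<tau>)" "natural (op_cat A) (set_cat elts) F G \<sigma>"
      "natural (op_cat A) (set_cat elts) G H \<tau>"
    using assms(1,2) unfolding presheaf_cat_def Hom_functor_cat by blast
  have "\<sigma> x \<in> Hom (set_cat elts) (fobj F x) (fobj G x)"
    "\<tau> x \<in> Hom (set_cat elts) (fobj G x) (fobj H x)"
    using mn assms(3) by (simp_all add: natural_def)
  then show ?thesis
    using assms(3,4)
    by (auto simp: mn Hom_set_cat ev_def app_def presheaf_cat_def functor_cat_simps compose_def)
qed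

lemma ev_ident:
  assumes "x \<in> Obj A" "a \<in> elts (fobj F x)"
  shows "ev (Ident (presheaf_cat elts A) F) x a = a"
  using assms by (simp add: ev_def app_def presheaf_cat_def functor_cat_simps)

section \<open>Weighted colimits and density\<close>

text \<open>This is a natural transformation from \<open>F\<close> to \<open>B(K -, b)\<close>.
  Written as a family of arrows it avoids coding the hom-sets of \<open>B\<close> in the
  universe.\<close>

definition weighted_cocone ::
  "('u \<Rightarrow> 'u set) \<Rightarrow> ('o1, 'a1) cat \<Rightarrow> ('o2, 'a2) cat \<Rightarrow> ('o1, 'a1, 'u) psh \<Rightarrow>
     ('o1, 'a1, 'o2, 'a2) func \<Rightarrow> 'o2 \<Rightarrow> ('o1 \<Rightarrow> 'u \<Rightarrow> 'a2) \<Rightarrow> bool" where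
  "weighted_cocone elts A B F K b i \<longleftrightarrow> b \<in> Obj B \<and>
     (\<forall>x\<in>Obj A. \<forall>a\<in>elts (fobj F x). i x a \<in> Hom B (fobj K x) b) \<and>
     (\<forall>x y. \<forall>f\<in>Hom A x y. \<forall>a\<in>elts (fobj F y). i x (app (farr F f) a) = i y a \<cdot>\<^bsub>B\<^esub> farr K f)"

text \<open>Equivalently the colimit of \<open>K\<close> over the category of elements of
  \<open>F\<close>, an index category that may be large.\<close>

definition weighted_colimit ::
  "('u \<Rightarrow> 'u set) \<Rightarrow> ('o1, 'a1) cat \<Rightarrow> ('o2, 'a2) cat \<Rightarrow> ('o1, 'a1, 'u) psh \<Rightarrow>
     ('o1, 'a1, 'o2, 'a2) func \<Rightarrow> 'o2 \<Rightarrow> ('o1 \<Rightarrow> 'u \<Rightarrow> 'a2) \<Rightarrow> bool" where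
  "weighted_colimit elts A B F K b i \<longleftrightarrow> weighted_cocone elts A B F K b i \<and>
     (\<forall>b' i'. weighted_cocone elts A B F K b' i' \<longrightarrow>
        (\<exists>!h. h \<in> Hom B b b' \<and> (\<forall>x\<in>Obj A. \<forall>a\<in>elts (fobj F x). h \<cdot>\<^bsub>B\<^esub> i x a = i' x a)))"

lemma weighted_coconeI:
  assumes "b \<in> Obj B"
    and "\<And>x a. x \<in> Obj A \<Longrightarrow> a \<in> elts (fobj F x) \<Longrightarrow> i x a \<in> Hom B (fobj K x) b"
    and "\<And>x y f a. f \<in> Hom A x y \<Longrightarrow> a \<in> elts (fobj F y) \<Longrightarrow>
      i x (app (farr F f) a) = i y a \<cdot>\<^bsub>B\<^esub> farr K f"
  shows "weighted_cocone elts A B F K b i"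
  using assms by (simp add: weighted_cocone_def)

lemma weighted_coconeD:
  assumes "weighted_cocone elts A B F K b i"
  shows "b \<in> Obj B"
    and "\<And>x a. x \<in> Obj A \<Longrightarrow> a \<in> elts (fobj F x) \<Longrightarrow> i x a \<in> Hom B (fobj K x) b"
    and "\<And>x y f a. f \<in> Hom A x y \<Longrightarrow> a \<in> elts (fobj F y) \<Longrightarrow>
      i x (app (farr F f) a) = i y a \<cdot>\<^bsub>B\<^esub> farr K f"
  using assms by (simp_all add: weighted_cocone_def)

lemma weighted_colimit_cocone: "weighted_colimit elts A B F K b i \<Longrightarrow> weighted_cocone elts A B F K b i"
  by (simp add: weighted_colimit_def)

lemma weighted_colimit_ex:
  assumes "weighted_colimit elts A B F K b i" "weighted_cocone elts A B F K b' i'"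
  obtains h where "h \<in> Hom B b b'"
    and "\<And>x a. x \<in> Obj A \<Longrightarrow> a \<in> elts (fobj F x) \<Longrightarrow> h \<cdot>\<^bsub>B\<^esub> i x a = i' x a"
  using assms unfolding weighted_colimit_def by blast

lemma weighted_cocone_postcomp:
  assumes "cat_functor A B K" "weighted_cocone elts A B F K b i" "h \<in> Hom B b b'"
  shows "weighted_cocone elts A B F K b' (\<lambda>x a. h \<cdot>\<^bsub>B\<^esub> i x a)"
proof -
  interpret K: cat_functor A B K by fact
  note i = weighted_coconeD[OF assms(2)]
  show ?thesis
  proof (rule weighted_coconeI)
    show "b' \<in> Obj B" by (rule K.cod.Hom_objD(2)[OF assms(3)])
    show "h \<cdot>\<^bsub>B\<^esub> i x a \<in> Hom B (fobj K x) b'" if "x \<in> Obj A" "a \<in> elts (fobj F x)" for x a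
      by (rule K.cod.comp_closed[OF i(2)[OF that] assms(3)])
    show "h \<cdot>\<^bsub>B\<^esub> i x (app (farr F f) a) = (h \<cdot>\<^bsub>B\<^esub> i y a) \<cdot>\<^bsub>B\<^esub> farr K f"
      if f: "f \<in> Hom A x y" and a: "a \<in> elts (fobj F y)" for x y f a
      using i(3)[OF that] K.cod.comp_assoc[OF K.farr_closed[OF f] i(2)[OF K.dom.Hom_objD(2)[OF f] a] assms(3)]
      by simp
  qed
qed

lemma weighted_colimit_eqI:
  assumes "cat_functor A B K" "weighted_colimit elts A B F K b i" "h \<in> Hom B b b'" "h' \<in> Hom B b b'"
    and "\<And>x a. x \<in> Obj A \<Longrightarrow> a \<in> elts (fobj F x) \<Longrightarrow> h \<cdot>\<^bsub>B\<^esub> i x a = h' \<cdot>\<^bsub>B\<^esub> i x a"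
  shows "h = h'"
proof -
  have "weighted_cocone elts A B F K b' (\<lambda>x a. h' \<cdot>\<^bsub>B\<^esub> i x a)"
    by (rule weighted_cocone_postcomp[OF assms(1) weighted_colimit_cocone[OF assms(2)] assms(4)])
  then have "\<exists>!g. g \<in> Hom B b b' \<and> (\<forall>x\<in>Obj A. \<forall>a\<in>elts (fobj F x). g \<cdot>\<^bsub>B\<^esub> i x a = h' \<cdot>\<^bsub>B\<^esub> i x a)"
    using assms(2) by (simp add: weighted_colimit_def)
  then show ?thesis using assms(3-5) by blast
qed

lemma cat_functor_comp_func:
  assumes "cat_functor A B F" "cat_functor B C G"
  shows "cat_functor A C (comp_func G F)"
proof -
  interpret F: cat_functor A B F by fact
  interpret G: cat_functor B C G by fact
  show ?thesis
    by unfold_locales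
      (simp_all add: comp_func_def F.fobj_closed G.fobj_closed F.farr_closed G.farr_closed
        F.farr_ident G.farr_ident F.farr_comp G.farr_comp[OF F.farr_closed F.farr_closed])
qed

lemma cat_functor_id_func: "category A \<Longrightarrow> cat_functor A A id_func"
  by (intro cat_functor.intro cat_functor_axioms.intro) (simp_all add: id_func_def)

text \<open>Cocones under \<open>L K\<close> with vertex \<open>d\<close> transpose to cocones under
  \<open>K\<close> with vertex \<open>R d\<close>, leg by leg, and mediating arrows transpose along
  with them.\<close>

lemma weighted_colimit_left_adjoint:
  assumes K: "cat_functor A B K" and adj: "adjoint B D L R" and col: "weighted_colimit elts A B F K b i"
  shows "weighted_colimit elts A D F (comp_func L K) (fobj L b) (\<lambda>x a. farr L (i x a))"
proof -
  interpret K: cat_functor A B K by fact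
  interpret L: cat_functor B D L using adj by (simp add: adjoint_def)
  interpret R: cat_functor D B R using adj by (simp add: adjoint_def)
  obtain \<eta> where u: "\<And>x. x \<in> Obj B \<Longrightarrow> universal_arrow B D R x (fobj L x) (\<eta> x)"
    and nat: "\<And>x y f. f \<in> Hom B x y \<Longrightarrow> farr R (farr L f) \<cdot>\<^bsub>B\<^esub> \<eta> x = \<eta> y \<cdot>\<^bsub>B\<^esub> f"
    using adjoint_unit[OF adj] by blast
  have \<eta>: "\<eta> x \<in> Hom B x (fobj R (fobj L x))" if "x \<in> Obj B" for x
    using u[OF that] by (simp add: universal_arrow_def)
  have ex1: "\<exists>!g. g \<in> Hom D (fobj L x) y \<and> farr R g \<cdot>\<^bsub>B\<^esub> \<eta> x = h"
    if "x \<in> Obj B" "y \<in> Obj D" "h \<in> Hom B x (fobj R y)" for x y h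
    using u[OF that(1)] that by (simp add: universal_arrow_def)
  note i = weighted_coconeD[OF weighted_colimit_cocone[OF col]]
  have LK: "cat_functor A D (comp_func L K)"
    by (rule cat_functor_comp_func[OF K L.cat_functor_axioms])
  have cocone: "weighted_cocone elts A D F (comp_func L K) (fobj L b) (\<lambda>x a. farr L (i x a))"
  proof (rule weighted_coconeI)
    show "fobj L b \<in> Obj D" by (rule L.fobj_closed[OF i(1)])
    show "farr L (i x a) \<in> Hom D (fobj (comp_func L K) x) (fobj L b)"
      if "x \<in> Obj A" "a \<in> elts (fobj F x)" for x a
      using L.farr_closed[OF i(2)[OF that]] by (simp add: comp_func_def)
    show "farr L (i x (app (farr F f) a)) = farr L (i y a) \<cdot>\<^bsub>D\<^esub> farr (comp_func L K) f"
      if "f \<in> Hom A x y" "a \<in> elts (fobj F y)" for x y f a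
      using i(3)[OF that] L.farr_comp[OF K.farr_closed[OF that(1)] i(2)[OF K.dom.Hom_objD(2)[OF that(1)] that(2)]]
      by (simp add: comp_func_def)
  qed
  have "\<exists>!h. h \<in> Hom D (fobj L b) d \<and> (\<forall>x\<in>Obj A. \<forall>a\<in>elts (fobj F x). h \<cdot>\<^bsub>D\<^esub> farr L (i x a) = k x a)"
    if "weighted_cocone elts A D F (comp_func L K) d k" for d k
  proof -
    note k = weighted_coconeD[OF that, unfolded comp_func_def, simplified]
    have "weighted_cocone elts A B F K (fobj R d) (\<lambda>x a. farr R (k x a) \<cdot>\<^bsub>B\<^esub> \<eta> (fobj K x))"
    proof (rule weighted_coconeI)
      show "fobj R d \<in> Obj B" by (rule R.fobj_closed[OF k(1)])
      show "farr R (k x a) \<cdot>\<^bsub>B\<^esub> \<eta> (fobj K x) \<in> Hom B (fobj K x) (fobj R d)"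
        if "x \<in> Obj A" "a \<in> elts (fobj F x)" for x a
        by (rule K.cod.comp_closed[OF \<eta>[OF K.fobj_closed[OF that(1)]] R.farr_closed[OF k(2)[OF that]]])
      show "farr R (k x (app (farr F f) a)) \<cdot>\<^bsub>B\<^esub> \<eta> (fobj K x) = (farr R (k y a) \<cdot>\<^bsub>B\<^esub> \<eta> (fobj K y)) \<cdot>\<^bsub>B\<^esub> farr K f"
        if f: "f \<in> Hom A x y" and a: "a \<in> elts (fobj F y)" for x y f a
      proof -
        note xy = K.dom.Hom_objD[OF f]
        note Kf = K.farr_closed[OF f]
        note LKf = L.farr_closed[OF Kf]
        note ky = k(2)[OF xy(2) a]
        have "farr R (k x (app (farr F f) a)) = farr R (k y a) \<cdot>\<^bsub>B\<^esub> farr R (farr L (farr K f))"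
          using k(3)[OF f a] R.farr_comp[OF LKf ky] by simp
        then show ?thesis
          using K.cod.comp_assoc[OF \<eta>[OF K.fobj_closed[OF xy(1)]] R.farr_closed[OF LKf] R.farr_closed[OF ky]]
            nat[OF Kf] K.cod.comp_assoc[OF Kf \<eta>[OF K.fobj_closed[OF xy(2)]] R.farr_closed[OF ky]]
          by simp
      qed
    qed
    then obtain g where g: "g \<in> Hom B b (fobj R d)"
      and gi: "\<And>x a. x \<in> Obj A \<Longrightarrow> a \<in> elts (fobj F x) \<Longrightarrow>
        g \<cdot>\<^bsub>B\<^esub> i x a = farr R (k x a) \<cdot>\<^bsub>B\<^esub> \<eta> (fobj K x)"
      using weighted_colimit_ex[OF col] by blast
    \<comment> \<open>The transpose of \<open>h\<close> restricted to a leg is the transpose of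
      \<open>h\<close>, restricted to that leg; so the equations for \<open>h\<close> and for its
      transpose are the same equations.\<close>
    have transpose: "farr R (h \<cdot>\<^bsub>D\<^esub> farr L (i x a)) \<cdot>\<^bsub>B\<^esub> \<eta> (fobj K x) = (farr R h \<cdot>\<^bsub>B\<^esub> \<eta> b) \<cdot>\<^bsub>B\<^esub> i x a"
      if h: "h \<in> Hom D (fobj L b) d" and x: "x \<in> Obj A" and a: "a \<in> elts (fobj F x)" for h x a
      using R.farr_comp[OF L.farr_closed[OF i(2)[OF x a]] h] nat[OF i(2)[OF x a]]
        K.cod.comp_assoc[OF \<eta>[OF K.fobj_closed[OF x]] R.farr_closed[OF L.farr_closed[OF i(2)[OF x a]]] R.farr_closed[OF h]]
        K.cod.comp_assoc[OF i(2)[OF x a] \<eta>[OF i(1)] R.farr_closed[OF h]]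
      by simp
    have uniq: "h = h'"
      if x: "x \<in> Obj B" and h: "h \<in> Hom D (fobj L x) d" "h' \<in> Hom D (fobj L x) d"
        "farr R h \<cdot>\<^bsub>B\<^esub> \<eta> x = farr R h' \<cdot>\<^bsub>B\<^esub> \<eta> x" for x h h'
      using ex1[OF x k(1) K.cod.comp_closed[OF \<eta>[OF x] R.farr_closed[OF h(2)]]] h by blast
    obtain h where h: "h \<in> Hom D (fobj L b) d" "farr R h \<cdot>\<^bsub>B\<^esub> \<eta> b = g"
      using ex1[OF i(1) k(1) g] by blast
    show ?thesis
    proof (intro ex1I conjI ballI)
      show "h \<in> Hom D (fobj L b) d" by (rule h(1))
      fix x a assume xa: "x \<in> Obj A" "a \<in> elts (fobj F x)"
      show "h \<cdot>\<^bsub>D\<^esub> farr L (i x a) = k x a"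
      proof (rule uniq[OF K.fobj_closed[OF xa(1)]])
        show "h \<cdot>\<^bsub>D\<^esub> farr L (i x a) \<in> Hom D (fobj L (fobj K x)) d"
          by (rule L.cod.comp_closed[OF L.farr_closed[OF i(2)[OF xa]] h(1)])
      qed (use k(2)[OF xa] transpose[OF h(1) xa] h(2) gi[OF xa] in simp_all)
    next
      fix h' assume h': "h' \<in> Hom D (fobj L b) d \<and> (\<forall>x\<in>Obj A. \<forall>a\<in>elts (fobj F x). h' \<cdot>\<^bsub>D\<^esub> farr L (i x a) = k x a)"
      then have h'1: "h' \<in> Hom D (fobj L b) d" by blast
      have "farr R h' \<cdot>\<^bsub>B\<^esub> \<eta> b = g"
      proof (rule weighted_colimit_eqI[OF K col])
        show "farr R h' \<cdot>\<^bsub>B\<^esub> \<eta> b \<in> Hom B b (fobj R d)"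
          by (rule K.cod.comp_closed[OF \<eta>[OF i(1)] R.farr_closed[OF h'1]])
        show "farr R h' \<cdot>\<^bsub>B\<^esub> \<eta> b \<cdot>\<^bsub>B\<^esub> i x a = g \<cdot>\<^bsub>B\<^esub> i x a" if "x \<in> Obj A" "a \<in> elts (fobj F x)" for x a
          using transpose[OF h'1 that] h' that gi[OF that] by simp
      qed (rule g)
      then show "h' = h" using uniq[OF i(1) h'1 h(1)] h(2) by simp
    qed
  qed
  then show ?thesis using cocone by (simp add: weighted_colimit_def)
qed

section \<open>Coded hom-sets, representables and the Yoneda embedding\<close>

lemma bij_hom_enc:
  assumes "locally_small elts A" "x \<in> Obj A" "y \<in> Obj A"
  shows "bij_betw (hom_enc elts A x y) (Hom A x y) (elts (hom_obj elts A x y))"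
proof -
  have "\<exists>u f. bij_betw f (Hom A x y) (elts u)"
    using assms unfolding locally_small_def small_def by blast
  then have "\<exists>f. bij_betw f (Hom A x y) (elts (hom_obj elts A x y))"
    unfolding hom_obj_def by (rule someI_ex)
  then show ?thesis unfolding hom_enc_def by (rule someI_ex)
qed

lemma locally_small_category: "locally_small elts A \<Longrightarrow> category A"
  by (simp add: locally_small_def)

lemma hom_enc_closed:
  assumes "locally_small elts A" "f \<in> Hom A x y"
  shows "hom_enc elts A x y f \<in> elts (hom_obj elts A x y)"
  using bij_betw_apply[OF bij_hom_enc assms(2)] assms(1)
    category.Hom_objD[OF locally_small_category[OF assms(1)] assms(2)] by blast

lemma hom_dec_enc [simp]:
  assumes "locally_small elts A" "f \<in> Hom A x y"
  shows "hom_dec elts A x y (hom_enc elts A x y f) = f"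
  using bij_betw_inv_into_left[OF bij_hom_enc assms(2)] assms(1)
    category.Hom_objD[OF locally_small_category[OF assms(1)] assms(2)]
  unfolding hom_dec_def by blast

lemma hom_dec_closed:
  assumes "locally_small elts A" "x \<in> Obj A" "y \<in> Obj A" "p \<in> elts (hom_obj elts A x y)"
  shows "hom_dec elts A x y p \<in> Hom A x y"
  using bij_betw_apply[OF bij_betw_inv_into[OF bij_hom_enc[OF assms(1-3)]] assms(4)]
  by (simp add: hom_dec_def)

lemma hom_enc_dec [simp]:
  assumes "locally_small elts A" "x \<in> Obj A" "y \<in> Obj A" "p \<in> elts (hom_obj elts A x y)"
  shows "hom_enc elts A x y (hom_dec elts A x y p) = p"
  using bij_betw_inv_into_right[OF bij_hom_enc[OF assms(1-3)] assms(4)] by (simp add: hom_dec_def)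

lemma representable_eq_mk_psh:
  "representable elts A v = mk_psh elts A (\<lambda>x. hom_obj elts A x v)
     (\<lambda>f p. hom_enc elts A (Dom A f) v (hom_dec elts A (Cod A f) v p \<cdot>\<^bsub>A\<^esub> f))"
  by (simp add: representable_def mk_psh_def Let_def)

lemma fobj_representable [simp]: "x \<in> Obj A \<Longrightarrow> fobj (representable elts A v) x = hom_obj elts A x v"
  by (simp add: representable_eq_mk_psh)

lemma app_representable:
  assumes "f \<in> Hom A x y" "p \<in> elts (hom_obj elts A y v)"
  shows "app (farr (representable elts A v) f) p = hom_enc elts A x v (hom_dec elts A y v p \<cdot>\<^bsub>A\<^esub> f)"
  using assms(2) HomD[OF assms(1)] unfolding representable_eq_mk_psh by (subst app_mk_psh[OF assms(1)]) simp_all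

lemma representable_closed:
  assumes A: "locally_small elts A" and v: "v \<in> Obj A"
  shows "representable elts A v \<in> Obj (presheaf_cat elts A)"
  unfolding representable_eq_mk_psh
proof (rule mk_psh_closed)
  interpret category A by (rule locally_small_category[OF A])
  show "category A" by (rule locally_small_category[OF A])
  note dec = hom_dec_closed[OF A _ v] and enc = hom_enc_closed[OF A]
  show "hom_enc elts A (Dom A f) v (hom_dec elts A (Cod A f) v a \<cdot>\<^bsub>A\<^esub> f) \<in> elts (hom_obj elts A x v)"
    if "f \<in> Hom A x y" "a \<in> elts (hom_obj elts A y v)" for f x y a
    using enc[OF comp_closed[OF that(1) dec[OF Hom_objD(2)[OF that(1)] that(2)]]] HomD[OF that(1)] by simp
  show "hom_enc elts A (Dom A (Ident A x)) v (hom_dec elts A (Cod A (Ident A x)) v a \<cdot>\<^bsub>A\<^esub> Ident A x) = a"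
    if "x \<in> Obj A" "a \<in> elts (hom_obj elts A x v)" for x a
    using HomD[OF ident_closed[OF that(1)]] ident_right[OF dec[OF that]] hom_enc_dec[OF A that(1) v that(2)]
    by simp
  show "hom_enc elts A (Dom A (g \<cdot>\<^bsub>A\<^esub> f)) v (hom_dec elts A (Cod A (g \<cdot>\<^bsub>A\<^esub> f)) v a \<cdot>\<^bsub>A\<^esub> (g \<cdot>\<^bsub>A\<^esub> f)) =
      hom_enc elts A (Dom A f) v (hom_dec elts A (Cod A f) v
        (hom_enc elts A (Dom A g) v (hom_dec elts A (Cod A g) v a \<cdot>\<^bsub>A\<^esub> g)) \<cdot>\<^bsub>A\<^esub> f)"
    if f: "f \<in> Hom A x y" and g: "g \<in> Hom A y z" and a: "a \<in> elts (hom_obj elts A z v)" for f g x y z a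
  proof -
    note da = dec[OF Hom_objD(2)[OF g] a]
    show ?thesis
      using HomD[OF f] HomD[OF g] HomD[OF comp_closed[OF f g]]
        hom_dec_enc[OF A comp_closed[OF g da]] comp_assoc[OF f g da]
      by simp
  qed
qed

lemma fobj_yoneda [simp]: "fobj (yoneda elts A) = representable elts A"
  by (simp add: yoneda_def)

lemma farr_yoneda:
  assumes "g \<in> Hom A v w"
  shows "farr (yoneda elts A) g = mk_arr elts A (representable elts A v) (representable elts A w)
    (\<lambda>x p. hom_enc elts A x w (g \<cdot>\<^bsub>A\<^esub> hom_dec elts A x v p))"
  using HomD[OF assms] by (simp add: yoneda_def mk_arr_def Let_def cong: restrict_cong)

lemma ev_yoneda:
  assumes "g \<in> Hom A v w" "x \<in> Obj A" "p \<in> elts (hom_obj elts A x v)"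
  shows "ev (farr (yoneda elts A) g) x p = hom_enc elts A x w (g \<cdot>\<^bsub>A\<^esub> hom_dec elts A x v p)"
  using assms by (simp add: farr_yoneda)

lemma farr_yoneda_closed:
  assumes A: "locally_small elts A" and g: "g \<in> Hom A v w"
  shows "farr (yoneda elts A) g \<in> Hom (presheaf_cat elts A) (representable elts A v) (representable elts A w)"
  unfolding farr_yoneda[OF g]
proof (rule mk_arr_closed)
  interpret category A by (rule locally_small_category[OF A])
  note vw = Hom_objD[OF g]
  note dec = hom_dec_closed[OF A _ vw(1)] and enc = hom_enc_closed[OF A]
  show "category A" by (rule locally_small_category[OF A])
  show "representable elts A v \<in> Obj (presheaf_cat elts A)"
    "representable elts A w \<in> Obj (presheaf_cat elts A)"
    using representable_closed[OF A] vw by blast+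
  show "hom_enc elts A x w (g \<cdot>\<^bsub>A\<^esub> hom_dec elts A x v a) \<in> elts (fobj (representable elts A w) x)"
    if "x \<in> Obj A" "a \<in> elts (fobj (representable elts A v) x)" for x a
    using enc[OF comp_closed[OF dec g]] that by simp
  show "hom_enc elts A x w (g \<cdot>\<^bsub>A\<^esub> hom_dec elts A x v (app (farr (representable elts A v) f) a)) =
      app (farr (representable elts A w) f) (hom_enc elts A y w (g \<cdot>\<^bsub>A\<^esub> hom_dec elts A y v a))"
    if f: "f \<in> Hom A x y" and a: "a \<in> elts (fobj (representable elts A v) y)" for f x y a
  proof -
    note xy = Hom_objD[OF f]
    have a': "a \<in> elts (hom_obj elts A y v)" using a xy by simp
    note da = dec[OF xy(2) a']
    show ?thesis
      using app_representable[where elts = elts, OF f a'] hom_dec_enc[OF A comp_closed[OF f da]]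
        app_representable[where elts = elts, OF f enc[OF comp_closed[OF da g]]]
        hom_dec_enc[OF A comp_closed[OF da g]] comp_assoc[OF f da g]
      by simp
  qed
qed

lemma cat_functor_yoneda:
  assumes A: "locally_small elts A"
  shows "cat_functor A (presheaf_cat elts A) (yoneda elts A)"
proof -
  interpret category A by (rule locally_small_category[OF A])
  interpret P: category "presheaf_cat elts A" by (rule category_presheaf_cat[OF category_axioms])
  note Y = farr_yoneda_closed[OF A]
  show ?thesis
  proof (unfold_locales, unfold fobj_yoneda)
    show "representable elts A x \<in> Obj (presheaf_cat elts A)" if "x \<in> Obj A" for x
      by (rule representable_closed[OF A that])
    show "farr (yoneda elts A) f \<in> Hom (presheaf_cat elts A) (representable elts A x) (representable elts A y)"
      if "f \<in> Hom A x y" for f x y by (rule Y[OF that])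
    show "farr (yoneda elts A) (Ident A x) = Ident (presheaf_cat elts A) (representable elts A x)"
      if x: "x \<in> Obj A" for x
    proof (rule psh_arr_eqI[OF Y[OF ident_closed[OF x]] P.ident_closed[OF representable_closed[OF A x]]])
      fix y a assume y: "y \<in> Obj A" and "a \<in> elts (fobj (representable elts A x) y)"
      then have a: "a \<in> elts (hom_obj elts A y x)" by simp
      show "ev (farr (yoneda elts A) (Ident A x)) y a = ev (Ident (presheaf_cat elts A) (representable elts A x)) y a"
        using ev_yoneda[where elts = elts, OF ident_closed[OF x] y a] ident_left[OF hom_dec_closed[OF A y x a]]
          hom_enc_dec[OF A y x a] y a by (simp add: ev_ident)
    qed
    show "farr (yoneda elts A) (g \<cdot>\<^bsub>A\<^esub> f) = farr (yoneda elts A) g \<cdot>\<^bsub>presheaf_cat elts A\<^esub> farr (yoneda elts A) f"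
      if f: "f \<in> Hom A x y" and g: "g \<in> Hom A y z" for x y z f g
    proof (rule psh_arr_eqI[OF Y[OF comp_closed[OF f g]] P.comp_closed[OF Y[OF f] Y[OF g]]])
      fix w a assume w: "w \<in> Obj A" and a': "a \<in> elts (fobj (representable elts A x) w)"
      then have a: "a \<in> elts (hom_obj elts A w x)" by simp
      note da = hom_dec_closed[OF A w Hom_objD(1)[OF f] a]
      show "ev (farr (yoneda elts A) (g \<cdot>\<^bsub>A\<^esub> f)) w a =
        ev (farr (yoneda elts A) g \<cdot>\<^bsub>presheaf_cat elts A\<^esub> farr (yoneda elts A) f) w a"
        using ev_comp[OF Y[OF f] Y[OF g] w a'] ev_yoneda[where elts = elts, OF comp_closed[OF f g] w a]
          ev_yoneda[where elts = elts, OF f w a] ev_yoneda[where elts = elts, OF g w hom_enc_closed[OF A comp_closed[OF da f]]]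
          hom_dec_enc[OF A comp_closed[OF da f]] comp_assoc[OF da f g]
        by simp
    qed
  qed
qed

text \<open>The arrow \<open>yx \<rightarrow> X\<close> which the Yoneda lemma assigns to an element of \<open>X x\<close>.\<close>

definition yoneda_elem ::
  "('u \<Rightarrow> 'u set) \<Rightarrow> ('o, 'a) cat \<Rightarrow> ('o, 'a, 'u) psh \<Rightarrow> 'o \<Rightarrow> 'u \<Rightarrow> ('o, 'a, 'u) psh_arr" where
  "yoneda_elem elts A X x p =
     mk_arr elts A (representable elts A x) X (\<lambda>y q. app (farr X (hom_dec elts A y x q)) p)"

lemma ev_yoneda_elem:
  "y \<in> Obj A \<Longrightarrow> q \<in> elts (hom_obj elts A y x) \<Longrightarrow>
    ev (yoneda_elem elts A X x p) y q = app (farr X (hom_dec elts A y x q)) p"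
  by (simp add: yoneda_elem_def)

lemma yoneda_elem_closed:
  assumes A: "locally_small elts A" and X: "X \<in> Obj (presheaf_cat elts A)" and x: "x \<in> Obj A"
    and p: "p \<in> elts (fobj X x)"
  shows "yoneda_elem elts A X x p \<in> Hom (presheaf_cat elts A) (representable elts A x) X"
  unfolding yoneda_elem_def
proof (rule mk_arr_closed[OF locally_small_category[OF A] representable_closed[OF A x] X])
  interpret category A by (rule locally_small_category[OF A])
  show "app (farr X (hom_dec elts A y x q)) p \<in> elts (fobj X y)"
    if "y \<in> Obj A" "q \<in> elts (fobj (representable elts A x) y)" for y q
    using psh_app_closed[OF X hom_dec_closed[OF A that(1) x] p] that by simp
  show "app (farr X (hom_dec elts A y x (app (farr (representable elts A x) f) q))) p =
      app (farr X f) (app (farr X (hom_dec elts A z x q)) p)"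
    if f: "f \<in> Hom A y z" and q: "q \<in> elts (fobj (representable elts A x) z)" for f y z q
  proof -
    have q': "q \<in> elts (hom_obj elts A z x)" using q Hom_objD[OF f] by simp
    note dq = hom_dec_closed[OF A Hom_objD(2)[OF f] x q']
    show ?thesis
      using app_representable[where elts = elts, OF f q'] hom_dec_enc[OF A comp_closed[OF f dq]] psh_app_comp[OF X f dq p]
      by simp
  qed
qed

text \<open>The two sides agree at \<open>q\<close> because \<open>m\<close> commutes with the
  action of the arrow that \<open>q\<close> codes. This is the naturality of the Yoneda bijection in
  the presheaf.\<close>

lemma comp_yoneda_elem:
  assumes A: "locally_small elts A" and m: "m \<in> Hom (presheaf_cat elts A) X Z" and x: "x \<in> Obj A"
    and p: "p \<in> elts (fobj X x)"
  shows "m \<cdot>\<^bsub>presheaf_cat elts A\<^esub> yoneda_elem elts A X x p = yoneda_elem elts A Z x (ev m x p)"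
proof -
  interpret P: category "presheaf_cat elts A" by (rule category_presheaf_cat[OF locally_small_category[OF A]])
  note X = P.Hom_objD(1)[OF m] and Z = P.Hom_objD(2)[OF m]
  note px = yoneda_elem_closed[OF A X x p] and pz = yoneda_elem_closed[OF A Z x ev_closed[OF m x p]]
  show ?thesis
  proof (rule psh_arr_eqI[OF P.comp_closed[OF px m] pz])
    fix y q assume y: "y \<in> Obj A" and q: "q \<in> elts (fobj (representable elts A x) y)"
    then have q': "q \<in> elts (hom_obj elts A y x)" by simp
    show "ev (m \<cdot>\<^bsub>presheaf_cat elts A\<^esub> yoneda_elem elts A X x p) y q = ev (yoneda_elem elts A Z x (ev m x p)) y q"
      using ev_comp[OF px m y q] ev_yoneda_elem[where elts = elts, OF y q', of X p] ev_yoneda_elem[where elts = elts, OF y q', of Z "ev m x p"]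
        ev_natural[OF m hom_dec_closed[OF A y x q'] p] by simp
  qed
qed

text \<open>Both sides send \<open>q\<close> to the action on \<open>p\<close> of \<open>f\<close>
  after the arrow coded by \<open>q\<close>. This is the cocone condition in
  \<open>density\<close>.\<close>

lemma yoneda_elem_app:
  assumes A: "locally_small elts A" and X: "X \<in> Obj (presheaf_cat elts A)" and f: "f \<in> Hom A x y"
    and p: "p \<in> elts (fobj X y)"
  shows "yoneda_elem elts A X x (app (farr X f) p) =
    yoneda_elem elts A X y p \<cdot>\<^bsub>presheaf_cat elts A\<^esub> farr (yoneda elts A) f"
proof -
  interpret category A by (rule locally_small_category[OF A])
  interpret P: category "presheaf_cat elts A" by (rule category_presheaf_cat[OF locally_small_category[OF A]])
  note x = Hom_objD(1)[OF f] and y = Hom_objD(2)[OF f]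
  note px = yoneda_elem_closed[OF A X x psh_app_closed[OF X f p]] and py = yoneda_elem_closed[OF A X y p]
  note Yf = farr_yoneda_closed[OF A f]
  show ?thesis
  proof (rule psh_arr_eqI[OF px P.comp_closed[OF Yf py]])
    fix z q assume z: "z \<in> Obj A" and q: "q \<in> elts (fobj (representable elts A x) z)"
    then have q': "q \<in> elts (hom_obj elts A z x)" by simp
    note dq = hom_dec_closed[OF A z x q']
    note fq = comp_closed[OF dq f]
    show "ev (yoneda_elem elts A X x (app (farr X f) p)) z q =
        ev (yoneda_elem elts A X y p \<cdot>\<^bsub>presheaf_cat elts A\<^esub> farr (yoneda elts A) f) z q"
      using ev_comp[OF Yf py z q] ev_yoneda[where elts = elts, OF f z q'] ev_yoneda_elem[where elts = elts, OF z q', of X]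
        ev_yoneda_elem[where elts = elts, OF z hom_enc_closed[OF A fq], of X p] hom_dec_enc[OF A fq]
        psh_app_comp[OF X dq f p] by simp
  qed
qed

lemma ev_yoneda_elem_ident:
  assumes A: "locally_small elts A" and X: "X \<in> Obj (presheaf_cat elts A)" and x: "x \<in> Obj A"
    and p: "p \<in> elts (fobj X x)"
  shows "ev (yoneda_elem elts A X x p) x (hom_enc elts A x x (Ident A x)) = p"
proof -
  interpret category A by (rule locally_small_category[OF A])
  note i = ident_closed[OF x]
  show ?thesis
    using ev_yoneda_elem[where elts = elts, OF x hom_enc_closed[OF A i], of X p] hom_dec_enc[OF A i] psh_app_ident[OF X x p]
    by simp
qed

text \<open>The co-Yoneda lemma. By Yoneda a leg \<open>\<theta> x p\<close> is an element of
  \<open>Z x\<close>, so a cocone amounts to functions \<open>X x \<rightarrow> Z x\<close>, and its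
  compatibility is the naturality of these functions.\<close>

lemma density:
  assumes A: "locally_small elts A" and X: "X \<in> Obj (presheaf_cat elts A)"
  shows "weighted_colimit elts A (presheaf_cat elts A) X (yoneda elts A) X (yoneda_elem elts A X)"
proof -
  interpret category A by (rule locally_small_category[OF A])
  interpret P: category "presheaf_cat elts A" by (rule category_presheaf_cat[OF locally_small_category[OF A]])
  have cocone: "weighted_cocone elts A (presheaf_cat elts A) X (yoneda elts A) X (yoneda_elem elts A X)"
    by (rule weighted_coconeI[OF X])
      (simp_all add: yoneda_elem_closed[OF A X] yoneda_elem_app[OF A X])
  have "\<exists>!h. h \<in> Hom (presheaf_cat elts A) X Z \<and>
      (\<forall>x\<in>Obj A. \<forall>p\<in>elts (fobj X x). h \<cdot>\<^bsub>presheaf_cat elts A\<^esub> yoneda_elem elts A X x p = \<theta> x p)"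
    if co: "weighted_cocone elts A (presheaf_cat elts A) X (yoneda elts A) Z \<theta>" for Z \<theta>
  proof
    note \<theta> = weighted_coconeD[OF co, unfolded fobj_yoneda]
    \<comment> \<open>The element of \<open>Z x\<close> that corresponds to the leg
      \<open>\<theta> x p\<close>: its value at the identity.\<close>
    define t where "t x p = ev (\<theta> x p) x (hom_enc elts A x x (Ident A x))" for x p
    define h where "h = mk_arr elts A X Z t"
    have enc_id: "hom_enc elts A x x (Ident A x) \<in> elts (fobj (representable elts A x) x)" if "x \<in> Obj A" for x
      using that hom_enc_closed[OF A ident_closed[OF that]] by simp
    have t_app: "t y (app (farr X f) p) = ev (\<theta> x p) y (hom_enc elts A y x f)"
      if f: "f \<in> Hom A y x" and p: "p \<in> elts (fobj X x)" for f x y p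
    proof -
      note y = Hom_objD(1)[OF f] and x = Hom_objD(2)[OF f]
      show ?thesis unfolding t_def
        using \<theta>(3)[OF f p] ev_comp[OF farr_yoneda_closed[OF A f] \<theta>(2)[OF x p] y enc_id[OF y]]
          ev_yoneda[where elts = elts, OF f y hom_enc_closed[OF A ident_closed[OF y]]]
          hom_dec_enc[OF A ident_closed[OF y]] ident_right[OF f] by simp
    qed
    have h: "h \<in> Hom (presheaf_cat elts A) X Z"
      unfolding h_def
    proof (rule mk_arr_closed[OF category_axioms X \<theta>(1)])
      show "t x p \<in> elts (fobj Z x)" if "x \<in> Obj A" "p \<in> elts (fobj X x)" for x p
        unfolding t_def by (rule ev_closed[OF \<theta>(2)[OF that] that(1) enc_id[OF that(1)]])
      show "t y (app (farr X f) p) = app (farr Z f) (t x p)"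
        if f: "f \<in> Hom A y x" and p: "p \<in> elts (fobj X x)" for f x y p
      proof -
        note x = Hom_objD(2)[OF f]
        show ?thesis unfolding t_app[OF f p]
          unfolding t_def ev_natural[OF \<theta>(2)[OF x p] f enc_id[OF x], symmetric]
          using app_representable[where elts = elts, OF f hom_enc_closed[OF A ident_closed[OF x]]]
            hom_dec_enc[OF A ident_closed[OF x]] ident_left[OF f] by simp
      qed
    qed
    have "h \<cdot>\<^bsub>presheaf_cat elts A\<^esub> yoneda_elem elts A X x p = \<theta> x p" if x: "x \<in> Obj A" and p: "p \<in> elts (fobj X x)" for x p
    proof (rule psh_arr_eqI[OF P.comp_closed[OF yoneda_elem_closed[OF A X x p] h] \<theta>(2)[OF x p]])
      fix y q assume y: "y \<in> Obj A" and q: "q \<in> elts (fobj (representable elts A x) y)"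
      then have q': "q \<in> elts (hom_obj elts A y x)" by simp
      note dq = hom_dec_closed[OF A y x q']
      show "ev (h \<cdot>\<^bsub>presheaf_cat elts A\<^esub> yoneda_elem elts A X x p) y q = ev (\<theta> x p) y q"
        using ev_comp[OF yoneda_elem_closed[OF A X x p] h y q] ev_yoneda_elem[where elts = elts, OF y q', of X p]
          t_app[OF dq p] hom_enc_dec[OF A y x q'] y psh_app_closed[OF X dq p] by (simp add: h_def)
    qed
    then show "h \<in> Hom (presheaf_cat elts A) X Z \<and>
      (\<forall>x\<in>Obj A. \<forall>p\<in>elts (fobj X x). h \<cdot>\<^bsub>presheaf_cat elts A\<^esub> yoneda_elem elts A X x p = \<theta> x p)"
      using h by blast
    fix g assume g: "g \<in> Hom (presheaf_cat elts A) X Z \<and>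
      (\<forall>x\<in>Obj A. \<forall>p\<in>elts (fobj X x). g \<cdot>\<^bsub>presheaf_cat elts A\<^esub> yoneda_elem elts A X x p = \<theta> x p)"
    then have g1: "g \<in> Hom (presheaf_cat elts A) X Z" by blast
    show "g = h"
    proof (rule psh_arr_eqI[OF g1 h])
      fix x p assume x: "x \<in> Obj A" and p: "p \<in> elts (fobj X x)"
      \<comment> \<open>\<open>g\<close> is determined: \<open>ev g x p\<close> must be the element
        that corresponds to the leg \<open>\<theta> x p\<close>.\<close>
      have "yoneda_elem elts A Z x (ev g x p) = \<theta> x p"
        using comp_yoneda_elem[OF A g1 x p] g x p by simp
      then show "ev g x p = ev h x p"
        using ev_yoneda_elem_ident[OF A P.Hom_objD(2)[OF g1] x ev_closed[OF g1 x p]] x p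
        by (simp add: h_def t_def)
    qed
  qed
  then show ?thesis using cocone by (simp add: weighted_colimit_def)
qed

text \<open>Cocones under the identity functor weighted by \<open>F\<close> are arrows from \<open>F\<close> to a representable.\<close>

definition arr_of_cocone ::
  "('u \<Rightarrow> 'u set) \<Rightarrow> ('o, 'a) cat \<Rightarrow> ('o, 'a, 'u) psh \<Rightarrow> 'o \<Rightarrow> ('o \<Rightarrow> 'u \<Rightarrow> 'a) \<Rightarrow> ('o, 'a, 'u) psh_arr" where
  "arr_of_cocone elts A F v i = mk_arr elts A F (representable elts A v) (\<lambda>x a. hom_enc elts A x v (i x a))"

definition cocone_of_arr ::
  "('u \<Rightarrow> 'u set) \<Rightarrow> ('o, 'a) cat \<Rightarrow> 'o \<Rightarrow> ('o, 'a, 'u) psh_arr \<Rightarrow> 'o \<Rightarrow> 'u \<Rightarrow> 'a" where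
  "cocone_of_arr elts A v m x a = hom_dec elts A x v (ev m x a)"

lemma arr_of_cocone_closed:
  assumes A: "locally_small elts A" and F: "F \<in> Obj (presheaf_cat elts A)"
    and i: "weighted_cocone elts A A F id_func v i"
  shows "arr_of_cocone elts A F v i \<in> Hom (presheaf_cat elts A) F (representable elts A v)"
proof -
  interpret category A by (rule locally_small_category[OF A])
  note i = weighted_coconeD[OF i, unfolded id_func_def, simplified]
  show ?thesis unfolding arr_of_cocone_def
  proof (rule mk_arr_closed[OF category_axioms F representable_closed[OF A i(1)]])
    show "hom_enc elts A x v (i x a) \<in> elts (fobj (representable elts A v) x)"
      if "x \<in> Obj A" "a \<in> elts (fobj F x)" for x a
      using hom_enc_closed[OF A i(2)[OF that]] that(1) by simp
    show "hom_enc elts A x v (i x (app (farr F f) a)) = app (farr (representable elts A v) f) (hom_enc elts A y v (i y a))"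
      if f: "f \<in> Hom A x y" and a: "a \<in> elts (fobj F y)" for x y f a
    proof -
      note iy = i(2)[OF Hom_objD(2)[OF f] a]
      show ?thesis using app_representable[where elts = elts, OF f hom_enc_closed[OF A iy]] hom_dec_enc[OF A iy] i(3)[OF f a] by simp
    qed
  qed
qed

lemma cocone_of_arr_closed:
  assumes A: "locally_small elts A" and v: "v \<in> Obj A"
    and m: "m \<in> Hom (presheaf_cat elts A) F (representable elts A v)"
  shows "weighted_cocone elts A A F id_func v (cocone_of_arr elts A v m)"
proof (rule weighted_coconeI[OF v])
  interpret category A by (rule locally_small_category[OF A])
  have evm: "ev m x a \<in> elts (hom_obj elts A x v)" if "x \<in> Obj A" "a \<in> elts (fobj F x)" for x a
    using ev_closed[OF m that] that(1) by simp
  show "cocone_of_arr elts A v m x a \<in> Hom A (fobj id_func x) v" if "x \<in> Obj A" "a \<in> elts (fobj F x)" for x a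
    using hom_dec_closed[OF A that(1) v evm[OF that]] by (simp add: cocone_of_arr_def id_func_def)
  show "cocone_of_arr elts A v m x (app (farr F f) a) = cocone_of_arr elts A v m y a \<cdot>\<^bsub>A\<^esub> farr id_func f"
    if f: "f \<in> Hom A x y" and a: "a \<in> elts (fobj F y)" for x y f a
  proof -
    note y = Hom_objD(2)[OF f]
    show ?thesis
      using ev_natural[OF m f a] app_representable[where elts = elts, OF f evm[OF y a]]
        hom_dec_enc[OF A comp_closed[OF f hom_dec_closed[OF A y v evm[OF y a]]]]
      by (simp add: cocone_of_arr_def id_func_def)
  qed
qed

lemma cocone_of_arr_of_cocone:
  assumes A: "locally_small elts A" and i: "weighted_cocone elts A A F id_func v i"
    and "x \<in> Obj A" "a \<in> elts (fobj F x)"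
  shows "cocone_of_arr elts A v (arr_of_cocone elts A F v i) x a = i x a"
  using weighted_coconeD(2)[OF i assms(3,4)] assms(3,4) hom_dec_enc[OF A]
  by (simp add: cocone_of_arr_def arr_of_cocone_def id_func_def)

lemma cocone_of_arr_inject:
  assumes A: "locally_small elts A" and v: "v \<in> Obj A"
    and m: "m \<in> Hom (presheaf_cat elts A) F (representable elts A v)"
      "m' \<in> Hom (presheaf_cat elts A) F (representable elts A v)"
    and eq: "\<And>x a. x \<in> Obj A \<Longrightarrow> a \<in> elts (fobj F x) \<Longrightarrow> cocone_of_arr elts A v m x a = cocone_of_arr elts A v m' x a"
  shows "m = m'"
proof (rule psh_arr_eqI[OF m])
  fix x a assume x: "x \<in> Obj A" and a: "a \<in> elts (fobj F x)"
  have e: "ev m x a \<in> elts (hom_obj elts A x v)" "ev m' x a \<in> elts (hom_obj elts A x v)"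
    using ev_closed[OF m(1) x a] ev_closed[OF m(2) x a] x by simp_all
  show "ev m x a = ev m' x a"
    using eq[OF x a, unfolded cocone_of_arr_def] hom_enc_dec[OF A x v e(1)] hom_enc_dec[OF A x v e(2)]
    by metis
qed

lemma cocone_of_arr_comp:
  assumes A: "locally_small elts A" and g: "g \<in> Hom A v w"
    and m: "m \<in> Hom (presheaf_cat elts A) F (representable elts A v)"
    and x: "x \<in> Obj A" and a: "a \<in> elts (fobj F x)"
  shows "cocone_of_arr elts A w (farr (yoneda elts A) g \<cdot>\<^bsub>presheaf_cat elts A\<^esub> m) x a =
    g \<cdot>\<^bsub>A\<^esub> cocone_of_arr elts A v m x a"
proof -
  interpret category A by (rule locally_small_category[OF A])
  have e: "ev m x a \<in> elts (hom_obj elts A x v)" using ev_closed[OF m x a] x by simp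
  show ?thesis
    using ev_comp[OF m farr_yoneda_closed[OF A g] x a] ev_yoneda[where elts = elts, OF g x e]
      hom_dec_enc[OF A comp_closed[OF hom_dec_closed[OF A x Hom_objD(1)[OF g] e] g]]
    by (simp add: cocone_of_arr_def)
qed

text \<open>Arrows from \<open>F\<close> to the representable of \<open>v\<close> and cocones with
  vertex \<open>v\<close> correspond, compatibly with composition by arrows
  \<open>v \<rightarrow> w\<close>, so the two universal properties are one. The colimit form is the
  one that left adjoints visibly preserve.\<close>

lemma weighted_colimit_of_universal_arrow:
  assumes A: "locally_small elts A"
    and u: "universal_arrow (presheaf_cat elts A) A (yoneda elts A) F l \<eta>"
  shows "weighted_colimit elts A A F id_func l (cocone_of_arr elts A l \<eta>)"
proof -
  interpret P: category "presheaf_cat elts A" by (rule category_presheaf_cat[OF locally_small_category[OF A]])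
  have l: "l \<in> Obj A" and \<eta>: "\<eta> \<in> Hom (presheaf_cat elts A) F (representable elts A l)"
    using u by (simp_all add: universal_arrow_def)
  note F = P.Hom_objD(1)[OF \<eta>]
  have "\<exists>!h. h \<in> Hom A l v \<and> (\<forall>x\<in>Obj A. \<forall>a\<in>elts (fobj F x). h \<cdot>\<^bsub>A\<^esub> cocone_of_arr elts A l \<eta> x a = i x a)"
    if co: "weighted_cocone elts A A F id_func v i" for v i
  proof -
    note v = weighted_coconeD(1)[OF co]
    note m = arr_of_cocone_closed[OF A F co]
    have "h \<in> Hom A l v \<and> (\<forall>x\<in>Obj A. \<forall>a\<in>elts (fobj F x). h \<cdot>\<^bsub>A\<^esub> cocone_of_arr elts A l \<eta> x a = i x a)
      \<longleftrightarrow> h \<in> Hom A l v \<and> farr (yoneda elts A) h \<cdot>\<^bsub>presheaf_cat elts A\<^esub> \<eta> = arr_of_cocone elts A F v i" for h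
    proof (intro conj_cong refl iffI ballI)
      assume h: "h \<in> Hom A l v"
        and eq: "\<forall>x\<in>Obj A. \<forall>a\<in>elts (fobj F x). h \<cdot>\<^bsub>A\<^esub> cocone_of_arr elts A l \<eta> x a = i x a"
      show "farr (yoneda elts A) h \<cdot>\<^bsub>presheaf_cat elts A\<^esub> \<eta> = arr_of_cocone elts A F v i"
      proof (rule cocone_of_arr_inject[OF A v P.comp_closed[OF \<eta> farr_yoneda_closed[OF A h]] m])
        fix x a assume "x \<in> Obj A" "a \<in> elts (fobj F x)"
        then show "cocone_of_arr elts A v (farr (yoneda elts A) h \<cdot>\<^bsub>presheaf_cat elts A\<^esub> \<eta>) x a =
          cocone_of_arr elts A v (arr_of_cocone elts A F v i) x a"
          using cocone_of_arr_comp[OF A h \<eta>] cocone_of_arr_of_cocone[OF A co] eq by simp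
      qed
    next
      fix x a assume h: "h \<in> Hom A l v" and xa: "x \<in> Obj A" "a \<in> elts (fobj F x)"
        and eq: "farr (yoneda elts A) h \<cdot>\<^bsub>presheaf_cat elts A\<^esub> \<eta> = arr_of_cocone elts A F v i"
      show "h \<cdot>\<^bsub>A\<^esub> cocone_of_arr elts A l \<eta> x a = i x a"
        using cocone_of_arr_comp[OF A h \<eta> xa] cocone_of_arr_of_cocone[OF A co xa] eq by simp
    qed
    moreover have "\<exists>!h. h \<in> Hom A l v \<and>
        farr (yoneda elts A) h \<cdot>\<^bsub>presheaf_cat elts A\<^esub> \<eta> = arr_of_cocone elts A F v i"
      using u v m by (simp add: universal_arrow_def)
    ultimately show ?thesis by presburger
  qed
  then show ?thesis using cocone_of_arr_closed[OF A l \<eta>] by (simp add: weighted_colimit_def)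
qed

section \<open>Splitting idempotents and Kan extension of presheaves\<close>

text \<open>Values of a presheaf are codes in \<open>'u\<close>, while the constructions below yield
  sets that are not given by codes, such as sets of fixed points or of equivalence classes. The
  action is transported along chosen bijections \<open>e x\<close> with coded sets.\<close>

lemma ex_presheaf_of_small_sets:
  assumes A: "category A"
    and small: "\<And>x. x \<in> Obj A \<Longrightarrow> small elts (S x)"
    and closed: "\<And>f x y s. f \<in> Hom A x y \<Longrightarrow> s \<in> S y \<Longrightarrow> ac f s \<in> S x"
    and ident: "\<And>x s. x \<in> Obj A \<Longrightarrow> s \<in> S x \<Longrightarrow> ac (Ident A x) s = s"
    and comp: "\<And>f g x y z s. f \<in> Hom A x y \<Longrightarrow> g \<in> Hom A y z \<Longrightarrow> s \<in> S z \<Longrightarrow>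
      ac (g \<cdot>\<^bsub>A\<^esub> f) s = ac f (ac g s)"
  obtains F e where "F \<in> Obj (presheaf_cat elts A)"
    and "\<And>x. x \<in> Obj A \<Longrightarrow> bij_betw (e x) (S x) (elts (fobj F x))"
    and "\<And>f x y s. f \<in> Hom A x y \<Longrightarrow> s \<in> S y \<Longrightarrow> app (farr F f) (e y s) = e x (ac f s)"
proof -
  interpret A: category A by fact
  have "\<forall>x\<in>Obj A. \<exists>u f. bij_betw f (S x) (elts u)" using small by (simp add: small_def)
  then obtain ob e where e: "\<And>x. x \<in> Obj A \<Longrightarrow> bij_betw (e x) (S x) (elts (ob x))" by metis
  define d where "d x = inv_into (S x) (e x)" for x
  have e_closed: "e x s \<in> elts (ob x)" if "x \<in> Obj A" "s \<in> S x" for x s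
    by (rule bij_betw_apply[OF e[OF that(1)] that(2)])
  have d_closed: "d x a \<in> S x" if "x \<in> Obj A" "a \<in> elts (ob x)" for x a
    using bij_betw_apply[OF bij_betw_inv_into[OF e[OF that(1)]] that(2)] by (simp add: d_def)
  have de: "d x (e x s) = s" if "x \<in> Obj A" "s \<in> S x" for x s
    using bij_betw_inv_into_left[OF e[OF that(1)] that(2)] by (simp add: d_def)
  have ed: "e x (d x a) = a" if "x \<in> Obj A" "a \<in> elts (ob x)" for x a
    using bij_betw_inv_into_right[OF e[OF that(1)] that(2)] by (simp add: d_def)
  define F where "F = mk_psh elts A ob (\<lambda>f a. e (Dom A f) (ac f (d (Cod A f) a)))"
  show thesis
  proof
    show "F \<in> Obj (presheaf_cat elts A)"
      unfolding F_def
    proof (rule mk_psh_closed[OF A])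
      show "e (Dom A f) (ac f (d (Cod A f) a)) \<in> elts (ob x)"
        if "f \<in> Hom A x y" "a \<in> elts (ob y)" for f x y a
        using that e_closed closed d_closed HomD[OF that(1)] A.Hom_objD[OF that(1)] by simp
      show "e (Dom A (Ident A x)) (ac (Ident A x) (d (Cod A (Ident A x)) a)) = a"
        if "x \<in> Obj A" "a \<in> elts (ob x)" for x a
        using that HomD[OF A.ident_closed[OF that(1)]] ident d_closed ed by simp
      show "e (Dom A (g \<cdot>\<^bsub>A\<^esub> f)) (ac (g \<cdot>\<^bsub>A\<^esub> f) (d (Cod A (g \<cdot>\<^bsub>A\<^esub> f)) a)) =
         e (Dom A f) (ac f (d (Cod A f) (e (Dom A g) (ac g (d (Cod A g) a)))))"
        if f: "f \<in> Hom A x y" and g: "g \<in> Hom A y z" and a: "a \<in> elts (ob z)" for f g x y z a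
      proof -
        note z = A.Hom_objD[OF g]
        note da = d_closed[OF z(2) a]
        show ?thesis
          using HomD[OF f] HomD[OF g] HomD[OF A.comp_closed[OF f g]] comp[OF f g da]
            de[OF z(1) closed[OF g da]] by simp
      qed
    qed
    show "bij_betw (e x) (S x) (elts (fobj F x))" if "x \<in> Obj A" for x
      using e[OF that] that by (simp add: F_def)
    show "app (farr F f) (e y s) = e x (ac f s)" if f: "f \<in> Hom A x y" and s: "s \<in> S y" for f x y s
      using app_mk_psh[where elts = elts and ob = ob, OF f e_closed[OF A.Hom_objD(2)[OF f] s]] HomD[OF f] de[OF A.Hom_objD(2)[OF f] s]
      by (simp add: F_def)
  qed
qed

context grothendieck_universe
begin

text \<open>The splitting is pointwise: by naturality the fixed points of \<open>e\<close> are
  closed under the action, so they form a subpresheaf; \<open>e\<close> maps onto it and its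
  inclusion is the section.\<close>

lemma idempotents_split_presheaf_cat:
  assumes A: "category A"
  shows "idempotents_split (presheaf_cat elts A)"
  unfolding idempotents_split_def
proof (intro allI ballI impI)
  interpret A: category A by fact
  interpret P: category "presheaf_cat elts A" by (rule category_presheaf_cat[OF A])
  fix X e assume e: "e \<in> Hom (presheaf_cat elts A) X X" and ee: "e \<cdot>\<^bsub>presheaf_cat elts A\<^esub> e = e"
  note X = P.Hom_objD(1)[OF e]
  have eee: "ev e x (ev e x a) = ev e x a" if "x \<in> Obj A" "a \<in> elts (fobj X x)" for x a
    using ev_comp[OF e e that] ee by simp
  define S where "S x = {a \<in> elts (fobj X x). ev e x a = a}" for x
  have SX: "a \<in> elts (fobj X x)" if "a \<in> S x" for x a using that by (simp add: S_def)
  have Se: "ev e x a = a" if "a \<in> S x" for x a using that by (simp add: S_def)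
  have eS: "ev e x a \<in> S x" if "x \<in> Obj A" "a \<in> elts (fobj X x)" for x a
    using eee[OF that] ev_closed[OF e that] by (simp add: S_def)
  have appS: "app (farr X f) s \<in> S x" if f: "f \<in> Hom A x y" and s: "s \<in> S y" for f x y s
    using psh_app_closed[OF X f SX[OF s]] ev_natural[OF e f SX[OF s]] Se[OF s] by (simp add: S_def)
  obtain L i where L: "L \<in> Obj (presheaf_cat elts A)"
    and i: "\<And>x. x \<in> Obj A \<Longrightarrow> bij_betw (i x) (S x) (elts (fobj L x))"
    and Li: "\<And>f x y s. f \<in> Hom A x y \<Longrightarrow> s \<in> S y \<Longrightarrow> app (farr L f) (i y s) = i x (app (farr X f) s)"
  proof (rule ex_presheaf_of_small_sets[OF A, where elts = elts and S = S and ac = "\<lambda>f. app (farr X f)"])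
    show "small elts (S x)" if "x \<in> Obj A" for x
      by (rule small_subset[OF small_elts[of "fobj X x"]]) (auto simp: S_def)
    show "app (farr X f) s \<in> S x" if "f \<in> Hom A x y" "s \<in> S y" for f x y s by (rule appS[OF that])
    show "app (farr X (Ident A x)) s = s" if "x \<in> Obj A" "s \<in> S x" for x s
      by (rule psh_app_ident[OF X that(1) SX[OF that(2)]])
    show "app (farr X (g \<cdot>\<^bsub>A\<^esub> f)) s = app (farr X f) (app (farr X g) s)"
      if "f \<in> Hom A x y" "g \<in> Hom A y z" "s \<in> S z" for f g x y z s
      by (rule psh_app_comp[OF X that(1,2) SX[OF that(3)]])
  qed blast
  define d where "d x = inv_into (S x) (i x)" for x
  have i_closed: "i x s \<in> elts (fobj L x)" if "x \<in> Obj A" "s \<in> S x" for x s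
    by (rule bij_betw_apply[OF i[OF that(1)] that(2)])
  have d_closed: "d x a \<in> S x" if "x \<in> Obj A" "a \<in> elts (fobj L x)" for x a
    using bij_betw_apply[OF bij_betw_inv_into[OF i[OF that(1)]] that(2)] by (simp add: d_def)
  have di: "d x (i x s) = s" if "x \<in> Obj A" "s \<in> S x" for x s
    using bij_betw_inv_into_left[OF i[OF that(1)] that(2)] by (simp add: d_def)
  have id: "i x (d x a) = a" if "x \<in> Obj A" "a \<in> elts (fobj L x)" for x a
    using bij_betw_inv_into_right[OF i[OF that(1)] that(2)] by (simp add: d_def)
  define q where "q = mk_arr elts A X L (\<lambda>x a. i x (ev e x a))"
  define m where "m = mk_arr elts A L X d"
  have q: "q \<in> Hom (presheaf_cat elts A) X L"
    unfolding q_def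
  proof (rule mk_arr_closed[OF A X L])
    show "i x (ev e x a) \<in> elts (fobj L x)" if "x \<in> Obj A" "a \<in> elts (fobj X x)" for x a
      by (rule i_closed[OF that(1) eS[OF that]])
    show "i x (ev e x (app (farr X f) a)) = app (farr L f) (i y (ev e y a))"
      if f: "f \<in> Hom A x y" and a: "a \<in> elts (fobj X y)" for f x y a
      using ev_natural[OF e f a] Li[OF f eS[OF A.Hom_objD(2)[OF f] a]] by simp
  qed
  have m: "m \<in> Hom (presheaf_cat elts A) L X"
    unfolding m_def
  proof (rule mk_arr_closed[OF A L X])
    show "d x a \<in> elts (fobj X x)" if "x \<in> Obj A" "a \<in> elts (fobj L x)" for x a
      by (rule SX[OF d_closed[OF that]])
    show "d x (app (farr L f) a) = app (farr X f) (d y a)"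
      if f: "f \<in> Hom A x y" and a: "a \<in> elts (fobj L y)" for f x y a
    proof -
      note x = A.Hom_objD(1)[OF f] and da = d_closed[OF A.Hom_objD(2)[OF f] a]
      show ?thesis
        using Li[OF f da] id[OF A.Hom_objD(2)[OF f] a] di[OF x appS[OF f da]] by simp
    qed
  qed
  have "q \<cdot>\<^bsub>presheaf_cat elts A\<^esub> m = Ident (presheaf_cat elts A) L"
  proof (rule psh_arr_eqI[OF P.comp_closed[OF m q] P.ident_closed[OF L]])
    fix x a assume xa: "x \<in> Obj A" "a \<in> elts (fobj L x)"
    show "ev (q \<cdot>\<^bsub>presheaf_cat elts A\<^esub> m) x a = ev (Ident (presheaf_cat elts A) L) x a"
      using ev_comp[OF m q xa] xa SX[OF d_closed[OF xa]] Se[OF d_closed[OF xa]] id[OF xa]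
      by (simp add: m_def q_def ev_ident)
  qed
  moreover have "m \<cdot>\<^bsub>presheaf_cat elts A\<^esub> q = e"
  proof (rule psh_arr_eqI[OF P.comp_closed[OF q m] e])
    fix x a assume xa: "x \<in> Obj A" "a \<in> elts (fobj X x)"
    show "ev (m \<cdot>\<^bsub>presheaf_cat elts A\<^esub> q) x a = ev e x a"
      using ev_comp[OF q m xa] xa i_closed[OF xa(1) eS[OF xa]] di[OF xa(1) eS[OF xa]]
      by (simp add: m_def q_def)
  qed
  ultimately show "\<exists>Y. \<exists>q\<in>Hom (presheaf_cat elts A) X Y. \<exists>m\<in>Hom (presheaf_cat elts A) Y X.
      q \<cdot>\<^bsub>presheaf_cat elts A\<^esub> m = Ident (presheaf_cat elts A) Y \<and> m \<cdot>\<^bsub>presheaf_cat elts A\<^esub> q = e"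
    using q m by blast
qed

text \<open>An arrow is determined by the joint graph \<open>?G\<close> of its components, a subset
  of a set that is small because \<open>Obj A\<close> is.\<close>

lemma locally_small_presheaf_cat:
  fixes A :: "('o, 'a) cat"
  assumes "small_category elts A"
  shows "locally_small elts (presheaf_cat elts A)"
  unfolding locally_small_def
proof (intro conjI ballI)
  have A: "category A" "small elts (Obj A)" using assms by (simp_all add: small_category_def)
  show "category (presheaf_cat elts A)" by (rule category_presheaf_cat[OF A(1)])
  fix X Y :: "('o, 'a, 'u) psh"
  let ?G = "\<lambda>m. {(x, a, b). x \<in> Obj A \<and> a \<in> elts (fobj X x) \<and> b = ev m x a}"
  show "small elts (Hom (presheaf_cat elts A) X Y)"
  proof (rule small_inj[where g = ?G])
    show "small elts (Pow (SIGMA x:Obj A. elts (fobj X x) \<times> elts (fobj Y x)))"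
      by (intro small_Pow small_Sigma small_elts A)
    show "inj_on ?G (Hom (presheaf_cat elts A) X Y)"
    proof (rule inj_onI)
      fix m n assume m: "m \<in> Hom (presheaf_cat elts A) X Y" and n: "n \<in> Hom (presheaf_cat elts A) X Y"
        and eq: "?G m = ?G n"
      show "m = n"
      proof (rule psh_arr_eqI[OF m n])
        fix x a assume "x \<in> Obj A" "a \<in> elts (fobj X x)"
        then have "(x, a, ev m x a) \<in> ?G m" by simp
        then have "(x, a, ev m x a) \<in> ?G n" unfolding eq .
        then show "ev m x a = ev n x a" by simp
      qed
    qed
    show "?G ` Hom (presheaf_cat elts A) X Y \<subseteq> Pow (SIGMA x:Obj A. elts (fobj X x) \<times> elts (fobj Y x))"
      by (auto intro: ev_closed)
  qed
qed

end

text \<open>Precomposition with \<open>K\<close>. The presheaf is rebuilt by \<open>mk_psh\<close>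
  because a bare composite of functors need not be \<open>extensional\<close>, as objects of the
  presheaf category must be.\<close>

definition restriction ::
  "('u \<Rightarrow> 'u set) \<Rightarrow> ('o1, 'a1) cat \<Rightarrow> ('o2, 'a2) cat \<Rightarrow> ('o1, 'a1, 'o2, 'a2) func \<Rightarrow>
     (('o2, 'a2, 'u) psh, ('o2, 'a2, 'u) psh_arr, ('o1, 'a1, 'u) psh, ('o1, 'a1, 'u) psh_arr) func" where
  "restriction elts A B K =
     (let R = (\<lambda>F. mk_psh elts A (\<lambda>x. fobj F (fobj K x)) (\<lambda>f. app (farr F (farr K f))))
      in \<lparr>fobj = R,
          farr = (\<lambda>m. mk_arr elts A (R (Dom (presheaf_cat elts B) m)) (R (Cod (presheaf_cat elts B) m))
                        (\<lambda>x. ev m (fobj K x)))\<rparr>)"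

lemma fobj_restriction [simp]:
  "x \<in> Obj A \<Longrightarrow> fobj (fobj (restriction elts A B K) F) x = fobj F (fobj K x)"
  by (simp add: restriction_def)

lemma app_restriction:
  assumes "f \<in> Hom A x y" "a \<in> elts (fobj F (fobj K y))"
  shows "app (farr (fobj (restriction elts A B K) F) f) a = app (farr F (farr K f)) a"
  using app_mk_psh[where elts = elts and ob = "\<lambda>x. fobj F (fobj K x)", OF assms]
  by (simp add: restriction_def)

lemma ev_restriction:
  assumes "x \<in> Obj A" "a \<in> elts (fobj F (fobj K x))" "m \<in> Hom (presheaf_cat elts B) F G"
  shows "ev (farr (restriction elts A B K) m) x a = ev m (fobj K x) a"
  using assms HomD[OF assms(3)] by (simp add: restriction_def Let_def)

lemma fobj_restriction_closed:
  assumes K: "cat_functor A B K" and F: "F \<in> Obj (presheaf_cat elts B)"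
  shows "fobj (restriction elts A B K) F \<in> Obj (presheaf_cat elts A)"
proof -
  interpret K: cat_functor A B K by fact
  show ?thesis
    unfolding restriction_def Let_def func.simps
  proof (rule mk_psh_closed[OF K.dom.category_axioms])
    show "app (farr F (farr K f)) a \<in> elts (fobj F (fobj K x))"
      if "f \<in> Hom A x y" "a \<in> elts (fobj F (fobj K y))" for f x y a
      by (rule psh_app_closed[OF F K.farr_closed[OF that(1)] that(2)])
    show "app (farr F (farr K (Ident A x))) a = a" if "x \<in> Obj A" "a \<in> elts (fobj F (fobj K x))" for x a
      using psh_app_ident[OF F K.fobj_closed[OF that(1)] that(2)] K.farr_ident[OF that(1)] by simp
    show "app (farr F (farr K (g \<cdot>\<^bsub>A\<^esub> f))) a = app (farr F (farr K f)) (app (farr F (farr K g)) a)"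
      if f: "f \<in> Hom A x y" and g: "g \<in> Hom A y z" and a: "a \<in> elts (fobj F (fobj K z))" for f g x y z a
      using psh_app_comp[OF F K.farr_closed[OF f] K.farr_closed[OF g] a] K.farr_comp[OF f g] by simp
  qed
qed

lemma farr_restriction_closed:
  assumes K: "cat_functor A B K" and m: "m \<in> Hom (presheaf_cat elts B) F G"
  shows "farr (restriction elts A B K) m \<in>
    Hom (presheaf_cat elts A) (fobj (restriction elts A B K) F) (fobj (restriction elts A B K) G)"
proof -
  interpret K: cat_functor A B K by fact
  interpret P: category "presheaf_cat elts B" by (rule category_presheaf_cat[OF K.cod.category_axioms])
  have eq: "farr (restriction elts A B K) m =
      mk_arr elts A (fobj (restriction elts A B K) F) (fobj (restriction elts A B K) G) (\<lambda>x. ev m (fobj K x))"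
    using HomD[OF m] by (simp add: restriction_def Let_def)
  show ?thesis
    unfolding eq
  proof (rule mk_arr_closed[OF K.dom.category_axioms fobj_restriction_closed[OF K P.Hom_objD(1)[OF m]]
        fobj_restriction_closed[OF K P.Hom_objD(2)[OF m]]])
    show "ev m (fobj K x) a \<in> elts (fobj (fobj (restriction elts A B K) G) x)"
      if "x \<in> Obj A" "a \<in> elts (fobj (fobj (restriction elts A B K) F) x)" for x a
      using ev_closed[OF m K.fobj_closed[OF that(1)]] that by simp
    show "ev m (fobj K x) (app (farr (fobj (restriction elts A B K) F) f) a) =
        app (farr (fobj (restriction elts A B K) G) f) (ev m (fobj K y) a)"
      if f: "f \<in> Hom A x y" and a: "a \<in> elts (fobj (fobj (restriction elts A B K) F) y)" for f x y a
    proof -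
      note y = K.dom.Hom_objD(2)[OF f]
      have a': "a \<in> elts (fobj F (fobj K y))" using a y by simp
      show ?thesis
        using ev_natural[OF m K.farr_closed[OF f] a'] app_restriction[where elts = elts, OF f a']
          app_restriction[where elts = elts, OF f ev_closed[OF m K.fobj_closed[OF y] a']] by simp
    qed
  qed
qed

lemma cat_functor_restriction:
  assumes K: "cat_functor A B K"
  shows "cat_functor (presheaf_cat elts B) (presheaf_cat elts A) (restriction elts A B K)"
proof -
  interpret K: cat_functor A B K by fact
  interpret P: category "presheaf_cat elts B" by (rule category_presheaf_cat[OF K.cod.category_axioms])
  interpret Q: category "presheaf_cat elts A" by (rule category_presheaf_cat[OF K.dom.category_axioms])
  let ?R = "restriction elts A B K"
  note R = farr_restriction_closed[OF K]
  show ?thesis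
  proof
    show "fobj ?R F \<in> Obj (presheaf_cat elts A)" if "F \<in> Obj (presheaf_cat elts B)" for F
      by (rule fobj_restriction_closed[OF K that])
    show "farr ?R m \<in> Hom (presheaf_cat elts A) (fobj ?R F) (fobj ?R G)"
      if "m \<in> Hom (presheaf_cat elts B) F G" for F G m by (rule R[OF that])
    show "farr ?R (Ident (presheaf_cat elts B) F) = Ident (presheaf_cat elts A) (fobj ?R F)"
      if F: "F \<in> Obj (presheaf_cat elts B)" for F
    proof (rule psh_arr_eqI[OF R[OF P.ident_closed[OF F]] Q.ident_closed[OF fobj_restriction_closed[OF K F]]])
      fix x a assume x: "x \<in> Obj A" and "a \<in> elts (fobj (fobj ?R F) x)"
      then have a: "a \<in> elts (fobj F (fobj K x))" by simp
      show "ev (farr ?R (Ident (presheaf_cat elts B) F)) x a = ev (Ident (presheaf_cat elts A) (fobj ?R F)) x a"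
        using ev_restriction[OF x a P.ident_closed[OF F]] x a K.fobj_closed[OF x] by (simp add: ev_ident)
    qed
    show "farr ?R (n \<cdot>\<^bsub>presheaf_cat elts B\<^esub> m) = farr ?R n \<cdot>\<^bsub>presheaf_cat elts A\<^esub> farr ?R m"
      if m: "m \<in> Hom (presheaf_cat elts B) F G" and n: "n \<in> Hom (presheaf_cat elts B) G H" for m n F G H
    proof (rule psh_arr_eqI[OF R[OF P.comp_closed[OF m n]] Q.comp_closed[OF R[OF m] R[OF n]]])
      fix x a assume x: "x \<in> Obj A" and a': "a \<in> elts (fobj (fobj ?R F) x)"
      then have a: "a \<in> elts (fobj F (fobj K x))" by simp
      note Kx = K.fobj_closed[OF x]
      show "ev (farr ?R (n \<cdot>\<^bsub>presheaf_cat elts B\<^esub> m)) x a = ev (farr ?R n \<cdot>\<^bsub>presheaf_cat elts A\<^esub> farr ?R m) x a"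
        using ev_restriction[OF x a P.comp_closed[OF m n]] ev_comp[OF R[OF m] R[OF n] x a']
          ev_restriction[OF x a m] ev_restriction[OF x ev_closed[OF m Kx a] n] ev_comp[OF m n Kx a]
        by simp
    qed
  qed
qed

text \<open>The value at \<open>b\<close> of the left Kan extension of \<open>X\<close> along \<open>K\<close> is the set of triples
  \<open>(x, p, f)\<close> with \<open>p \<in> X x\<close> and \<open>f : b \<rightarrow> K x\<close>, modulo the equivalence relation generated by
  \<open>(x, p\<cdot>u, f) \<sim> (y, p, K u \<circ> f)\<close>. Two triples are equivalent iff no set that is saturated for
  these generating pairs separates them.\<close>

definition lan_triples ::
  "('u \<Rightarrow> 'u set) \<Rightarrow> ('o1, 'a1) cat \<Rightarrow> ('o2, 'a2) cat \<Rightarrow> ('o1, 'a1, 'o2, 'a2) func \<Rightarrow>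
     ('o1, 'a1, 'u) psh \<Rightarrow> 'o2 \<Rightarrow> ('o1 \<times> 'u \<times> 'a2) set" where
  "lan_triples elts A B K X b = (SIGMA x:Obj A. elts (fobj X x) \<times> Hom B b (fobj K x))"

text \<open>Polymorphic in \<open>'z\<close> on purpose: at \<open>bool\<close> it describes the
  saturated sets, at other types the functions that descend to the quotient.\<close>

definition lan_compatible ::
  "('u \<Rightarrow> 'u set) \<Rightarrow> ('o1, 'a1) cat \<Rightarrow> ('o2, 'a2) cat \<Rightarrow> ('o1, 'a1, 'o2, 'a2) func \<Rightarrow>
     ('o1, 'a1, 'u) psh \<Rightarrow> 'o2 \<Rightarrow> ('o1 \<times> 'u \<times> 'a2 \<Rightarrow> 'z) \<Rightarrow> bool" where
  "lan_compatible elts A B K X b g \<longleftrightarrow>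
     (\<forall>x y. \<forall>u\<in>Hom A x y. \<forall>p\<in>elts (fobj X y). \<forall>f\<in>Hom B b (fobj K x).
        g (x, app (farr X u) p, f) = g (y, p, farr K u \<cdot>\<^bsub>B\<^esub> f))"

definition lan_class ::
  "('u \<Rightarrow> 'u set) \<Rightarrow> ('o1, 'a1) cat \<Rightarrow> ('o2, 'a2) cat \<Rightarrow> ('o1, 'a1, 'o2, 'a2) func \<Rightarrow>
     ('o1, 'a1, 'u) psh \<Rightarrow> 'o2 \<Rightarrow> 'o1 \<times> 'u \<times> 'a2 \<Rightarrow> ('o1 \<times> 'u \<times> 'a2) set" where
  "lan_class elts A B K X b t =
     {t' \<in> lan_triples elts A B K X b. \<forall>Q :: 'o1 \<times> 'u \<times> 'a2 \<Rightarrow> bool.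
        lan_compatible elts A B K X b Q \<longrightarrow> Q t = Q t'}"

lemma lan_class_compatible: "lan_compatible elts A B K X b (lan_class elts A B K X b)"
  unfolding lan_compatible_def lan_class_def by auto

text \<open>The fibre of \<open>g\<close> over \<open>g t'\<close> is itself saturated, hence cannot
  separate \<open>t\<close> from \<open>t'\<close>.\<close>

lemma lan_compatible_eq:
  assumes g: "lan_compatible elts A B K X b g" and t: "t' \<in> lan_triples elts A B K X b"
    and eq: "lan_class elts A B K X b t = lan_class elts A B K X b t'"
  shows "g t = g t'"
proof -
  have "t' \<in> lan_class elts A B K X b t" using t unfolding eq by (simp add: lan_class_def)
  moreover have "lan_compatible elts A B K X b (\<lambda>s. g s = g t')"
    using g by (simp add: lan_compatible_def)
  ultimately have "(g t = g t') = (g t' = g t')" unfolding lan_class_def by blast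
  then show ?thesis by simp
qed

text \<open>The pointwise left Kan extension. The triples at \<open>b\<close> form a small set,
  since \<open>Obj A\<close>, the values of \<open>X\<close> and the hom-sets of \<open>B\<close>
  are small; so their quotient is again the value of a presheaf. The unit sends \<open>p\<close> to
  the class of \<open>(x, p, 1)\<close>.\<close>

lemma (in grothendieck_universe) ex_universal_arrow_restriction:
  fixes A :: "('o1, 'a1) cat" and B :: "('o2, 'a2) cat"
  assumes small: "small elts (Obj A)" and B: "locally_small elts B" and K: "cat_functor A B K"
    and X: "X \<in> Obj (presheaf_cat elts A)"
  shows "\<exists>T u. universal_arrow (presheaf_cat elts A) (presheaf_cat elts B) (restriction elts A B K) X T u"
proof -
  interpret K: cat_functor A B K by fact
  interpret PA: category "presheaf_cat elts A" by (rule category_presheaf_cat[OF K.dom.category_axioms])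
  interpret PB: category "presheaf_cat elts B" by (rule category_presheaf_cat[OF K.cod.category_axioms])
  let ?R = "restriction elts A B K"
  define Tr where "Tr = lan_triples elts A B K X"
  define cl where "cl = lan_class elts A B K X"
  \<comment> \<open>The action of an arrow \<open>g\<close> of \<open>B\<close> on triples. On
    classes it is computed at a representative chosen by \<open>rep\<close>;
    \<open>sh_compatible\<close> with \<open>cl_rep\<close> shows that the choice is
    immaterial.\<close>
  define sh :: "'a2 \<Rightarrow> 'o1 \<times> 'u \<times> 'a2 \<Rightarrow> 'o1 \<times> 'u \<times> 'a2"
    where "sh g = (\<lambda>(x, p, f). (x, p, f \<cdot>\<^bsub>B\<^esub> g))" for g
  define rep where "rep b z = (SOME t. t \<in> Tr b \<and> cl b t = z)" for b z
  have Tr_iff: "(x, p, f) \<in> Tr b \<longleftrightarrow> x \<in> Obj A \<and> p \<in> elts (fobj X x) \<and> f \<in> Hom B b (fobj K x)" for x p f b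
    by (simp add: Tr_def lan_triples_def)
  have rep: "rep b z \<in> Tr b \<and> cl b (rep b z) = z" if "z \<in> cl b ` Tr b" for b z
    unfolding rep_def by (rule someI_ex) (use that in blast)
  have cl_rep: "g (rep b (cl b t)) = g t" if "lan_compatible elts A B K X b g" "t \<in> Tr b"
    for b t and g :: "_ \<Rightarrow> 'z"
    using lan_compatible_eq[OF that(1), of t "rep b (cl b t)"] that(2) rep[of "cl b t" b]
    by (simp add: Tr_def cl_def)
  have sh_closed: "sh g t \<in> Tr b'" if "g \<in> Hom B b' b" "t \<in> Tr b" for g b b' t
    using that K.cod.comp_closed[OF that(1)] by (cases t) (auto simp: Tr_iff sh_def)
  have sh_compatible: "lan_compatible elts A B K X b (\<lambda>t. cl b' (sh g t))" if g: "g \<in> Hom B b' b" for g b b'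
    unfolding lan_compatible_def
  proof (intro allI ballI)
    fix x y u p f assume u: "u \<in> Hom A x y" and p: "p \<in> elts (fobj X y)" and f: "f \<in> Hom B b (fobj K x)"
    show "cl b' (sh g (x, app (farr X u) p, f)) = cl b' (sh g (y, p, farr K u \<cdot>\<^bsub>B\<^esub> f))"
      using lan_class_compatible[of elts A B K X b'] u p K.cod.comp_closed[OF g f]
        K.cod.comp_assoc[OF g f K.farr_closed[OF u]]
      by (simp add: lan_compatible_def sh_def cl_def)
  qed
  obtain T e where T: "T \<in> Obj (presheaf_cat elts B)"
    and e: "\<And>b. b \<in> Obj B \<Longrightarrow> bij_betw (e b) (cl b ` Tr b) (elts (fobj T b))"
    and Te: "\<And>g b' b z. g \<in> Hom B b' b \<Longrightarrow> z \<in> cl b ` Tr b \<Longrightarrow>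
      app (farr T g) (e b z) = e b' (cl (Dom B g) (sh g (rep (Cod B g) z)))"
  proof (rule ex_presheaf_of_small_sets[OF K.cod.category_axioms, where elts = elts
        and S = "\<lambda>b. cl b ` Tr b" and ac = "\<lambda>g z. cl (Dom B g) (sh g (rep (Cod B g) z))"])
    show "small elts (cl b ` Tr b)" if "b \<in> Obj B" for b
      unfolding Tr_def lan_triples_def
      using B that by (intro small_image small_Sigma small small_elts) (simp_all add: locally_small_def K.fobj_closed)
    show "cl (Dom B g) (sh g (rep (Cod B g) z)) \<in> cl b' ` Tr b'"
      if "g \<in> Hom B b' b" "z \<in> cl b ` Tr b" for g b' b z
      using HomD[OF that(1)] sh_closed[OF that(1)] rep[OF that(2)] by simp
    show "cl (Dom B (Ident B b)) (sh (Ident B b) (rep (Cod B (Ident B b)) z)) = z"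
      if "b \<in> Obj B" "z \<in> cl b ` Tr b" for b z
    proof -
      have "sh (Ident B b) t = t" if "t \<in> Tr b" for t
        using that K.cod.ident_right by (cases t) (auto simp: Tr_iff sh_def)
      then show ?thesis using HomD[OF K.cod.ident_closed[OF that(1)]] rep[OF that(2)] by simp
    qed
    show "cl (Dom B (g \<cdot>\<^bsub>B\<^esub> f)) (sh (g \<cdot>\<^bsub>B\<^esub> f) (rep (Cod B (g \<cdot>\<^bsub>B\<^esub> f)) z)) =
        cl (Dom B f) (sh f (rep (Cod B f) (cl (Dom B g) (sh g (rep (Cod B g) z)))))"
      if f: "f \<in> Hom B x y" and g: "g \<in> Hom B y b" and z: "z \<in> cl b ` Tr b" for f g x y b z
    proof -
      have "sh (g \<cdot>\<^bsub>B\<^esub> f) t = sh f (sh g t)" if "t \<in> Tr b" for t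
        using that K.cod.comp_assoc[OF f g] by (cases t) (auto simp: Tr_iff sh_def)
      then show ?thesis
        using HomD[OF f] HomD[OF g] HomD[OF K.cod.comp_closed[OF f g]] conjunct1[OF rep[OF z]]
          cl_rep[OF sh_compatible[OF f] sh_closed[OF g conjunct1[OF rep[OF z]]]] by simp
    qed
  qed blast
  define ins where "ins b t = e b (cl b t)" for b t
  have ins_closed: "ins b t \<in> elts (fobj T b)" if "b \<in> Obj B" "t \<in> Tr b" for b t
    using bij_betw_apply[OF e[OF that(1)]] that(2) by (simp add: ins_def)
  have ins_app: "app (farr T g) (ins b t) = ins b' (sh g t)" if g: "g \<in> Hom B b' b" and t: "t \<in> Tr b" for g b' b t
    using Te[OF g imageI[OF t]] HomD[OF g] cl_rep[OF sh_compatible[OF g] t] by (simp add: ins_def)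
  have ins_compatible: "ins b (x, app (farr X u) p, f) = ins b (y, p, farr K u \<cdot>\<^bsub>B\<^esub> f)"
    if "u \<in> Hom A x y" "p \<in> elts (fobj X y)" "f \<in> Hom B b (fobj K x)" for b x y u p f
    using lan_class_compatible[of elts A B K X b] that by (simp add: lan_compatible_def ins_def cl_def)
  have ins_cases: "\<exists>t\<in>Tr b. a = ins b t" if "b \<in> Obj B" "a \<in> elts (fobj T b)" for b a
    using e[OF that(1)] that(2) unfolding bij_betw_def ins_def by blast
  have ins_lift: "\<exists>h. \<forall>t\<in>Tr b. h (ins b t) = g t"
    if b: "b \<in> Obj B" and g: "lan_compatible elts A B K X b g" for b and g :: "_ \<Rightarrow> 'u"
  proof (intro exI ballI)
    fix t assume t: "t \<in> Tr b"
    have "inv_into (cl b ` Tr b) (e b) (ins b t) = cl b t"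
      unfolding ins_def by (rule bij_betw_inv_into_left[OF e[OF b] imageI[OF t]])
    then show "(\<lambda>a. g (rep b (inv_into (cl b ` Tr b) (e b) a))) (ins b t) = g t"
      using cl_rep[OF g t] by simp
  qed
  define un where "un x p = ins (fobj K x) (x, p, Ident B (fobj K x))" for x p
  have ident_triple: "(x, p, Ident B (fobj K x)) \<in> Tr (fobj K x)" if "x \<in> Obj A" "p \<in> elts (fobj X x)" for x p
    using that K.cod.ident_closed[OF K.fobj_closed] by (simp add: Tr_iff)
  have un_closed: "un x p \<in> elts (fobj T (fobj K x))" if "x \<in> Obj A" "p \<in> elts (fobj X x)" for x p
    unfolding un_def by (rule ins_closed[OF K.fobj_closed[OF that(1)] ident_triple[OF that]])
  define u where "u = mk_arr elts A X (fobj ?R T) un"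
  \<comment> \<open>Thus every element of \<open>T\<close> is the restriction along some
    \<open>f\<close> of a value of the unit, which forces the extension of \<open>\<theta>\<close>
    below.\<close>
  have app_un: "app (farr T f) (un x p) = ins b (x, p, f)"
    if "x \<in> Obj A" "p \<in> elts (fobj X x)" "f \<in> Hom B b (fobj K x)" for b x p f
    unfolding un_def using ins_app[OF that(3) ident_triple[OF that(1,2)]] K.cod.ident_left[OF that(3)] by (simp add: sh_def)
  have u: "u \<in> Hom (presheaf_cat elts A) X (fobj ?R T)"
    unfolding u_def
  proof (rule mk_arr_closed[OF K.dom.category_axioms X fobj_restriction_closed[OF K T]])
    show "un x p \<in> elts (fobj (fobj ?R T) x)" if "x \<in> Obj A" "p \<in> elts (fobj X x)" for x p
      using un_closed[OF that] that(1) by simp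
    show "un x (app (farr X f) p) = app (farr (fobj ?R T) f) (un y p)"
      if f: "f \<in> Hom A x y" and p: "p \<in> elts (fobj X y)" for f x y p
    proof -
      note y = K.dom.Hom_objD(2)[OF f] and Kf = K.farr_closed[OF f]
      have "un x (app (farr X f) p) = ins (fobj K x) (y, p, farr K f)"
        unfolding un_def
        using ins_compatible[OF f p K.cod.ident_closed[OF K.cod.Hom_objD(1)[OF Kf]]] K.cod.ident_right[OF Kf]
        by simp
      then show ?thesis
        using app_restriction[where elts = elts, OF f un_closed[OF y p]] app_un[OF y p Kf] by simp
    qed
  qed
  have "\<exists>!\<tau>. \<tau> \<in> Hom (presheaf_cat elts B) T F \<and> farr ?R \<tau> \<cdot>\<^bsub>presheaf_cat elts A\<^esub> u = \<theta>"
    if F: "F \<in> Obj (presheaf_cat elts B)" and \<theta>: "\<theta> \<in> Hom (presheaf_cat elts A) X (fobj ?R F)" for F \<theta>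
  proof -
    \<comment> \<open>The forced value of the induced arrow \<open>T \<rightarrow> F\<close>, first
      on triples and then, by \<open>ins_lift\<close>, on classes.\<close>
    define g where "g = (\<lambda>(x, p, f). app (farr F f) (ev \<theta> x p))"
    have \<theta>_closed: "ev \<theta> x p \<in> elts (fobj F (fobj K x))" if "x \<in> Obj A" "p \<in> elts (fobj X x)" for x p
      using ev_closed[OF \<theta> that] that(1) by simp
    have "lan_compatible elts A B K X b g" for b
      unfolding lan_compatible_def
    proof (intro allI ballI)
      fix x y u p f assume u: "u \<in> Hom A x y" and p: "p \<in> elts (fobj X y)" and f: "f \<in> Hom B b (fobj K x)"
      note \<theta>p = \<theta>_closed[OF K.dom.Hom_objD(2)[OF u] p]
      show "g (x, app (farr X u) p, f) = g (y, p, farr K u \<cdot>\<^bsub>B\<^esub> f)"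
        using ev_natural[OF \<theta> u p] app_restriction[where elts = elts, OF u \<theta>p]
          psh_app_comp[OF F f K.farr_closed[OF u] \<theta>p] by (simp add: g_def)
    qed
    then have "\<forall>b\<in>Obj B. \<exists>h. \<forall>t\<in>Tr b. h (ins b t) = g t" using ins_lift by blast
    then obtain h where h: "\<And>b t. b \<in> Obj B \<Longrightarrow> t \<in> Tr b \<Longrightarrow> h b (ins b t) = g t"
      by metis
    define \<tau> where "\<tau> = mk_arr elts B T F h"
    have g_closed: "g t \<in> elts (fobj F b)" if "t \<in> Tr b" for b t
      using that \<theta>_closed psh_app_closed[OF F] by (cases t) (auto simp: Tr_iff g_def)
    have g_sh: "g (sh k t) = app (farr F k) (g t)" if "k \<in> Hom B b' b" "t \<in> Tr b" for k b' b t
      using that \<theta>_closed psh_app_comp[OF F that(1)] by (cases t) (auto simp: Tr_iff g_def sh_def)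
    have \<tau>: "\<tau> \<in> Hom (presheaf_cat elts B) T F"
      unfolding \<tau>_def
    proof (rule mk_arr_closed[OF K.cod.category_axioms T F])
      show "h b a \<in> elts (fobj F b)" if "b \<in> Obj B" "a \<in> elts (fobj T b)" for b a
        using ins_cases[OF that] h[OF that(1)] g_closed by auto
      show "h b' (app (farr T k) a) = app (farr F k) (h b a)"
        if k: "k \<in> Hom B b' b" and a: "a \<in> elts (fobj T b)" for k b' b a
      proof -
        obtain t where t: "t \<in> Tr b" "a = ins b t" using ins_cases[OF K.cod.Hom_objD(2)[OF k] a] by blast
        show ?thesis
          using ins_app[OF k t(1)] h[OF K.cod.Hom_objD(1)[OF k] sh_closed[OF k t(1)]]
            h[OF K.cod.Hom_objD(2)[OF k] t(1)] g_sh[OF k t(1)] t(2) by simp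
      qed
    qed
    have comp_u: "ev (farr ?R \<sigma> \<cdot>\<^bsub>presheaf_cat elts A\<^esub> u) x p = ev \<sigma> (fobj K x) (un x p)"
      if \<sigma>: "\<sigma> \<in> Hom (presheaf_cat elts B) T F" and x: "x \<in> Obj A" and p: "p \<in> elts (fobj X x)" for \<sigma> x p
      using ev_comp[OF u farr_restriction_closed[OF K \<sigma>] x p] ev_restriction[OF x un_closed[OF x p] \<sigma>] x p
      by (simp add: u_def)
    show ?thesis
    proof (intro ex1I conjI)
      show "\<tau> \<in> Hom (presheaf_cat elts B) T F" by (rule \<tau>)
      show "farr ?R \<tau> \<cdot>\<^bsub>presheaf_cat elts A\<^esub> u = \<theta>"
      proof (rule psh_arr_eqI[OF PA.comp_closed[OF u farr_restriction_closed[OF K \<tau>]] \<theta>])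
        fix x p assume x: "x \<in> Obj A" and p: "p \<in> elts (fobj X x)"
        show "ev (farr ?R \<tau> \<cdot>\<^bsub>presheaf_cat elts A\<^esub> u) x p = ev \<theta> x p"
          using comp_u[OF \<tau> x p] K.fobj_closed[OF x] un_closed[OF x p] h[OF K.fobj_closed[OF x] ident_triple[OF x p]]
            psh_app_ident[OF F K.fobj_closed[OF x] \<theta>_closed[OF x p]]
          by (simp add: \<tau>_def un_def g_def)
      qed
      fix \<sigma> assume "\<sigma> \<in> Hom (presheaf_cat elts B) T F \<and> farr ?R \<sigma> \<cdot>\<^bsub>presheaf_cat elts A\<^esub> u = \<theta>"
      then have \<sigma>: "\<sigma> \<in> Hom (presheaf_cat elts B) T F" and \<sigma>u: "farr ?R \<sigma> \<cdot>\<^bsub>presheaf_cat elts A\<^esub> u = \<theta>" by auto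
      show "\<sigma> = \<tau>"
      proof (rule psh_arr_eqI[OF \<sigma> \<tau>])
        fix b a assume b: "b \<in> Obj B" and a: "a \<in> elts (fobj T b)"
        obtain x p f where t: "(x, p, f) \<in> Tr b" "a = ins b (x, p, f)" using ins_cases[OF b a] by (metis prod_cases3)
        then have x: "x \<in> Obj A" and p: "p \<in> elts (fobj X x)" and f: "f \<in> Hom B b (fobj K x)"
          by (simp_all add: Tr_iff)
        have "ev \<sigma> b a = app (farr F f) (ev \<theta> x p)"
          using ev_natural[OF \<sigma> f un_closed[OF x p]] app_un[OF x p f] t(2) comp_u[OF \<sigma> x p] \<sigma>u by simp
        then show "ev \<sigma> b a = ev \<tau> b a"
          using b a h[OF b t(1)] t(2) by (simp add: \<tau>_def g_def)
      qed
    qed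
  qed
  then have "universal_arrow (presheaf_cat elts A) (presheaf_cat elts B) ?R X T u"
    using T u by (simp add: universal_arrow_def)
  then show ?thesis by blast
qed

section \<open>Retracts of presheaf categories\<close>

lemma comp_func_id_func [simp]: "comp_func F id_func = (F :: ('o1, 'a1, 'o2, 'a2) func)"
  by (simp add: comp_func_def id_func_def comp_def)

text \<open>Here \<open>s'\<close> and \<open>j'\<close> are the direct images that belong to the
  inverse images \<open>s\<close> and \<open>j\<close>, and \<open>\<rho>\<close> is the isomorphism
  from \<open>j s\<close> to the identity, with inverse \<open>\<rho>'\<close>.\<close>

locale section_adjoints = grothendieck_universe elts
  for elts :: "'u \<Rightarrow> 'u set" +
  fixes C :: "('c, 'd) cat" and E :: "('o, 'a) cat"
    and s :: "('o, 'a, ('c, 'd, 'u) psh, ('c, 'd, 'u) psh_arr) func"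
    and s' :: "(('c, 'd, 'u) psh, ('c, 'd, 'u) psh_arr, 'o, 'a) func"
    and j :: "(('c, 'd, 'u) psh, ('c, 'd, 'u) psh_arr, 'o, 'a) func"
    and j' :: "('o, 'a, ('c, 'd, 'u) psh, ('c, 'd, 'u) psh_arr) func"
    and \<rho> \<rho>' :: "'o \<Rightarrow> 'a"
  assumes small_C: "small_category elts C"
    and s_adjoint: "adjoint E (presheaf_cat elts C) s s'"
    and j_adjoint: "adjoint (presheaf_cat elts C) E j j'"
    and \<rho>: "\<And>x. x \<in> Obj E \<Longrightarrow> \<rho> x \<in> Hom E (fobj j (fobj s x)) x"
    and \<rho>': "\<And>x. x \<in> Obj E \<Longrightarrow> \<rho>' x \<in> Hom E x (fobj j (fobj s x))"
    and \<rho>\<rho>': "\<And>x. x \<in> Obj E \<Longrightarrow> \<rho> x \<cdot>\<^bsub>E\<^esub> \<rho>' x = Ident E x"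
    and \<rho>'\<rho>: "\<And>x. x \<in> Obj E \<Longrightarrow> \<rho>' x \<cdot>\<^bsub>E\<^esub> \<rho> x = Ident E (fobj j (fobj s x))"
    and \<rho>_natural: "\<And>x y f. f \<in> Hom E x y \<Longrightarrow> \<rho> y \<cdot>\<^bsub>E\<^esub> farr j (farr s f) = f \<cdot>\<^bsub>E\<^esub> \<rho> x"
begin

section \<open>First consequences of the retraction: density, smallness and split
  idempotents\<close>

abbreviation P :: "('c, 'd, 'u) psh_cat" where "P \<equiv> presheaf_cat elts C"
abbreviation Eh :: "('o, 'a, 'u) psh_cat" where "Eh \<equiv> presheaf_cat elts E"
abbreviation el :: "('c, 'd, 'u) psh \<Rightarrow> 'c \<Rightarrow> 'u \<Rightarrow> ('c, 'd, 'u) psh_arr"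
  where "el \<equiv> yoneda_elem elts C"

definition k :: "('c, 'd, 'o, 'a) func" where "k = comp_func j (yoneda elts C)"

abbreviation res :: "(('o, 'a, 'u) psh, ('o, 'a, 'u) psh_arr, ('c, 'd, 'u) psh, ('c, 'd, 'u) psh_arr) func"
  where "res \<equiv> restriction elts C E k"

sublocale s: cat_functor E P s using s_adjoint by (simp add: adjoint_def)
sublocale j: cat_functor P E j using j_adjoint by (simp add: adjoint_def)

lemma locally_small_C: "locally_small elts C"
  using small_C small_subset[of "Arr C"] by (auto simp: small_category_def locally_small_def Hom_def)

lemma cat_functor_k: "cat_functor C E k"
  unfolding k_def
  by (rule cat_functor_comp_func[OF cat_functor_yoneda[OF locally_small_C] j.cat_functor_axioms])

sublocale k: cat_functor C E k by (rule cat_functor_k)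

lemma fobj_k [simp]: "fobj k c = fobj j (representable elts C c)"
  by (simp add: k_def comp_func_def)

lemma el_closed:
  "X \<in> Obj P \<Longrightarrow> c \<in> Obj C \<Longrightarrow> p \<in> elts (fobj X c) \<Longrightarrow> el X c p \<in> Hom P (representable elts C c) X"
  by (rule yoneda_elem_closed[OF locally_small_C])

lemma j_el_closed:
  "X \<in> Obj P \<Longrightarrow> c \<in> Obj C \<Longrightarrow> p \<in> elts (fobj X c) \<Longrightarrow> farr j (el X c p) \<in> Hom E (fobj k c) (fobj j X)"
  using j.farr_closed[OF el_closed] by simp

lemma j_comp_el:
  assumes "m \<in> Hom P X Z" "c \<in> Obj C" "p \<in> elts (fobj X c)"
  shows "farr j m \<cdot>\<^bsub>E\<^esub> farr j (el X c p) = farr j (el Z c (ev m c p))"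
  using comp_yoneda_elem[OF locally_small_C assms]
    j.farr_comp[OF el_closed[OF s.cod.Hom_objD(1)[OF assms(1)] assms(2,3)] assms(1)] by simp

text \<open>The left adjoint \<open>j\<close> carries the colimit of \<open>density\<close> into
  \<open>E\<close>. Hence arrows out of \<open>j X\<close> can be defined and compared on the legs
  \<open>k c \<rightarrow> j X\<close>.\<close>

lemma j_density:
  "X \<in> Obj P \<Longrightarrow> weighted_colimit elts C E X k (fobj j X) (\<lambda>c p. farr j (el X c p))"
  unfolding k_def
  by (rule weighted_colimit_left_adjoint[OF cat_functor_yoneda[OF locally_small_C] j_adjoint
        density[OF locally_small_C]])

lemma j_eqI:
  assumes "X \<in> Obj P" "h \<in> Hom E (fobj j X) v" "h' \<in> Hom E (fobj j X) v"
    and "\<And>c p. c \<in> Obj C \<Longrightarrow> p \<in> elts (fobj X c) \<Longrightarrow>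
      h \<cdot>\<^bsub>E\<^esub> farr j (el X c p) = h' \<cdot>\<^bsub>E\<^esub> farr j (el X c p)"
  shows "h = h'"
  using weighted_colimit_eqI[OF cat_functor_k j_density assms(2,3)] assms(1,4) by blast

lemma comp_\<rho>_\<rho>':
  assumes "f \<in> Hom E x y"
  shows "(f \<cdot>\<^bsub>E\<^esub> \<rho> x) \<cdot>\<^bsub>E\<^esub> \<rho>' x = f"
proof -
  note x = s.dom.Hom_objD(1)[OF assms]
  show ?thesis
    using s.dom.comp_assoc[OF \<rho>'[OF x] \<rho>[OF x] assms] \<rho>\<rho>'[OF x] s.dom.ident_right[OF assms] by simp
qed

text \<open>\<open>s\<close> is faithful, since \<open>f\<close> is \<open>j (s f)\<close>
  conjugated by \<open>\<rho>\<close>; so hom-sets of \<open>E\<close> embed into those of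
  \<open>P\<close>, which is locally small because \<open>C\<close> is small.\<close>

lemma locally_small_E: "locally_small elts E"
  unfolding locally_small_def
proof (intro conjI ballI s.dom.category_axioms)
  fix x y assume x: "x \<in> Obj E" and y: "y \<in> Obj E"
  show "small elts (Hom E x y)"
  proof (rule small_inj[where g = "farr s"])
    show "small elts (Hom P (fobj s x) (fobj s y))"
      using locally_small_presheaf_cat[OF small_C] s.fobj_closed x y by (simp add: locally_small_def)
    show "inj_on (farr s) (Hom E x y)"
    proof (rule inj_onI)
      fix f g assume "f \<in> Hom E x y" "g \<in> Hom E x y" "farr s f = farr s g"
      then show "f = g" using \<rho>_natural comp_\<rho>_\<rho>' by metis
    qed
    show "farr s ` Hom E x y \<subseteq> Hom P (fobj s x) (fobj s y)" using s.farr_closed by blast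
  qed
qed

sublocale Eh: category Eh by (rule category_presheaf_cat[OF s.dom.category_axioms])
sublocale y: cat_functor E Eh "yoneda elts E" by (rule cat_functor_yoneda[OF locally_small_E])
sublocale res: cat_functor Eh P res by (rule cat_functor_restriction[OF cat_functor_k])

text \<open>Split \<open>s e\<close> in \<open>P\<close>, apply \<open>j\<close>, and use
  \<open>\<rho>\<close> to move from \<open>j (s x)\<close> back to \<open>x\<close>.\<close>

lemma idempotents_split_E: "idempotents_split E"
  unfolding idempotents_split_def
proof (intro allI ballI impI)
  fix x e assume e: "e \<in> Hom E x x" and ee: "e \<cdot>\<^bsub>E\<^esub> e = e"
  note x = s.dom.Hom_objD(1)[OF e]
  have "farr s e \<cdot>\<^bsub>P\<^esub> farr s e = farr s e" using s.farr_comp[OF e e] ee by simp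
  then obtain l q m where q: "q \<in> Hom P (fobj s x) l" and m: "m \<in> Hom P l (fobj s x)"
    and qm: "q \<cdot>\<^bsub>P\<^esub> m = Ident P l" and mq: "m \<cdot>\<^bsub>P\<^esub> q = farr s e"
    using idempotents_split_presheaf_cat[OF k.dom.category_axioms] s.farr_closed[OF e]
    unfolding idempotents_split_def by blast
  note jq = j.farr_closed[OF q] and jm = j.farr_closed[OF m]
  have 1: "farr j q \<cdot>\<^bsub>E\<^esub> \<rho>' x \<in> Hom E x (fobj j l)" by (rule s.dom.comp_closed[OF \<rho>'[OF x] jq])
  have 2: "\<rho> x \<cdot>\<^bsub>E\<^esub> farr j m \<in> Hom E (fobj j l) x" by (rule s.dom.comp_closed[OF jm \<rho>[OF x]])
  have "(farr j q \<cdot>\<^bsub>E\<^esub> \<rho>' x) \<cdot>\<^bsub>E\<^esub> (\<rho> x \<cdot>\<^bsub>E\<^esub> farr j m) = Ident E (fobj j l)"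
    using s.dom.comp_cancel_middle[OF jm \<rho>[OF x] \<rho>'[OF x] jq \<rho>'\<rho>[OF x]] j.farr_comp[OF m q] qm
      j.farr_ident[OF s.cod.Hom_objD(1)[OF m]] by simp
  moreover have "(\<rho> x \<cdot>\<^bsub>E\<^esub> farr j m) \<cdot>\<^bsub>E\<^esub> (farr j q \<cdot>\<^bsub>E\<^esub> \<rho>' x) = e"
  proof -
    have "(\<rho> x \<cdot>\<^bsub>E\<^esub> farr j m) \<cdot>\<^bsub>E\<^esub> (farr j q \<cdot>\<^bsub>E\<^esub> \<rho>' x) = (\<rho> x \<cdot>\<^bsub>E\<^esub> (farr j m \<cdot>\<^bsub>E\<^esub> farr j q)) \<cdot>\<^bsub>E\<^esub> \<rho>' x"
      using s.dom.comp_assoc[OF \<rho>'[OF x] jq 2] s.dom.comp_assoc[OF jq jm \<rho>[OF x]] by simp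
    also have "farr j m \<cdot>\<^bsub>E\<^esub> farr j q = farr j (farr s e)" using j.farr_comp[OF q m] mq by simp
    finally show ?thesis using \<rho>_natural[OF e] comp_\<rho>_\<rho>'[OF e] by simp
  qed
  ultimately show "\<exists>l. \<exists>q\<in>Hom E x l. \<exists>m\<in>Hom E l x. q \<cdot>\<^bsub>E\<^esub> m = Ident E l \<and> m \<cdot>\<^bsub>E\<^esub> q = e"
    using 1 2 by blast
qed

text \<open>The arrow \<open>k c \<rightarrow> j s x \<cong> x\<close> given by \<open>p \<in> (s x) c\<close>.\<close>

definition elem_arr :: "'o \<Rightarrow> 'c \<Rightarrow> 'u \<Rightarrow> 'a" where
  "elem_arr x c p = \<rho> x \<cdot>\<^bsub>E\<^esub> farr j (el (fobj s x) c p)"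

lemma elem_arr_closed:
  assumes x: "x \<in> Obj E" and c: "c \<in> Obj C" and p: "p \<in> elts (fobj (fobj s x) c)"
  shows "elem_arr x c p \<in> Hom E (fobj k c) x"
  unfolding elem_arr_def by (rule s.dom.comp_closed[OF j_el_closed[OF s.fobj_closed[OF x] c p] \<rho>[OF x]])

text \<open>Naturality in \<open>c\<close> of the comparison
  \<open>s x \<rightarrow> E(k -, x)\<close>; \<open>elem_arr_comp\<close> is its naturality in
  \<open>x\<close>.\<close>

lemma elem_arr_app:
  assumes x: "x \<in> Obj E" and f: "f \<in> Hom C b c" and p: "p \<in> elts (fobj (fobj s x) c)"
  shows "elem_arr x b (app (farr (fobj s x) f) p) = elem_arr x c p \<cdot>\<^bsub>E\<^esub> farr k f"
proof -
  note sx = s.fobj_closed[OF x] and c = k.dom.Hom_objD(2)[OF f]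
  note Yf = farr_yoneda_closed[OF locally_small_C f]
  have "farr j (el (fobj s x) b (app (farr (fobj s x) f) p)) = farr j (el (fobj s x) c p) \<cdot>\<^bsub>E\<^esub> farr k f"
    using yoneda_elem_app[OF locally_small_C sx f p] j.farr_comp[OF Yf el_closed[OF sx c p]]
    by (simp add: k_def comp_func_def)
  then show ?thesis
    using s.dom.comp_assoc[OF k.farr_closed[OF f] j_el_closed[OF sx c p] \<rho>[OF x]] by (simp add: elem_arr_def)
qed

lemma elem_arr_comp:
  assumes f: "f \<in> Hom E x y" and c: "c \<in> Obj C" and p: "p \<in> elts (fobj (fobj s x) c)"
  shows "elem_arr y c (ev (farr s f) c p) = f \<cdot>\<^bsub>E\<^esub> elem_arr x c p"
proof -
  note x = s.dom.Hom_objD(1)[OF f] and y = s.dom.Hom_objD(2)[OF f]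
  note sf = s.farr_closed[OF f] and jel = j_el_closed[OF s.fobj_closed[OF x] c p]
  show ?thesis
    using j_comp_el[OF sf c p] s.dom.comp_assoc[OF jel j.farr_closed[OF sf] \<rho>[OF y]] \<rho>_natural[OF f]
      s.dom.comp_assoc[OF jel \<rho>[OF x] f] by (simp add: elem_arr_def)
qed

text \<open>The comparison \<open>s x \<rightarrow> E(k -, x)\<close> followed by the restriction
  along \<open>k\<close> of the Yoneda arrow from \<open>E(-, x)\<close> to \<open>F\<close> that
  corresponds to \<open>a\<close>.\<close>

definition mu :: "('o, 'a, 'u) psh \<Rightarrow> 'o \<Rightarrow> 'u \<Rightarrow> ('c, 'd, 'u) psh_arr" where
  "mu F x a = mk_arr elts C (fobj s x) (fobj res F) (\<lambda>c p. app (farr F (elem_arr x c p)) a)"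

lemma ev_mu:
  "c \<in> Obj C \<Longrightarrow> p \<in> elts (fobj (fobj s x) c) \<Longrightarrow> ev (mu F x a) c p = app (farr F (elem_arr x c p)) a"
  by (simp add: mu_def)

lemma mu_closed:
  assumes F: "F \<in> Obj Eh" and x: "x \<in> Obj E" and a: "a \<in> elts (fobj F x)"
  shows "mu F x a \<in> Hom P (fobj s x) (fobj res F)"
  unfolding mu_def
proof (rule mk_arr_closed[OF k.dom.category_axioms s.fobj_closed[OF x] res.fobj_closed[OF F]])
  show "app (farr F (elem_arr x c p)) a \<in> elts (fobj (fobj res F) c)"
    if "c \<in> Obj C" "p \<in> elts (fobj (fobj s x) c)" for c p
    using psh_app_closed[OF F elem_arr_closed[OF x that] a] that(1) by simp
  show "app (farr F (elem_arr x b (app (farr (fobj s x) f) p))) a = app (farr (fobj res F) f) (app (farr F (elem_arr x c p)) a)"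
    if f: "f \<in> Hom C b c" and p: "p \<in> elts (fobj (fobj s x) c)" for b c f p
  proof -
    note t = elem_arr_closed[OF x k.dom.Hom_objD(2)[OF f] p]
    show ?thesis
      using elem_arr_app[OF x f p] psh_app_comp[OF F k.farr_closed[OF f] t a]
        app_restriction[where elts = elts, OF f psh_app_closed[OF F t a]] by simp
  qed
qed

text \<open>Naturality of \<open>elem_arr\<close> in \<open>x\<close>, seen through the action of
  \<open>F\<close>. The cocone has vertex \<open>F k\<close>, and so induces \<open>\<phi>\<close>
  once \<open>s\<close> is known to preserve the colimit \<open>c F\<close>.\<close>

lemma mu_cocone:
  assumes F: "F \<in> Obj Eh"
  shows "weighted_cocone elts E P F s (fobj res F) (mu F)"
proof (rule weighted_coconeI[OF res.fobj_closed[OF F] mu_closed[OF F]])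
  fix x y f a assume f: "f \<in> Hom E x y" and a: "a \<in> elts (fobj F y)"
  note x = s.dom.Hom_objD(1)[OF f] and y = s.dom.Hom_objD(2)[OF f]
  note sf = s.farr_closed[OF f]
  show "mu F x (app (farr F f) a) = mu F y a \<cdot>\<^bsub>P\<^esub> farr s f"
  proof (rule psh_arr_eqI[OF mu_closed[OF F x psh_app_closed[OF F f a]] s.cod.comp_closed[OF sf mu_closed[OF F y a]]])
    fix c p assume c: "c \<in> Obj C" and p: "p \<in> elts (fobj (fobj s x) c)"
    show "ev (mu F x (app (farr F f) a)) c p = ev (mu F y a \<cdot>\<^bsub>P\<^esub> farr s f) c p"
      using ev_comp[OF sf mu_closed[OF F y a] c p] ev_mu[OF c p, of F] ev_mu[OF c ev_closed[OF sf c p], of F a]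
        elem_arr_comp[OF f c p] psh_app_comp[OF F elem_arr_closed[OF x c p] f a] by simp
  qed
qed

text \<open>\<open>m\<close> commutes with the action of each arrow \<open>elem_arr x c p\<close>.
  This gives the naturality of \<open>\<phi>\<close>.\<close>

lemma mu_natural:
  assumes m: "m \<in> Hom Eh F G" and x: "x \<in> Obj E" and a: "a \<in> elts (fobj F x)"
  shows "farr res m \<cdot>\<^bsub>P\<^esub> mu F x a = mu G x (ev m x a)"
proof -
  note F = Eh.Hom_objD(1)[OF m] and G = Eh.Hom_objD(2)[OF m]
  note muF = mu_closed[OF F x a] and rm = res.farr_closed[OF m]
  show ?thesis
  proof (rule psh_arr_eqI[OF s.cod.comp_closed[OF muF rm] mu_closed[OF G x ev_closed[OF m x a]]])
    fix c p assume c: "c \<in> Obj C" and p: "p \<in> elts (fobj (fobj s x) c)"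
    note t = elem_arr_closed[OF x c p]
    show "ev (farr res m \<cdot>\<^bsub>P\<^esub> mu F x a) c p = ev (mu G x (ev m x a)) c p"
      using ev_comp[OF muF rm c p] ev_mu[OF c p, of F a] ev_mu[OF c p, of G]
        ev_restriction[OF c psh_app_closed[OF F t a] m] ev_natural[OF m t a] by simp
  qed
qed

text \<open>\<open>j (F k)\<close> is the colimit of the objects \<open>k c\<close> weighted by \<open>F k\<close>; the arrow \<open>h\<close> out of it is
  determined by the legs of \<open>i\<close> at these objects.\<close>

definition extends :: "('o, 'a, 'u) psh \<Rightarrow> 'o \<Rightarrow> ('o \<Rightarrow> 'u \<Rightarrow> 'a) \<Rightarrow> 'a \<Rightarrow> bool" where
  "extends F v i h \<longleftrightarrow> h \<in> Hom E (fobj j (fobj res F)) v \<and>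
     (\<forall>c\<in>Obj C. \<forall>q\<in>elts (fobj F (fobj k c)). h \<cdot>\<^bsub>E\<^esub> farr j (el (fobj res F) c q) = i (fobj k c) q)"

text \<open>The legs of \<open>i\<close> at the objects \<open>k c\<close> form a cocone on
  \<open>k\<close> weighted by \<open>F k\<close>, to which \<open>j_density\<close>
  applies.\<close>

lemma ex_extends:
  assumes F: "F \<in> Obj Eh" and i: "weighted_cocone elts E E F id_func v i"
  shows "\<exists>h. extends F v i h"
proof -
  note i = weighted_coconeD[OF i, unfolded id_func_def, simplified]
  have "weighted_cocone elts C E (fobj res F) k v (\<lambda>c. i (fobj k c))"
  proof (rule weighted_coconeI[OF i(1)])
    show "i (fobj k c) q \<in> Hom E (fobj k c) v" if "c \<in> Obj C" "q \<in> elts (fobj (fobj res F) c)" for c q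
      using i(2)[OF k.fobj_closed[OF that(1)]] that by simp
    show "i (fobj k b) (app (farr (fobj res F) f) q) = i (fobj k c) q \<cdot>\<^bsub>E\<^esub> farr k f"
      if f: "f \<in> Hom C b c" and q: "q \<in> elts (fobj (fobj res F) c)" for b c f q
    proof -
      have q': "q \<in> elts (fobj F (fobj k c))" using q k.dom.Hom_objD[OF f] by simp
      show ?thesis using i(3)[OF k.farr_closed[OF f] q'] app_restriction[where elts = elts, OF f q'] by simp
    qed
  qed
  from weighted_colimit_ex[OF j_density[OF res.fobj_closed[OF F]] this]
  obtain h where "h \<in> Hom E (fobj j (fobj res F)) v"
    "\<And>c q. c \<in> Obj C \<Longrightarrow> q \<in> elts (fobj (fobj res F) c) \<Longrightarrow>
      h \<cdot>\<^bsub>E\<^esub> farr j (el (fobj res F) c q) = i (fobj k c) q" by blast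
  then show ?thesis unfolding extends_def by auto
qed

text \<open>Stated for families that agree on the carriers, because \<open>cocone_of_arr\<close> has
  uncontrolled values elsewhere.\<close>

lemma extends_unique:
  assumes F: "F \<in> Obj Eh" and h: "extends F v i h" "extends F v i' h'"
    and "\<And>x a. x \<in> Obj E \<Longrightarrow> a \<in> elts (fobj F x) \<Longrightarrow> i x a = i' x a"
  shows "h = h'"
proof (rule j_eqI[OF res.fobj_closed[OF F], where v = v])
  show "h \<cdot>\<^bsub>E\<^esub> farr j (el (fobj res F) c p) = h' \<cdot>\<^bsub>E\<^esub> farr j (el (fobj res F) c p)"
    if "c \<in> Obj C" "p \<in> elts (fobj (fobj res F) c)" for c p
    using h assms(4)[OF k.fobj_closed[OF that(1)]] that by (simp add: extends_def)
qed (use h in \<open>simp_all add: extends_def\<close>)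

lemma extends_comp:
  assumes F: "F \<in> Obj Eh" and h: "extends F v i h" and g: "g \<in> Hom E v w"
  shows "extends F w (\<lambda>x a. g \<cdot>\<^bsub>E\<^esub> i x a) (g \<cdot>\<^bsub>E\<^esub> h)"
  unfolding extends_def
proof (intro conjI ballI)
  have h1: "h \<in> Hom E (fobj j (fobj res F)) v" using h by (simp add: extends_def)
  show "g \<cdot>\<^bsub>E\<^esub> h \<in> Hom E (fobj j (fobj res F)) w" by (rule s.dom.comp_closed[OF h1 g])
  fix c q assume c: "c \<in> Obj C" and q: "q \<in> elts (fobj F (fobj k c))"
  have "q \<in> elts (fobj (fobj res F) c)" using c q by simp
  from s.dom.comp_assoc[OF j_el_closed[OF res.fobj_closed[OF F] c this] h1 g]
  show "(g \<cdot>\<^bsub>E\<^esub> h) \<cdot>\<^bsub>E\<^esub> farr j (el (fobj res F) c q) = g \<cdot>\<^bsub>E\<^esub> i (fobj k c) q"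
    using h c q by (simp add: extends_def)
qed

text \<open>\<open>h\<close> knows \<open>i\<close> only at the objects \<open>k c\<close>, but this
  determines \<open>i x a\<close>. Test on the leg of \<open>j (s x)\<close> given by
  \<open>p\<close>, and let \<open>t\<close> be \<open>elem_arr x c p\<close>: there the left side
  is the leg of \<open>i\<close> at the restriction of \<open>a\<close> along \<open>t\<close>,
  which is \<open>i x a \<cdot> t\<close> by the cocone condition, and \<open>t\<close> is
  \<open>\<rho> x\<close> after the leg.\<close>

lemma extends_mu:
  assumes F: "F \<in> Obj Eh" and i: "weighted_cocone elts E E F id_func v i" and h: "extends F v i h"
    and x: "x \<in> Obj E" and a: "a \<in> elts (fobj F x)"
  shows "h \<cdot>\<^bsub>E\<^esub> farr j (mu F x a) = i x a \<cdot>\<^bsub>E\<^esub> \<rho> x"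
proof -
  note i = weighted_coconeD[OF i, unfolded id_func_def, simplified]
  have h1: "h \<in> Hom E (fobj j (fobj res F)) v" using h by (simp add: extends_def)
  note mu = mu_closed[OF F x a]
  show ?thesis
  proof (rule j_eqI[OF s.fobj_closed[OF x] s.dom.comp_closed[OF j.farr_closed[OF mu] h1]
        s.dom.comp_closed[OF \<rho>[OF x] i(2)[OF x a]]])
    fix c p assume c: "c \<in> Obj C" and p: "p \<in> elts (fobj (fobj s x) c)"
    note jel = j_el_closed[OF s.fobj_closed[OF x] c p] and t = elem_arr_closed[OF x c p]
    have "(h \<cdot>\<^bsub>E\<^esub> farr j (mu F x a)) \<cdot>\<^bsub>E\<^esub> farr j (el (fobj s x) c p) =
        h \<cdot>\<^bsub>E\<^esub> farr j (el (fobj res F) c (app (farr F (elem_arr x c p)) a))"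
      using s.dom.comp_assoc[OF jel j.farr_closed[OF mu] h1] j_comp_el[OF mu c p] ev_mu[OF c p, of F a] by simp
    also have "\<dots> = i (fobj k c) (app (farr F (elem_arr x c p)) a)"
      using h c psh_app_closed[OF F t a] by (simp add: extends_def)
    also have "\<dots> = i x a \<cdot>\<^bsub>E\<^esub> elem_arr x c p" by (rule i(3)[OF t a])
    also have "\<dots> = (i x a \<cdot>\<^bsub>E\<^esub> \<rho> x) \<cdot>\<^bsub>E\<^esub> farr j (el (fobj s x) c p)"
      using s.dom.comp_assoc[OF jel \<rho>[OF x] i(2)[OF x a]] by (simp add: elem_arr_def)
    finally show "(h \<cdot>\<^bsub>E\<^esub> farr j (mu F x a)) \<cdot>\<^bsub>E\<^esub> farr j (el (fobj s x) c p) =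
        (i x a \<cdot>\<^bsub>E\<^esub> \<rho> x) \<cdot>\<^bsub>E\<^esub> farr j (el (fobj s x) c p)" .
  qed
qed

text \<open>An instance of \<open>ex_universal_arrow_of_retract\<close> with \<open>d\<close> equal
  to \<open>j (F k)\<close>. The retraction equation is \<open>extends_mu\<close>, with
  \<open>\<rho> x\<close> cancelled by \<open>\<rho>' x\<close>.\<close>

lemma ex_universal_arrow_yoneda:
  assumes F: "F \<in> Obj Eh"
  shows "\<exists>l \<eta>. universal_arrow Eh E (yoneda elts E) F l \<eta>"
proof -
  let ?d = "fobj j (fobj res F)"
  have d: "?d \<in> Obj E" by (rule j.fobj_closed[OF res.fobj_closed[OF F]])
  \<comment> \<open>The cocone of arrows \<open>j (mu F x a)\<close> starts at
    \<open>j (s x)\<close>; \<open>\<rho>'\<close> makes it start at \<open>x\<close>, so that it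
    corresponds to an arrow from \<open>F\<close> to a representable.\<close>
  define i where "i x a = farr j (mu F x a) \<cdot>\<^bsub>E\<^esub> \<rho>' x" for x a
  have jmu: "farr j (mu F x a) \<in> Hom E (fobj j (fobj s x)) ?d" if "x \<in> Obj E" "a \<in> elts (fobj F x)" for x a
    by (rule j.farr_closed[OF mu_closed[OF F that]])
  have i: "weighted_cocone elts E E F id_func ?d i"
  proof (rule weighted_coconeI[OF d])
    show "i x a \<in> Hom E (fobj id_func x) ?d" if "x \<in> Obj E" "a \<in> elts (fobj F x)" for x a
      unfolding i_def using s.dom.comp_closed[OF \<rho>'[OF that(1)] jmu[OF that]] by (simp add: id_func_def)
    show "i x (app (farr F f) a) = i y a \<cdot>\<^bsub>E\<^esub> farr id_func f"
      if f: "f \<in> Hom E x y" and a: "a \<in> elts (fobj F y)" for x y f a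
    proof -
      note x = s.dom.Hom_objD(1)[OF f] and y = s.dom.Hom_objD(2)[OF f]
      note sf = s.farr_closed[OF f]
      note jsf = j.farr_closed[OF sf]
      \<comment> \<open>Naturality of \<open>\<rho>'\<close>, derived from that of its inverse
        \<open>\<rho>\<close>.\<close>
      have "\<rho>' y \<cdot>\<^bsub>E\<^esub> f = \<rho>' y \<cdot>\<^bsub>E\<^esub> ((f \<cdot>\<^bsub>E\<^esub> \<rho> x) \<cdot>\<^bsub>E\<^esub> \<rho>' x)" by (simp add: comp_\<rho>_\<rho>'[OF f])
      also have "\<dots> = \<rho>' y \<cdot>\<^bsub>E\<^esub> (\<rho> y \<cdot>\<^bsub>E\<^esub> (farr j (farr s f) \<cdot>\<^bsub>E\<^esub> \<rho>' x))"
        using \<rho>_natural[OF f] s.dom.comp_assoc[OF \<rho>'[OF x] jsf \<rho>[OF y]] by simp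
      also have "\<dots> = farr j (farr s f) \<cdot>\<^bsub>E\<^esub> \<rho>' x"
        using s.dom.comp_assoc[OF s.dom.comp_closed[OF \<rho>'[OF x] jsf] \<rho>[OF y] \<rho>'[OF y]] \<rho>'\<rho>[OF y]
          s.dom.ident_left[OF s.dom.comp_closed[OF \<rho>'[OF x] jsf]] by simp
      finally have "\<rho>' y \<cdot>\<^bsub>E\<^esub> f = farr j (farr s f) \<cdot>\<^bsub>E\<^esub> \<rho>' x" .
      moreover have "farr j (mu F x (app (farr F f) a)) = farr j (mu F y a) \<cdot>\<^bsub>E\<^esub> farr j (farr s f)"
        using weighted_coconeD(3)[OF mu_cocone[OF F] f a] j.farr_comp[OF sf mu_closed[OF F y a]] by simp
      ultimately show ?thesis
        using s.dom.comp_assoc[OF f \<rho>'[OF y] jmu[OF y a]] s.dom.comp_assoc[OF \<rho>'[OF x] jsf jmu[OF y a]]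
        by (simp add: i_def id_func_def)
    qed
  qed
  define \<eta> where "\<eta> = arr_of_cocone elts E F ?d i"
  have \<eta>: "\<eta> \<in> Hom Eh F (representable elts E ?d)"
    unfolding \<eta>_def by (rule arr_of_cocone_closed[OF locally_small_E F i])
  \<comment> \<open>Extends the cocone of \<open>h\<close> over \<open>j (F k)\<close>. Its
    naturality in \<open>v\<close> below comes from the uniqueness of such extensions.\<close>
  define \<alpha> where "\<alpha> v h = (SOME g. extends F v (cocone_of_arr elts E v h) g)" for v h
  have cocone: "weighted_cocone elts E E F id_func v (cocone_of_arr elts E v h)"
    if "v \<in> Obj E" "h \<in> Hom Eh F (representable elts E v)" for v h
    by (rule cocone_of_arr_closed[OF locally_small_E that])
  have \<alpha>: "extends F v (cocone_of_arr elts E v h) (\<alpha> v h)"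
    if "v \<in> Obj E" "h \<in> Hom Eh F (representable elts E v)" for v h
    unfolding \<alpha>_def by (rule someI_ex[OF ex_extends[OF F cocone[OF that]]])
  show ?thesis
  proof (rule ex_universal_arrow_of_retract[OF y.cat_functor_axioms idempotents_split_E d, unfolded fobj_yoneda, OF \<eta>])
    show closed: "\<alpha> v h \<in> Hom E ?d v" if "v \<in> Obj E" "h \<in> Hom Eh F (representable elts E v)" for v h
      using \<alpha>[OF that] by (simp add: extends_def)
    show "farr (yoneda elts E) (\<alpha> v h) \<cdot>\<^bsub>Eh\<^esub> \<eta> = h"
      if v: "v \<in> Obj E" and h: "h \<in> Hom Eh F (representable elts E v)" for v h
    proof (rule cocone_of_arr_inject[OF locally_small_E v
          Eh.comp_closed[OF \<eta> farr_yoneda_closed[OF locally_small_E closed[OF v h]]] h])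
      fix x a assume x: "x \<in> Obj E" and a: "a \<in> elts (fobj F x)"
      have "cocone_of_arr elts E v (farr (yoneda elts E) (\<alpha> v h) \<cdot>\<^bsub>Eh\<^esub> \<eta>) x a = \<alpha> v h \<cdot>\<^bsub>E\<^esub> i x a"
        using cocone_of_arr_comp[OF locally_small_E closed[OF v h] \<eta> x a]
          cocone_of_arr_of_cocone[OF locally_small_E i x a] by (simp add: \<eta>_def)
      also have "\<dots> = (cocone_of_arr elts E v h x a \<cdot>\<^bsub>E\<^esub> \<rho> x) \<cdot>\<^bsub>E\<^esub> \<rho>' x"
        using s.dom.comp_assoc[OF \<rho>'[OF x] jmu[OF x a] closed[OF v h]]
          extends_mu[OF F cocone[OF v h] \<alpha>[OF v h] x a] by (simp add: i_def)
      also have "\<dots> = cocone_of_arr elts E v h x a"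
        using comp_\<rho>_\<rho>'[OF weighted_coconeD(2)[OF cocone[OF v h] x a]] by (simp add: id_func_def)
      finally show "cocone_of_arr elts E v (farr (yoneda elts E) (\<alpha> v h) \<cdot>\<^bsub>Eh\<^esub> \<eta>) x a = cocone_of_arr elts E v h x a" .
    qed
    show "\<alpha> w (farr (yoneda elts E) g \<cdot>\<^bsub>Eh\<^esub> h) = g \<cdot>\<^bsub>E\<^esub> \<alpha> v h"
      if h: "h \<in> Hom Eh F (representable elts E v)" and g: "g \<in> Hom E v w" for v w h g
    proof (rule extends_unique[OF F])
      note v = s.dom.Hom_objD(1)[OF g] and w = s.dom.Hom_objD(2)[OF g]
      note gh = Eh.comp_closed[OF h farr_yoneda_closed[OF locally_small_E g]]
      show "extends F w (cocone_of_arr elts E w (farr (yoneda elts E) g \<cdot>\<^bsub>Eh\<^esub> h))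
        (\<alpha> w (farr (yoneda elts E) g \<cdot>\<^bsub>Eh\<^esub> h))" by (rule \<alpha>[OF w gh])
      show "extends F w (\<lambda>x a. g \<cdot>\<^bsub>E\<^esub> cocone_of_arr elts E v h x a) (g \<cdot>\<^bsub>E\<^esub> \<alpha> v h)"
        by (rule extends_comp[OF F \<alpha>[OF v h] g])
    qed (rule cocone_of_arr_comp[OF locally_small_E g h])
  qed
qed

text \<open>For \<open>t\<close>, the map \<open>h \<mapsto> \<phi> \<cdot> s h\<close> from
  \<open>E(v, c F)\<close> to \<open>P(s v, F k)\<close> needs a left inverse natural in
  \<open>F\<close>. An arrow \<open>\<epsilon> : j (F k) \<rightarrow> c F\<close> supplies it as
  \<open>\<theta> \<mapsto> \<epsilon> \<cdot> j \<theta> \<cdot> \<rho>'\<close>, because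
  \<open>\<epsilon> \<cdot> j \<phi> = \<rho>\<close>.\<close>

lemma totally_distributive_E: "totally_distributive elts E"
proof -
  obtain c where c: "adjoint Eh E c (yoneda elts E)"
    using ex_left_adjoint[OF y.cat_functor_axioms Eh.category_axioms ex_universal_arrow_yoneda] by blast
  interpret c: cat_functor Eh E c using c by (simp add: adjoint_def)
  obtain \<eta> where \<eta>: "\<And>F. F \<in> Obj Eh \<Longrightarrow> universal_arrow Eh E (yoneda elts E) F (fobj c F) (\<eta> F)"
    and \<eta>_nat: "\<And>F G m. m \<in> Hom Eh F G \<Longrightarrow> farr (yoneda elts E) (farr c m) \<cdot>\<^bsub>Eh\<^esub> \<eta> F = \<eta> G \<cdot>\<^bsub>Eh\<^esub> m"
    using adjoint_unit[OF c] by blast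
  have \<eta>_closed: "\<eta> F \<in> Hom Eh F (representable elts E (fobj c F))" if "F \<in> Obj Eh" for F
    using \<eta>[OF that] by (simp add: universal_arrow_def)
  define inc where "inc F = cocone_of_arr elts E (fobj c F) (\<eta> F)" for F
  have col: "weighted_colimit elts E E F id_func (fobj c F) (inc F)" if "F \<in> Obj Eh" for F
    unfolding inc_def by (rule weighted_colimit_of_universal_arrow[OF locally_small_E \<eta>[OF that]])
  note cocone = weighted_colimit_cocone[OF col]
  have inc: "inc F x a \<in> Hom E x (fobj c F)" if "F \<in> Obj Eh" "x \<in> Obj E" "a \<in> elts (fobj F x)" for F x a
    using weighted_coconeD(2)[OF cocone[OF that(1)] that(2,3)] by (simp add: id_func_def)
  have inc_nat: "farr c m \<cdot>\<^bsub>E\<^esub> inc F x a = inc G x (ev m x a)"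
    if m: "m \<in> Hom Eh F G" and x: "x \<in> Obj E" and a: "a \<in> elts (fobj F x)" for F G m x a
    using cocone_of_arr_comp[OF locally_small_E c.farr_closed[OF m] \<eta>_closed[OF Eh.Hom_objD(1)[OF m]] x a]
      \<eta>_nat[OF m] ev_comp[OF m \<eta>_closed[OF Eh.Hom_objD(2)[OF m]] x a]
    by (simp add: inc_def cocone_of_arr_def)
  have id_E: "cat_functor E E id_func" by (rule cat_functor_id_func[OF s.dom.category_axioms])
  \<comment> \<open>\<open>c F\<close> is the colimit of the identity functor weighted by
    \<open>F\<close>, so its image under the left adjoint \<open>s\<close> is the colimit of
    \<open>s\<close> with the same weight.\<close>
  have s_col: "weighted_colimit elts E P F s (fobj s (fobj c F)) (\<lambda>x a. farr s (inc F x a))"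
    if "F \<in> Obj Eh" for F
    using weighted_colimit_left_adjoint[OF id_E s_adjoint col[OF that]] by simp
  have "\<exists>\<phi>. \<phi> \<in> Hom P (fobj s (fobj c F)) (fobj res F) \<and>
      (\<forall>x\<in>Obj E. \<forall>a\<in>elts (fobj F x). \<phi> \<cdot>\<^bsub>P\<^esub> farr s (inc F x a) = mu F x a)" if "F \<in> Obj Eh" for F
    using weighted_colimit_ex[OF s_col[OF that] mu_cocone[OF that]] by metis
  then obtain \<phi> where \<phi>: "\<And>F. F \<in> Obj Eh \<Longrightarrow> \<phi> F \<in> Hom P (fobj s (fobj c F)) (fobj res F)"
    and \<phi>_inc: "\<And>F x a. F \<in> Obj Eh \<Longrightarrow> x \<in> Obj E \<Longrightarrow> a \<in> elts (fobj F x) \<Longrightarrow>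
      \<phi> F \<cdot>\<^bsub>P\<^esub> farr s (inc F x a) = mu F x a"
    by metis
  \<comment> \<open>The colimit legs of \<open>c F\<close> at the objects \<open>k c\<close>,
    assembled to an arrow out of \<open>j (F k)\<close>.\<close>
  obtain \<epsilon> where \<epsilon>: "\<And>F. F \<in> Obj Eh \<Longrightarrow> extends F (fobj c F) (inc F) (\<epsilon> F)"
    using ex_extends[OF _ cocone] by metis
  have \<epsilon>_closed: "\<epsilon> F \<in> Hom E (fobj j (fobj res F)) (fobj c F)" if "F \<in> Obj Eh" for F
    using \<epsilon>[OF that] by (simp add: extends_def)
  \<comment> \<open>On the leg at \<open>a\<close>, both sides are
    \<open>mu G x (ev m x a)\<close>.\<close>
  have \<phi>_nat: "farr res m \<cdot>\<^bsub>P\<^esub> \<phi> F = \<phi> G \<cdot>\<^bsub>P\<^esub> farr s (farr c m)" if m: "m \<in> Hom Eh F G" for F G m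
  proof -
    note F = Eh.Hom_objD(1)[OF m] and G = Eh.Hom_objD(2)[OF m]
    note rm = res.farr_closed[OF m] and cm = c.farr_closed[OF m]
    note scm = s.farr_closed[OF cm]
    show ?thesis
    proof (rule weighted_colimit_eqI[OF s.cat_functor_axioms s_col[OF F]
          s.cod.comp_closed[OF \<phi>[OF F] rm] s.cod.comp_closed[OF scm \<phi>[OF G]]])
      fix x a assume x: "x \<in> Obj E" and a: "a \<in> elts (fobj F x)"
      note i = inc[OF F x a]
      show "(farr res m \<cdot>\<^bsub>P\<^esub> \<phi> F) \<cdot>\<^bsub>P\<^esub> farr s (inc F x a) = (\<phi> G \<cdot>\<^bsub>P\<^esub> farr s (farr c m)) \<cdot>\<^bsub>P\<^esub> farr s (inc F x a)"
        using s.cod.comp_assoc[OF s.farr_closed[OF i] \<phi>[OF F] rm] \<phi>_inc[OF F x a] mu_natural[OF m x a]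
          s.cod.comp_assoc[OF s.farr_closed[OF i] scm \<phi>[OF G]] s.farr_comp[OF i cm] inc_nat[OF m x a]
          \<phi>_inc[OF G x ev_closed[OF m x a]] by simp
    qed
  qed
  \<comment> \<open>On the leg at \<open>q\<close>, both sides are
    \<open>inc G (k d) (ev m (k d) q)\<close>.\<close>
  have \<epsilon>_nat: "farr c m \<cdot>\<^bsub>E\<^esub> \<epsilon> F = \<epsilon> G \<cdot>\<^bsub>E\<^esub> farr j (farr res m)" if m: "m \<in> Hom Eh F G" for F G m
  proof -
    note F = Eh.Hom_objD(1)[OF m] and G = Eh.Hom_objD(2)[OF m]
    note rm = res.farr_closed[OF m] and cm = c.farr_closed[OF m]
    note jrm = j.farr_closed[OF rm]
    show ?thesis
    proof (rule j_eqI[OF res.fobj_closed[OF F] s.dom.comp_closed[OF \<epsilon>_closed[OF F] cm]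
          s.dom.comp_closed[OF jrm \<epsilon>_closed[OF G]]])
      fix d q assume d: "d \<in> Obj C" and q: "q \<in> elts (fobj (fobj res F) d)"
      have q': "q \<in> elts (fobj F (fobj k d))" using d q by simp
      note kd = k.fobj_closed[OF d] and jel = j_el_closed[OF res.fobj_closed[OF F] d q]
      show "(farr c m \<cdot>\<^bsub>E\<^esub> \<epsilon> F) \<cdot>\<^bsub>E\<^esub> farr j (el (fobj res F) d q) =
          (\<epsilon> G \<cdot>\<^bsub>E\<^esub> farr j (farr res m)) \<cdot>\<^bsub>E\<^esub> farr j (el (fobj res F) d q)"
        using s.dom.comp_assoc[OF jel \<epsilon>_closed[OF F] cm] s.dom.comp_assoc[OF jel jrm \<epsilon>_closed[OF G]]
          \<epsilon>[OF F] \<epsilon>[OF G] d q' inc_nat[OF m kd q'] j_comp_el[OF rm d q] ev_restriction[OF d q' m]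
          ev_closed[OF m kd q']
        by (simp add: extends_def)
    qed
  qed
  \<comment> \<open>The colimit is preserved by \<open>j\<close> too, so test on the legs
    \<open>j (s (inc F x a))\<close>. There the left side is
    \<open>\<epsilon> \<cdot> j (mu F x a)\<close>, which is
    \<open>inc F x a \<cdot> \<rho> x\<close> by \<open>extends_mu\<close>, and
    \<open>\<rho>\<close> is natural.\<close>
  have \<epsilon>\<phi>: "\<epsilon> F \<cdot>\<^bsub>E\<^esub> farr j (\<phi> F) = \<rho> (fobj c F)" if F: "F \<in> Obj Eh" for F
  proof (rule weighted_colimit_eqI[OF cat_functor_comp_func[OF s.cat_functor_axioms j.cat_functor_axioms]
        weighted_colimit_left_adjoint[OF s.cat_functor_axioms j_adjoint s_col[OF F]]
        s.dom.comp_closed[OF j.farr_closed[OF \<phi>[OF F]] \<epsilon>_closed[OF F]] \<rho>[OF c.fobj_closed[OF F]]])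
    fix x a assume x: "x \<in> Obj E" and a: "a \<in> elts (fobj F x)"
    note i = inc[OF F x a]
    note si = s.farr_closed[OF i]
    show "(\<epsilon> F \<cdot>\<^bsub>E\<^esub> farr j (\<phi> F)) \<cdot>\<^bsub>E\<^esub> farr j (farr s (inc F x a)) = \<rho> (fobj c F) \<cdot>\<^bsub>E\<^esub> farr j (farr s (inc F x a))"
      using s.dom.comp_assoc[OF j.farr_closed[OF si] j.farr_closed[OF \<phi>[OF F]] \<epsilon>_closed[OF F]]
        j.farr_comp[OF si \<phi>[OF F]] \<phi>_inc[OF F x a] extends_mu[OF F cocone[OF F] \<epsilon>[OF F] x a] \<rho>_natural[OF i]
      by simp
  qed
  have "\<exists>l \<eta>. universal_arrow E Eh c v l \<eta>" if v: "v \<in> Obj E" for v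
  proof -
    have small_Obj: "small elts (Obj C)" using small_C by (simp add: small_category_def)
    note sv = s.fobj_closed[OF v]
    obtain T u where Tu: "universal_arrow P Eh res (fobj s v) T u"
      using ex_universal_arrow_restriction[OF small_Obj locally_small_E cat_functor_k sv] by blast
    have T: "T \<in> Obj Eh" and u: "u \<in> Hom P (fobj s v) (fobj res T)"
      using Tu by (simp_all add: universal_arrow_def)
    have ex1: "\<exists>!\<tau>. \<tau> \<in> Hom Eh T F \<and> farr res \<tau> \<cdot>\<^bsub>P\<^esub> u = \<theta>"
      if "F \<in> Obj Eh" "\<theta> \<in> Hom P (fobj s v) (fobj res F)" for F \<theta>
      using Tu that by (simp add: universal_arrow_def)
    \<comment> \<open>The transpose of \<open>\<phi> \<cdot> s h\<close> under the universal
      property of the Kan extension \<open>T\<close> of \<open>s v\<close> along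
      \<open>k\<close>.\<close>
    define \<alpha> where "\<alpha> F h = (THE \<tau>. \<tau> \<in> Hom Eh T F \<and> farr res \<tau> \<cdot>\<^bsub>P\<^esub> u = \<phi> F \<cdot>\<^bsub>P\<^esub> farr s h)" for F h
    have \<phi>s: "\<phi> F \<cdot>\<^bsub>P\<^esub> farr s h \<in> Hom P (fobj s v) (fobj res F)"
      if "F \<in> Obj Eh" "h \<in> Hom E v (fobj c F)" for F h
      by (rule s.cod.comp_closed[OF s.farr_closed[OF that(2)] \<phi>[OF that(1)]])
    have \<alpha>: "\<alpha> F h \<in> Hom Eh T F" and \<alpha>u: "farr res (\<alpha> F h) \<cdot>\<^bsub>P\<^esub> u = \<phi> F \<cdot>\<^bsub>P\<^esub> farr s h"
      if "F \<in> Obj Eh" "h \<in> Hom E v (fobj c F)" for F h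
      using theI'[OF ex1[OF that(1) \<phi>s[OF that]]] by (simp_all add: \<alpha>_def)
    note ju = j.farr_closed[OF u]
    \<comment> \<open>The image of the unit \<open>u\<close> under the left inverse \<open>\<theta>
      \<mapsto> \<epsilon> \<cdot> j \<theta> \<cdot> \<rho>'\<close>.\<close>
    define \<eta>T where "\<eta>T = (\<epsilon> T \<cdot>\<^bsub>E\<^esub> farr j u) \<cdot>\<^bsub>E\<^esub> \<rho>' v"
    note \<epsilon>u = s.dom.comp_closed[OF ju \<epsilon>_closed[OF T]]
    have \<eta>T: "\<eta>T \<in> Hom E v (fobj c T)" unfolding \<eta>T_def by (rule s.dom.comp_closed[OF \<rho>'[OF v] \<epsilon>u])
    show ?thesis
    proof (rule ex_universal_arrow_of_retract[where \<alpha> = \<alpha>, OF c.cat_functor_axioms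
          idempotents_split_presheaf_cat[OF s.dom.category_axioms] T \<eta>T \<alpha>])
      fix F h assume F: "F \<in> Obj Eh" and h: "h \<in> Hom E v (fobj c F)"
      note a = \<alpha>[OF F h] and sh = s.farr_closed[OF h]
      note ra = res.farr_closed[OF a] and ca = c.farr_closed[OF a] and jsh = j.farr_closed[OF sh]
      \<comment> \<open>Naturality of \<open>\<epsilon>\<close> moves \<open>\<alpha> F h\<close>
        next to \<open>u\<close>, where it becomes \<open>\<phi> \<cdot> s h\<close>; then
        \<open>\<epsilon>\<phi>\<close> applies.\<close>
      have "farr c (\<alpha> F h) \<cdot>\<^bsub>E\<^esub> (\<epsilon> T \<cdot>\<^bsub>E\<^esub> farr j u) = \<epsilon> F \<cdot>\<^bsub>E\<^esub> farr j (farr res (\<alpha> F h) \<cdot>\<^bsub>P\<^esub> u)"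
        using s.dom.comp_assoc[OF ju \<epsilon>_closed[OF T] ca] \<epsilon>_nat[OF a]
          s.dom.comp_assoc[OF ju j.farr_closed[OF ra] \<epsilon>_closed[OF F]] j.farr_comp[OF u ra] by simp
      also have "\<dots> = (\<epsilon> F \<cdot>\<^bsub>E\<^esub> farr j (\<phi> F)) \<cdot>\<^bsub>E\<^esub> farr j (farr s h)"
        using \<alpha>u[OF F h] j.farr_comp[OF sh \<phi>[OF F]]
          s.dom.comp_assoc[OF jsh j.farr_closed[OF \<phi>[OF F]] \<epsilon>_closed[OF F]] by simp
      also have "\<dots> = h \<cdot>\<^bsub>E\<^esub> \<rho> v" using \<epsilon>\<phi>[OF F] \<rho>_natural[OF h] by simp
      finally show "farr c (\<alpha> F h) \<cdot>\<^bsub>E\<^esub> \<eta>T = h"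
        using s.dom.comp_assoc[OF \<rho>'[OF v] \<epsilon>u ca] comp_\<rho>_\<rho>'[OF h] by (simp add: \<eta>T_def)
    next
      fix F G h m assume h: "h \<in> Hom E v (fobj c F)" and m: "m \<in> Hom Eh F G"
      note F = Eh.Hom_objD(1)[OF m] and G = Eh.Hom_objD(2)[OF m]
      note cm = c.farr_closed[OF m] and rm = res.farr_closed[OF m] and sh = s.farr_closed[OF h]
      note cmh = s.dom.comp_closed[OF h cm]
      note a = \<alpha>[OF F h]
      \<comment> \<open>Naturality of \<open>\<alpha>\<close>: the two arrows have the same
        transpose, by \<open>\<phi>_nat\<close>.\<close>
      have "farr res (m \<cdot>\<^bsub>Eh\<^esub> \<alpha> F h) \<cdot>\<^bsub>P\<^esub> u = farr res m \<cdot>\<^bsub>P\<^esub> (\<phi> F \<cdot>\<^bsub>P\<^esub> farr s h)"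
        using res.farr_comp[OF a m] s.cod.comp_assoc[OF u res.farr_closed[OF a] rm] \<alpha>u[OF F h] by simp
      also have "\<dots> = (\<phi> G \<cdot>\<^bsub>P\<^esub> farr s (farr c m)) \<cdot>\<^bsub>P\<^esub> farr s h"
        using s.cod.comp_assoc[OF sh \<phi>[OF F] rm] \<phi>_nat[OF m] by simp
      also have "\<dots> = \<phi> G \<cdot>\<^bsub>P\<^esub> farr s (farr c m \<cdot>\<^bsub>E\<^esub> h)"
        using s.cod.comp_assoc[OF sh s.farr_closed[OF cm] \<phi>[OF G]] s.farr_comp[OF h cm] by simp
      finally have "farr res (m \<cdot>\<^bsub>Eh\<^esub> \<alpha> F h) \<cdot>\<^bsub>P\<^esub> u = \<phi> G \<cdot>\<^bsub>P\<^esub> farr s (farr c m \<cdot>\<^bsub>E\<^esub> h)" .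
      then show "\<alpha> G (farr c m \<cdot>\<^bsub>E\<^esub> h) = m \<cdot>\<^bsub>Eh\<^esub> \<alpha> F h"
        using ex1[OF G \<phi>s[OF G cmh]] \<alpha>[OF G cmh] \<alpha>u[OF G cmh] Eh.comp_closed[OF a m] by blast
    qed
  qed
  then obtain t where "adjoint E Eh t c"
    using ex_left_adjoint[OF c.cat_functor_axioms s.dom.category_axioms] by blast
  then show ?thesis using c locally_small_E unfolding totally_distributive_def by blast
qed

end

theorem proposition1p5p4:
  fixes elts :: "'u \<Rightarrow> 'u set" and E :: "('o, 'a) cat"
  assumes "grothendieck_universe elts" and "quasi_injective_topos elts E"
  shows "totally_distributive elts E"
proof -
  obtain C :: "('u, 'u) cat" and i r where C: "small_category elts C"
    and i: "geometric_morphism E (presheaf_cat elts C) i"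
    and r: "geometric_morphism (presheaf_cat elts C) E r"
    and iso: "geom_isomorphic E E (geom_comp r i) geom_id"
    using assms(2) unfolding quasi_injective_topos_def geom_retract_def by blast
  let ?s = "inverse_image r" and ?j = "inverse_image i"
  have adj: "adjoint E (presheaf_cat elts C) ?s (direct_image r)"
    "adjoint (presheaf_cat elts C) E ?j (direct_image i)"
    using i r by (simp_all add: geometric_morphism_def)
  \<comment> \<open>2-cells are read on inverse images, which compose in the opposite order; so the
    isomorphism from \<open>r i\<close> to the identity is one from \<open>?j ?s\<close> to the
    identity functor of \<open>E\<close>.\<close>
  obtain \<rho> where nat: "natural E E (comp_func ?j ?s) id_func \<rho>" and iso: "\<And>x. x \<in> Obj E \<Longrightarrow> iso_arr E (\<rho> x)"
    using iso by (auto simp: geom_isomorphic_def geom_comp_def geom_id_def naturally_isomorphic_def)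
  have \<rho>: "\<rho> x \<in> Hom E (fobj ?j (fobj ?s x)) x" if "x \<in> Obj E" for x
    using nat that by (simp add: natural_def comp_func_def id_func_def)
  have \<rho>_natural: "\<rho> y \<cdot>\<^bsub>E\<^esub> farr ?j (farr ?s f) = f \<cdot>\<^bsub>E\<^esub> \<rho> x" if "f \<in> Hom E x y" for f x y
    using nat HomD[OF that] by (auto simp: natural_def comp_func_def id_func_def)
  have "\<exists>g. g \<in> Hom E x (fobj ?j (fobj ?s x)) \<and> \<rho> x \<cdot>\<^bsub>E\<^esub> g = Ident E x \<and>
      g \<cdot>\<^bsub>E\<^esub> \<rho> x = Ident E (fobj ?j (fobj ?s x))" if "x \<in> Obj E" for x
    using iso[OF that] HomD[OF \<rho>[OF that]] unfolding iso_arr_def by auto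
  then obtain \<rho>' where \<rho>': "\<And>x. x \<in> Obj E \<Longrightarrow> \<rho>' x \<in> Hom E x (fobj ?j (fobj ?s x)) \<and>
      \<rho> x \<cdot>\<^bsub>E\<^esub> \<rho>' x = Ident E x \<and> \<rho>' x \<cdot>\<^bsub>E\<^esub> \<rho> x = Ident E (fobj ?j (fobj ?s x))"
    by metis
  interpret grothendieck_universe elts by fact
  interpret section_adjoints elts C E ?s "direct_image r" ?j "direct_image i" \<rho> \<rho>'
    by unfold_locales (use C adj \<rho> \<rho>' \<rho>_natural in auto)
  show ?thesis by (rule totally_distributive_E)
qed

end
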